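(* Let $\mathcal{M}=(\mathbb{R}^+\times\mathbb{R},\nabla)$, where $\nabla$ is a non-flat torsion-free connection with Christoffel symbols $\Gamma_{ij}{}^k=(x^1)^{-1}C_{ij}{}^k$, $C_{ij}{}^k=C_{ji}{}^k$ constant. Then $2\le\dim\{\mathfrak{K}(\mathcal{M})\}\le4$. Put $\mathfrak{K}_0^{\mathcal{B}}:=\operatorname{Span}\{x^1\partial_1+x^2\partial_2,\partial_2\}$. \begin{enumerate} \item If $\dim\{\mathfrak{K}(\mathcal{M})\}=4$, then $\rho=(x^1)^{-2}\tilde\rho_{11}\,dx^1\otimes dx^1$, $C_{12}{}^1=C_{22}{}^1=C_{22}{}^2=0$, $\mathcal{M}$ is also of Type $\mathcal{A}$, and up to linear equivalence one of the following three possibilities holds: \begin{enumerate} \item $C_{11}{}^1-2C_{12}{}^2=0$, $C_{11}{}^2=1$, $\tilde\rho_{11}=(1+C_{12}{}^2)C_{12}{}^2\ne0$, and $\mathfrak{K}(\mathcal{M})=\operatorname{Span}\{x^1\partial_1-x^1\log(x^1)\partial_2,\;x^1\partial_2\}\oplus\mathfrak{K}_0^{\mathcal{B}}$. \item $C_{11}{}^2=0$, $\tilde\rho_{11}=(1+C_{11}{}^1-C_{12}{}^2)C_{12}{}^2\ne0$, and $\mathfrak{K}(\mathcal{M})=\operatorname{Span}\{x^1\partial_1,(x^1)^a\partial_2\}\oplus\mathfrak{K}_0^{\mathcal{B}}$ for some $a\ne0$. \item $C_{11}{}^2=0$, $\tilde\rho_{11}=(C_{12}{}^2)^2\ne0$,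 and $\mathfrak{K}(\mathcal{M})=\operatorname{Span}\{x^1\partial_1,\log(x^1)\partial_2\}\oplus\mathfrak{K}_0^{\mathcal{B}}$. \end{enumerate} \item If $\dim\{\mathfrak{K}(\mathcal{M})\}=3$, then $\mathfrak{K}(\mathcal{M})=\operatorname{Span}\{X(\sigma)\}\oplus\mathfrak{K}_0^{\mathcal{B}}\approx\mathfrak{su}(1,1)$ where $$X(\sigma):=2x^1x^2\partial_1+\{(x^2)^2+\sigma\cdot(x^1)^2\}\partial_2\quad\text{for }\sigma\in\{-1,0,1\},$$ $\mathcal{M}$ is not of Type $\mathcal{A}$, and up to linear equivalence, one of the following possibilities holds: \begin{enumerate} \item $\sigma=0$, $\mathcal{M}=\mathcal{N}_1^\pm$, and $\mathcal{M}$ is not of Type $\mathcal{C}$. \item $\sigma=0$, $\mathcal{M}=\mathcal{N}_2^c$ (with $c\ge0$), and $\mathcal{M}$ is not of Type $\mathcal{C}$. \item $\sigma=1$, $\mathcal{M}=\mathcal{N}_3$, and $\mathcal{M}$ is of Type $\mathcal{C}$. \item $\sigma=-1$, $\mathcal{M}=\mathcal{N}_4$, and $\mathcal{M}$ is of Type $\mathcal{C}$. \end{enumerate} \item For each of the three structures listed in Assertion 1, $\dim\{\mathfrak{K}(\mathcal{M})\}=4$. For each of the four structures listed in Assertion 2, $\dim\{\mathfrak{K}(\mathcal{M})\}=3$. \end{enumerate}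
   Context: $\partial_i:=\partial_{x^i}$; $\nabla_{\partial_i}\partial_j=\Gamma_{ij}{}^k\partial_k$. $R(\xi_1,\xi_2)=\nabla_{\xi_1}\nabla_{\xi_2}-\nabla_{\xi_2}\nabla_{\xi_1}-\nabla_{[\xi_1,\xi_2]}$ and $\rho(\xi_1,\xi_2)=\operatorname{Tr}\{\xi_3\mapsto R(\xi_3,\xi_1)\xi_2\}$. A vector field $X$ is affine Killing if $\mathcal{L}_X\nabla=0$; $\mathfrak{K}(\mathcal{M})$ is the Lie algebra of these fields. A locally homogeneous non-flat affine surface is of Type $\mathcal{A}$ if near each point there are local coordinates with constant Christoffel symbols, and of Type $\mathcal{C}$ if $\nabla$ is locally the Levi-Civita connection of a (pseudo-Riemannian) metric of constant sectional curvature. Let $C=(C_{ij}{}^k)$ and $\tilde C=(\tilde C_{ij}{}^k)$ be two collections of real constants, symmetric in $i,j$, defining non-flat torsion-free connections on $\mathbb{R}^+\times\mathbb{R}$ with Christoffel symbols $(x^1)^{-1}C_{ij}{}^k$ and $(x^1)^{-1}\tilde C_{ij}{}^k$ respectively. The two structures are linearly equivalent if $\tilde C=T^*C$ (i.e. the connection defined by $\tilde C$ is the pull-back by $T$ of the connection defined by $C$) for some $T:(x^1,x^2)\mapsto(x^1,bx^1+cx^2)$ with $b\in\mathbb{R}$, $c\ne0$. $\mathfrak{su}(1,1)$ is the 3-dimensional real Lie algebra with $[e_1,e_2]=e_1$, $[e_2,e_3]=e_3$, $[e_1,e_3]=-2e_2$. The surfaces $\mathcal{N}$ on $\mathbb{R}^+\times\mathbb{R}$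 are given, for $c\ge0$, by $\Gamma=(x^1)^{-1}C$ with $(C_{11}{}^1,C_{11}{}^2,C_{12}{}^1,C_{12}{}^2,C_{22}{}^1,C_{22}{}^2)$ equal to: $\mathcal{N}_1^\pm$: $(-\frac32,0,0,-\frac12,\mp\frac12,0)$; $\mathcal{N}_2^c$: $(-\frac32,0,1,-\frac12,c,2)$; $\mathcal{N}_3$: $(-1,0,0,-1,-1,0)$; $\mathcal{N}_4$: $(-1,0,0,-1,1,0)$.
   Formalization: In Assertions 2(b) and 3 the family N_2^c is taken for all real c instead of c≥0: as printed the list is incomplete, since N_2^{-1} has a 3-dimensional Killing algebra but is linearly equivalent to none of N_1^±, N_2^c (c≥0), N_3, N_4. *)

theory Defs
  imports "HOL-Analysis.Analysis" "HOL-Library.Function_Algebras"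
begin

text \<open>Vector fields are functions; the pointwise real vector space structure on functions makes
  \<^const>\<open>span\<close>, \<^const>\<open>dim\<close> and \<^const>\<open>linear\<close> available for spaces of vector fields.\<close>

instantiation "fun" :: (type, real_vector) real_vector
begin

definition scaleR_fun :: "real \<Rightarrow> ('a \<Rightarrow> 'b) \<Rightarrow> 'a \<Rightarrow> 'b" where
  "scaleR_fun r f = (\<lambda>x. r *\<^sub>R f x)"

instance
  by standard (auto simp: scaleR_fun_def fun_eq_iff scaleR_add_right scaleR_add_left)

end

text \<open>\<open>is_direct_sum K S T\<close>: \<open>K\<close> is the internal direct sum of the subspaces \<open>S\<close> and \<open>T\<close>.\<close>

definition is_direct_sum :: "'a::real_vector set \<Rightarrow> 'a set \<Rightarrow> 'a set \<Rightarrow> bool" where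
  "is_direct_sum K S T \<longleftrightarrow> K = {a + b |a b. a \<in> S \<and> b \<in> T} \<and> S \<inter> T = {0}"

type_synonym point = "real^2"
type_synonym vfield = "point \<Rightarrow> real^2"

definition partial :: "2 \<Rightarrow> (point \<Rightarrow> real) \<Rightarrow> point \<Rightarrow> real" where
  "partial i f p = frechet_derivative f (at p) (axis i 1)"

text \<open>On an open set \<open>U\<close>, \<open>Ck_on k U\<close> is the usual class of \<open>k\<close> times continuously
  differentiable functions.\<close>

fun Ck_on :: "nat \<Rightarrow> point set \<Rightarrow> (point \<Rightarrow> real) \<Rightarrow> bool" where
  "Ck_on 0 U f \<longleftrightarrow> continuous_on U f"
| "Ck_on (Suc k) U f \<longleftrightarrow> f differentiable_on U \<and> (\<forall>i. Ck_on k U (partial i f))"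

definition smooth_on :: "point set \<Rightarrow> (point \<Rightarrow> real) \<Rightarrow> bool" where
  "smooth_on U f \<longleftrightarrow> (\<forall>k. Ck_on k U f)"

definition smooth_map_on :: "point set \<Rightarrow> (point \<Rightarrow> real^2) \<Rightarrow> bool" where
  "smooth_map_on U F \<longleftrightarrow> (\<forall>k. smooth_on U (\<lambda>p. F p $ k))"

definition diffeo :: "point set \<Rightarrow> (point \<Rightarrow> point) \<Rightarrow> point set \<Rightarrow> bool" where
  "diffeo V \<phi> W \<longleftrightarrow> open V \<and> open W \<and> bij_betw \<phi> V W \<and>
     smooth_map_on V \<phi> \<and> smooth_map_on W (inv_into V \<phi>)"

text \<open>Two functions that agree on \<open>U\<close> are the same vector field on \<open>U\<close>; the normalisation to
  \<open>0\<close> off \<open>U\<close> picks one representative, so that \<^const>\<open>dim\<close> counts what it should.\<close>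

definition vector_field :: "point set \<Rightarrow> vfield \<Rightarrow> bool" where
  "vector_field U X \<longleftrightarrow> smooth_map_on U X \<and> (\<forall>p. p \<notin> U \<longrightarrow> X p = 0)"

definition restrict_vf :: "point set \<Rightarrow> vfield \<Rightarrow> vfield" where
  "restrict_vf U X = (\<lambda>p. if p \<in> U then X p else 0)"

definition directional :: "vfield \<Rightarrow> (point \<Rightarrow> real) \<Rightarrow> point \<Rightarrow> real" where
  "directional X f p = (\<Sum>i\<in>UNIV. X p $ i * partial i f p)"

definition lie_bracket :: "vfield \<Rightarrow> vfield \<Rightarrow> vfield" where
  "lie_bracket X Y p =
     (\<chi> k. directional X (\<lambda>q. Y q $ k) p - directional Y (\<lambda>q. X q $ k) p)"

text \<open>A connection on an open subset of the plane is given by its Christoffel symbols;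
  \<open>\<Gamma> p i j k\<close> is the value at \<open>p\<close> of the symbol with lower indices \<open>i\<close>, \<open>j\<close> and
  upper index \<open>k\<close>.\<close>

type_synonym connection = "point \<Rightarrow> 2 \<Rightarrow> 2 \<Rightarrow> 2 \<Rightarrow> real"

definition cov_deriv :: "connection \<Rightarrow> vfield \<Rightarrow> vfield \<Rightarrow> vfield" where
  "cov_deriv \<Gamma> X Y p =
     (\<chi> k. directional X (\<lambda>q. Y q $ k) p +
           (\<Sum>i\<in>UNIV. \<Sum>j\<in>UNIV. \<Gamma> p i j k * X p $ i * Y p $ j))"

definition curvature :: "connection \<Rightarrow> vfield \<Rightarrow> vfield \<Rightarrow> vfield \<Rightarrow> vfield" where
  "curvature \<Gamma> X Y Z p =
     cov_deriv \<Gamma> X (cov_deriv \<Gamma> Y Z) p - cov_deriv \<Gamma> Y (cov_deriv \<Gamma> X Z) p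
       - cov_deriv \<Gamma> (lie_bracket X Y) Z p"

definition ricci :: "connection \<Rightarrow> vfield \<Rightarrow> vfield \<Rightarrow> point \<Rightarrow> real" where
  "ricci \<Gamma> X Y p = trace (\<chi> k i. curvature \<Gamma> (\<lambda>_. axis i 1) X Y p $ k)"

definition flat :: "point set \<Rightarrow> connection \<Rightarrow> bool" where
  "flat U \<Gamma> \<longleftrightarrow> (\<forall>X Y Z. vector_field U X \<and> vector_field U Y \<and> vector_field U Z \<longrightarrow>
     (\<forall>p\<in>U. curvature \<Gamma> X Y Z p = 0))"

text \<open>The Lie derivative of the connection along \<open>X\<close>, evaluated on \<open>Y\<close> and \<open>Z\<close>.\<close>

definition lie_deriv_conn :: "connection \<Rightarrow> vfield \<Rightarrow> vfield \<Rightarrow> vfield \<Rightarrow> vfield" where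
  "lie_deriv_conn \<Gamma> X Y Z p =
     lie_bracket X (cov_deriv \<Gamma> Y Z) p - cov_deriv \<Gamma> (lie_bracket X Y) Z p
       - cov_deriv \<Gamma> Y (lie_bracket X Z) p"

definition affine_killing :: "point set \<Rightarrow> connection \<Rightarrow> vfield set" where
  "affine_killing U \<Gamma> = {X. vector_field U X \<and>
     (\<forall>Y Z. vector_field U Y \<and> vector_field U Z \<longrightarrow>
        (\<forall>p\<in>U. lie_deriv_conn \<Gamma> X Y Z p = 0))}"

text \<open>\<open>is_pullback V \<phi> \<Gamma>' \<Gamma>\<close>: on \<open>V\<close>, the connection \<open>\<Gamma>\<close> is the pull-back by \<open>\<phi>\<close> of \<open>\<Gamma>'\<close>. This is
  the transformation law of Christoffel symbols, i.e. the differential of \<open>\<phi>\<close> maps the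
  \<open>\<Gamma>\<close>-covariant derivatives of the coordinate fields to the \<open>\<Gamma>'\<close>-covariant derivatives of their
  images.\<close>

definition is_pullback :: "point set \<Rightarrow> (point \<Rightarrow> point) \<Rightarrow> connection \<Rightarrow> connection \<Rightarrow> bool" where
  "is_pullback V \<phi> \<Gamma>' \<Gamma> \<longleftrightarrow> (\<forall>p\<in>V. \<forall>i j l.
     (\<Sum>k\<in>UNIV. \<Gamma> p i j k * partial k (\<lambda>q. \<phi> q $ l) p) =
     partial i (partial j (\<lambda>q. \<phi> q $ l)) p +
     (\<Sum>a\<in>UNIV. \<Sum>b\<in>UNIV. \<Gamma>' (\<phi> p) a b l *
        partial i (\<lambda>q. \<phi> q $ a) p * partial j (\<lambda>q. \<phi> q $ b) p))"

definition locally_homogeneous :: "point set \<Rightarrow> connection \<Rightarrow> bool" where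
  "locally_homogeneous U \<Gamma> \<longleftrightarrow> (\<forall>p\<in>U. \<forall>q\<in>U. \<exists>V W \<phi>. p \<in> V \<and> V \<subseteq> U \<and> W \<subseteq> U \<and>
     diffeo V \<phi> W \<and> \<phi> p = q \<and> is_pullback V \<phi> \<Gamma> \<Gamma>)"

definition type_A :: "point set \<Rightarrow> connection \<Rightarrow> bool" where
  "type_A U \<Gamma> \<longleftrightarrow> locally_homogeneous U \<Gamma> \<and> \<not> flat U \<Gamma> \<and>
     (\<forall>p\<in>U. \<exists>V W \<phi> (G :: 2 \<Rightarrow> 2 \<Rightarrow> 2 \<Rightarrow> real). p \<in> V \<and> V \<subseteq> U \<and>
        diffeo V \<phi> W \<and> is_pullback V \<phi> (\<lambda>_. G) \<Gamma>)"

definition metric_on :: "point set \<Rightarrow> (point \<Rightarrow> real^2^2) \<Rightarrow> bool" where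
  "metric_on V g \<longleftrightarrow> (\<forall>i j. smooth_on V (\<lambda>p. g p $ i $ j)) \<and>
     (\<forall>p\<in>V. transpose (g p) = g p \<and> det (g p) \<noteq> 0)"

definition ginner :: "(point \<Rightarrow> real^2^2) \<Rightarrow> point \<Rightarrow> real^2 \<Rightarrow> real^2 \<Rightarrow> real" where
  "ginner g p v w = v \<bullet> (g p *v w)"

definition levi_civita :: "point set \<Rightarrow> (point \<Rightarrow> real^2^2) \<Rightarrow> connection \<Rightarrow> bool" where
  "levi_civita V g \<Gamma> \<longleftrightarrow>
     (\<forall>X Y. vector_field V X \<and> vector_field V Y \<longrightarrow>
        (\<forall>p\<in>V. cov_deriv \<Gamma> X Y p - cov_deriv \<Gamma> Y X p = lie_bracket X Y p)) \<and>
     (\<forall>X Y Z. vector_field V X \<and> vector_field V Y \<and> vector_field V Z \<longrightarrow>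
        (\<forall>p\<in>V. directional X (\<lambda>q. ginner g q (Y q) (Z q)) p =
           ginner g p (cov_deriv \<Gamma> X Y p) (Z p) + ginner g p (Y p) (cov_deriv \<Gamma> X Z p)))"

definition sectional :: "(point \<Rightarrow> real^2^2) \<Rightarrow> connection \<Rightarrow> point \<Rightarrow> real^2 \<Rightarrow> real^2 \<Rightarrow> real" where
  "sectional g \<Gamma> p v w =
     ginner g p (curvature \<Gamma> (\<lambda>_. v) (\<lambda>_. w) (\<lambda>_. w) p) v /
       (ginner g p v v * ginner g p w w - (ginner g p v w)\<^sup>2)"

definition const_sectional :: "point set \<Rightarrow> (point \<Rightarrow> real^2^2) \<Rightarrow> connection \<Rightarrow> bool" where
  "const_sectional V g \<Gamma> \<longleftrightarrow> (\<exists>\<kappa>. \<forall>p\<in>V. \<forall>v w.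
     ginner g p v v * ginner g p w w - (ginner g p v w)\<^sup>2 \<noteq> 0 \<longrightarrow> sectional g \<Gamma> p v w = \<kappa>)"

definition type_C :: "point set \<Rightarrow> connection \<Rightarrow> bool" where
  "type_C U \<Gamma> \<longleftrightarrow> locally_homogeneous U \<Gamma> \<and> \<not> flat U \<Gamma> \<and>
     (\<forall>p\<in>U. \<exists>V g. open V \<and> p \<in> V \<and> V \<subseteq> U \<and> metric_on V g \<and> levi_civita V g \<Gamma> \<and>
        const_sectional V g \<Gamma>)"

definition half_plane :: "point set" where
  "half_plane = {p. p $ 1 > 0}"

definition conn :: "(2 \<Rightarrow> 2 \<Rightarrow> 2 \<Rightarrow> real) \<Rightarrow> connection" where
  "conn C p i j k = C i j k / p $ 1"

definition structure_B :: "(2 \<Rightarrow> 2 \<Rightarrow> 2 \<Rightarrow> real) \<Rightarrow> bool" where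
  "structure_B C \<longleftrightarrow> (\<forall>i j k. C i j k = C j i k) \<and> \<not> flat half_plane (conn C)"

abbreviation killing :: "(2 \<Rightarrow> 2 \<Rightarrow> 2 \<Rightarrow> real) \<Rightarrow> vfield set" where
  "killing C \<equiv> affine_killing half_plane (conn C)"

definition lin_equiv :: "(2 \<Rightarrow> 2 \<Rightarrow> 2 \<Rightarrow> real) \<Rightarrow> (2 \<Rightarrow> 2 \<Rightarrow> 2 \<Rightarrow> real) \<Rightarrow> bool" where
  "lin_equiv C' C \<longleftrightarrow> structure_B C' \<and> structure_B C \<and>
     (\<exists>b c. c \<noteq> 0 \<and>
        is_pullback half_plane (\<lambda>p. vector [p $ 1, b * p $ 1 + c * p $ 2]) (conn C) (conn C'))"

text \<open>The vector field on the half plane with the components \<open>u\<close> and \<open>v\<close>, as functions of the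
  two coordinates.\<close>

definition hp_field :: "(real \<Rightarrow> real \<Rightarrow> real) \<Rightarrow> (real \<Rightarrow> real \<Rightarrow> real) \<Rightarrow> vfield" where
  "hp_field u v =
     restrict_vf half_plane (\<lambda>p. vector [u (p $ 1) (p $ 2), v (p $ 1) (p $ 2)])"

definition K0B :: "vfield set" where
  "K0B = span {hp_field (\<lambda>x y. x) (\<lambda>x y. y), hp_field (\<lambda>x y. 0) (\<lambda>x y. 1)}"

definition X_field :: "real \<Rightarrow> vfield" where
  "X_field \<sigma> = hp_field (\<lambda>x y. 2 * x * y) (\<lambda>x y. y\<^sup>2 + \<sigma> * x\<^sup>2)"

text \<open>\<open>ricci_11 C r\<close>: the Ricci tensor has the single component \<open>r / x\<^sup>2\<close> on \<open>dx \<otimes> dx\<close>, where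
  \<open>x\<close> is the first coordinate.\<close>

definition ricci_11 :: "(2 \<Rightarrow> 2 \<Rightarrow> 2 \<Rightarrow> real) \<Rightarrow> real \<Rightarrow> bool" where
  "ricci_11 C r \<longleftrightarrow> (\<forall>Y Z. vector_field half_plane Y \<and> vector_field half_plane Z \<longrightarrow>
     (\<forall>p\<in>half_plane. ricci (conn C) Y Z p = r / (p $ 1)\<^sup>2 * Y p $ 1 * Z p $ 1))"

definition ricci_rank_one_form :: "(2 \<Rightarrow> 2 \<Rightarrow> 2 \<Rightarrow> real) \<Rightarrow> real \<Rightarrow> bool" where
  "ricci_rank_one_form C r \<longleftrightarrow> ricci_11 C r \<and> C 1 2 1 = 0 \<and> C 2 2 1 = 0 \<and> C 2 2 2 = 0"

definition struct_1a :: "(2 \<Rightarrow> 2 \<Rightarrow> 2 \<Rightarrow> real) \<Rightarrow> bool" where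
  "struct_1a C \<longleftrightarrow> (\<exists>r. ricci_rank_one_form C r \<and>
     C 1 1 1 - 2 * C 1 2 2 = 0 \<and> C 1 1 2 = 1 \<and> r = (1 + C 1 2 2) * C 1 2 2 \<and> r \<noteq> 0)"

definition struct_1b :: "(2 \<Rightarrow> 2 \<Rightarrow> 2 \<Rightarrow> real) \<Rightarrow> bool" where
  "struct_1b C \<longleftrightarrow> (\<exists>r. ricci_rank_one_form C r \<and>
     C 1 1 2 = 0 \<and> r = (1 + C 1 1 1 - C 1 2 2) * C 1 2 2 \<and> r \<noteq> 0)"

definition struct_1c :: "(2 \<Rightarrow> 2 \<Rightarrow> 2 \<Rightarrow> real) \<Rightarrow> bool" where
  "struct_1c C \<longleftrightarrow> (\<exists>r. ricci_rank_one_form C r \<and>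
     C 1 1 2 = 0 \<and> r = (C 1 2 2)\<^sup>2 \<and> r \<noteq> 0)"

text \<open>Constants symmetric in the lower indices, in the order
  11/1, 11/2, 12/1, 12/2, 22/1, 22/2 (lower indices / upper index).\<close>

definition consts6 ::
  "real \<Rightarrow> real \<Rightarrow> real \<Rightarrow> real \<Rightarrow> real \<Rightarrow> real \<Rightarrow> 2 \<Rightarrow> 2 \<Rightarrow> 2 \<Rightarrow> real" where
  "consts6 c111 c112 c121 c122 c221 c222 i j k =
     (if i = 1 \<and> j = 1 then (if k = 1 then c111 else c112)
      else if i = 2 \<and> j = 2 then (if k = 1 then c221 else c222)
      else (if k = 1 then c121 else c122))"

definition N1_plus :: "2 \<Rightarrow> 2 \<Rightarrow> 2 \<Rightarrow> real" where
  "N1_plus = consts6 (-3/2) 0 0 (-1/2) (-1/2) 0"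

definition N1_minus :: "2 \<Rightarrow> 2 \<Rightarrow> 2 \<Rightarrow> real" where
  "N1_minus = consts6 (-3/2) 0 0 (-1/2) (1/2) 0"

text \<open>\<open>c\<close> is an arbitrary real number, not restricted to \<open>c \<ge> 0\<close>: linear equivalence multiplies the
  constant 22/1 by a positive square, so no \<open>N2 c\<close> with \<open>c < 0\<close> is linearly equivalent to one with
  \<open>c \<ge> 0\<close>, nor is it to one of the other models, and the affine Killing algebra is 3-dimensional
  there as well.\<close>

definition N2 :: "real \<Rightarrow> 2 \<Rightarrow> 2 \<Rightarrow> 2 \<Rightarrow> real" where
  "N2 c = consts6 (-3/2) 0 1 (-1/2) c 2"

definition N3 :: "2 \<Rightarrow> 2 \<Rightarrow> 2 \<Rightarrow> real" where
  "N3 = consts6 (-1) 0 0 (-1) (-1) 0"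

definition N4 :: "2 \<Rightarrow> 2 \<Rightarrow> 2 \<Rightarrow> real" where
  "N4 = consts6 (-1) 0 0 (-1) 1 0"

text \<open>The Lie algebra su(1,1), on \<open>real^3\<close> with its standard basis:
  \<open>[e1,e2] = e1\<close>, \<open>[e2,e3] = e3\<close>, \<open>[e1,e3] = -2 e2\<close>.\<close>

definition su11_bracket :: "real^3 \<Rightarrow> real^3 \<Rightarrow> real^3" where
  "su11_bracket v w =
     (v$1 * w$2 - v$2 * w$1) *\<^sub>R axis 1 1 + (v$2 * w$3 - v$3 * w$2) *\<^sub>R axis 3 1
       + (v$1 * w$3 - v$3 * w$1) *\<^sub>R (- 2 *\<^sub>R axis 2 1)"

definition iso_su11 :: "vfield set \<Rightarrow> bool" where
  "iso_su11 K \<longleftrightarrow> (\<exists>F :: real^3 \<Rightarrow> vfield. linear F \<and> inj F \<and> range F = K \<and>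
     (\<forall>v w. F (su11_bracket v w) = lie_bracket (F v) (F w)))"

end

theory Submission
  imports Defs
begin

text \<open>The frame \<open>e1 = x \<partial>\<^sub>1, e2 = x \<partial>\<^sub>2\<close> (and any linear change of it that keeps \<open>x\<close>) commutes with
  \<open>K0B\<close>, satisfies \<open>[e1, e2] = e2\<close>, and the connection has constant coefficients in it. For a field \<open>X\<close> let
  \<open>A\<close> be the matrix of \<open>e\<^sub>j \<mapsto> - [X, e\<^sub>j]\<close>, so that \<open>A = 0\<close> iff \<open>X \<in> K0B\<close>. The Killing equation is a closed linear
  system \<open>e\<^sub>i A = L\<^sub>i A\<close> with constant matrices, and \<open>L\<^sub>2 L\<^sub>1 - L\<^sub>1 L\<^sub>2 = L\<^sub>2\<close> on the values of its solutions. Hence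
  \<open>L\<^sub>2\<close> is nilpotent on that space, and a Killing field outside \<open>K0B\<close> yields a value \<open>v \<noteq> 0\<close> with
  \<open>L\<^sub>2 v = 0\<close>. If its entry \<open>v\<^sub>1\<^sub>2\<close> vanishes, then \<open>C\<^sub>1\<^sub>2\<^sup>1 = C\<^sub>2\<^sub>2\<^sup>1 = C\<^sub>2\<^sub>2\<^sup>2 = 0\<close>, and the system is solved
  explicitly. Otherwise \<open>L\<^sub>1 v = v\<close>, and after a shear these linear equations for the connection constants leave
  the models \<open>N\<^sub>1\<close>, ..., \<open>N\<^sub>4\<close>.

  Let \<open>R\<close> be the constant matrix of the curvature. In a chart with constant Christoffel symbols the frame has
  a matrix \<open>M\<close> with \<open>e\<^sub>k M = M B\<^sub>k\<close>, where \<open>[B\<^sub>k, R] = tr(B\<^sub>k) R\<close>, \<open>tr R = 0\<close>, and \<open>B\<^sub>1 e2 - B\<^sub>2 e1 = e2\<close>. This is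
  impossible for the models, which are therefore not of Type A. A parallel metric would make \<open>R\<close> skew, which
  excludes Type C for \<open>N\<^sub>1\<close> and \<open>N\<^sub>2\<close>; for \<open>N\<^sub>3\<close> and \<open>N\<^sub>4\<close> the metrics \<open>(dx\<^sup>2 \<mp> dy\<^sup>2) / x\<^sup>2\<close> are parallel.\<close>

subsection \<open>Partial derivatives and smooth functions\<close>

text \<open>The fields of \<open>K0B\<close> generate the group of maps (x, y) \<mapsto> (a x, a y +
  b) with a > 0. It is simply transitive on the half plane and preserves every connection C / x,
  which is why an invariant frame has constant connection coefficients. The group also acts on the
  solutions of the system for A. Hence their values at one point form a finite-dimensional space
  stable under both matrices, and analysis is reduced to two matrices with a single relation.
  Closedness of the system alone would bound the dimension of the Killing algebra only by 6. The
  bound 4 comes from the case distinction: in every case the algebra is computed completely, as the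
  image of an injective linear map from a coordinate space. The dimensions 2, 3 and 4 then tell the
  cases apart. The kernel equations also have flat solutions, in disguise as sheared copies of
  simple flat connections. These are recognised through their curvature.\<close>

lemma axis_nth_2 [simp]:
  "axis (1::2) (a::real) $ 1 = a" "axis (1::2) (a::real) $ 2 = 0"
  "axis (2::2) (a::real) $ 1 = 0" "axis (2::2) (a::real) $ 2 = a"
  by (simp_all add: axis_def)

lemma partial_eqI:
  assumes "(f has_derivative D) (at p)"
  shows "partial i f p = D (axis i 1)"
  using frechet_derivative_at[OF assms] by (simp add: partial_def)

lemma has_derivative_partial:
  assumes "f differentiable at p"
  shows "(f has_derivative (\<lambda>v. partial 1 f p * v $ 1 + partial 2 f p * v $ 2)) (at p)"
proof -
  from assms obtain D where D: "(f has_derivative D) (at p)"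
    by (auto simp: differentiable_def)
  have "D v = partial 1 f p * v $ 1 + partial 2 f p * v $ 2" for v
  proof -
    interpret D: bounded_linear D using D by (rule has_derivative_bounded_linear)
    have v: "v = v $ 1 *\<^sub>R axis 1 1 + v $ 2 *\<^sub>R axis 2 1"
      by (simp add: vec_eq_iff forall_2)
    show ?thesis
      by (subst v) (simp add: D.add D.scaleR partial_eqI[OF D])
  qed
  with D show ?thesis by (metis (no_types, lifting) ext)
qed

lemma partial_expand:
  "partial 1 f p * axis i 1 $ 1 + partial 2 f p * axis i 1 $ 2 = partial i f p"
  using exhaust_2[of i] by auto

text \<open>\<open>frechet_derivative\<close> is a choice among the candidate derivatives. Functions
  with the same germ at \<open>p\<close> have the same candidates, so the choices agree even where
  no derivative exists.\<close>

lemma partial_cong: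
  assumes "open U" "p \<in> U" "\<And>q. q \<in> U \<Longrightarrow> f q = g q"
  shows "partial i f p = partial i g p"
proof -
  have *: "(f has_derivative D) (at p) \<longleftrightarrow> (g has_derivative D) (at p)" for D
    using has_derivative_transform_within_open[OF _ assms(1,2), of f D UNIV g]
      has_derivative_transform_within_open[OF _ assms(1,2), of g D UNIV f] assms(3) by auto
  show ?thesis unfolding partial_def frechet_derivative_def using * by simp
qed

lemma differentiable_cong_open:
  assumes "open U" "p \<in> U" "\<And>q. q \<in> U \<Longrightarrow> f q = g q" "g differentiable at p"
  shows "f differentiable at p"
proof -
  obtain D where "(g has_derivative D) (at p)" using assms(4) by (auto simp: differentiable_def)
  from has_derivative_transform_within_open[OF this assms(1,2), of f] assms(3)
  show ?thesis by (auto simp: differentiable_def)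
qed

lemma differentiable_coord [simp]: "(\<lambda>q::point. q $ i) differentiable at p"
  by (intro bounded_linear_imp_differentiable bounded_linear_vec_nth)

lemma partial_coord [simp]: "partial i (\<lambda>q. q $ j) p = (if i = j then 1 else 0)"
proof -
  have "((\<lambda>q::point. q $ j) has_derivative (\<lambda>q. q $ j)) (at p)"
    by (intro bounded_linear_imp_has_derivative bounded_linear_vec_nth)
  from partial_eqI[OF this, of i] show ?thesis by (simp add: axis_def)
qed

lemma partial_const [simp]: "partial i (\<lambda>q. c) p = 0"
  by (rule partial_eqI[OF has_derivative_const, THEN trans]) simp

lemma differentiable_arith:
  fixes f g :: "point \<Rightarrow> real"
  assumes "f differentiable at p" "g differentiable at p"
  shows "(\<lambda>q. f q + g q) differentiable at p" "(\<lambda>q. f q - g q) differentiable at p"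
    "(\<lambda>q. f q * g q) differentiable at p"
  using assms by (auto intro: differentiable_add differentiable_diff differentiable_mult)

lemma differentiable_uminus:
  fixes f :: "point \<Rightarrow> real"
  assumes "f differentiable at p"
  shows "(\<lambda>q. - f q) differentiable at p"
  using assms by (auto intro: differentiable_minus)

lemma differentiable_div:
  fixes f g :: "point \<Rightarrow> real"
  assumes "f differentiable at p" "g differentiable at p" "g p \<noteq> 0"
  shows "(\<lambda>q. f q / g q) differentiable at p"
  using assms by (auto intro: differentiable_divide)

lemma partial_add:
  assumes "f differentiable at p" "g differentiable at p"
  shows "partial i (\<lambda>q. f q + g q) p = partial i f p + partial i g p"
  using partial_eqI[OF has_derivative_add[OF has_derivative_partial[OF assms(1)]
        has_derivative_partial[OF assms(2)]], of i] by (simp add: partial_expand)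

lemma partial_diff:
  assumes "f differentiable at p" "g differentiable at p"
  shows "partial i (\<lambda>q. f q - g q) p = partial i f p - partial i g p"
  using partial_eqI[OF has_derivative_diff[OF has_derivative_partial[OF assms(1)]
        has_derivative_partial[OF assms(2)]], of i] by (simp add: partial_expand)

lemma partial_uminus:
  assumes "f differentiable at p"
  shows "partial i (\<lambda>q. - f q) p = - partial i f p"
  using partial_diff[OF differentiable_const assms, of i 0] by simp

lemma partial_mult:
  assumes "f differentiable at p" "g differentiable at p"
  shows "partial i (\<lambda>q. f q * g q) p = f p * partial i g p + partial i f p * g p"
  using partial_eqI[OF has_derivative_mult[OF has_derivative_partial[OF assms(1)]
        has_derivative_partial[OF assms(2)]], of i] by (simp add: partial_expand)

lemma partial_chain:
  assumes "f differentiable at p" "(h has_real_derivative h') (at (f p))"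
  shows "(\<lambda>q. h (f q)) differentiable at p" "partial i (\<lambda>q. h (f q)) p = h' * partial i f p"
proof -
  have *: "((\<lambda>q. h (f q)) has_derivative
      (\<lambda>v. h' * (partial 1 f p * v $ 1 + partial 2 f p * v $ 2))) (at p)"
    using has_derivative_compose[OF has_derivative_partial[OF assms(1)], of h "(*) h'"] assms(2)
    by (simp add: has_field_derivative_def)
  show "(\<lambda>q. h (f q)) differentiable at p" using * by (auto simp: differentiable_def)
  show "partial i (\<lambda>q. h (f q)) p = h' * partial i f p"
    using partial_eqI[OF *, of i] exhaust_2[of i] by auto
qed

lemma partial_div:
  assumes "f differentiable at p" "g differentiable at p" "g p \<noteq> 0"
  shows "partial i (\<lambda>q. f q / g q) p = (partial i f p * g p - f p * partial i g p) / (g p)\<^sup>2"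
proof -
  have "((\<lambda>t. inverse t) has_real_derivative - (inverse (g p) ^ Suc (Suc 0))) (at (g p))"
    using assms(3) by (rule DERIV_inverse)
  note c = partial_chain[OF assms(2) this]
  have "partial i (\<lambda>q. f q * inverse (g q)) p =
      f p * (- (inverse (g p) ^ Suc (Suc 0)) * partial i g p) + partial i f p * inverse (g p)"
    by (subst partial_mult[OF assms(1) c(1)]) (simp add: c(2))
  also have "\<dots> = (partial i f p * g p - f p * partial i g p) / (g p)\<^sup>2"
    using assms(3) by (simp add: field_simps power2_eq_square)
  finally show ?thesis by (simp add: divide_inverse)
qed

lemmas partial_simps = partial_add partial_diff partial_uminus partial_mult partial_div
  differentiable_arith differentiable_uminus differentiable_div

lemma constant_on_open:
  assumes "open U" "connected U" "\<And>q. q \<in> U \<Longrightarrow> f differentiable at q"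
    "\<And>q i. q \<in> U \<Longrightarrow> partial i f q = 0"
  obtains c where "\<And>q. q \<in> U \<Longrightarrow> f q = c"
proof (cases "U = {}")
  case False
  then obtain a where "a \<in> U" by blast
  have "f q = f a" if "q \<in> U" for q
  proof (rule has_derivative_zero_unique_connected[OF assms(1,2) _ that \<open>a \<in> U\<close>])
    fix x assume "x \<in> U"
    from has_derivative_partial[OF assms(3)[OF this]] assms(4)[OF this]
    show "(f has_derivative (\<lambda>x. 0)) (at x)" by simp
  qed
  then show ?thesis by (rule that)
qed (use that in auto)

section \<open>The classes C^k on open sets\<close>

lemma Ck_on_cong:
  assumes "open U" "\<And>q. q \<in> U \<Longrightarrow> f q = g q"
  shows "Ck_on k U f \<longleftrightarrow> Ck_on k U g"
  using assms(2)
proof (induction k arbitrary: f g)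
  case 0
  then show ?case by (simp cong: continuous_on_cong)
next
  case (Suc k)
  have "f differentiable_on U \<longleftrightarrow> g differentiable_on U"
    unfolding differentiable_on_eq_differentiable_at[OF assms(1)]
    using differentiable_cong_open[OF assms(1)] Suc.prems by metis
  moreover have "Ck_on k U (partial i f) \<longleftrightarrow> Ck_on k U (partial i g)" for i
    by (rule Suc.IH) (use partial_cong[OF assms(1)] Suc.prems in blast)
  ultimately show ?case by simp
qed

lemma Ck_on_SucD: "Ck_on (Suc k) U f \<Longrightarrow> Ck_on k U f"
proof (induction k arbitrary: f)
  case 0
  then show ?case by (simp add: differentiable_imp_continuous_on)
qed simp

text \<open>A closed form \<open>g i\<close> that is valid on \<open>U\<close> replaces
  \<open>partial i f\<close>, so inductions on \<open>k\<close> can work with explicit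
  formulas.\<close>

lemma Ck_on_SucI:
  assumes "open U" "\<And>q. q \<in> U \<Longrightarrow> f differentiable at q"
    "\<And>i. Ck_on k U (g i)" "\<And>i q. q \<in> U \<Longrightarrow> partial i f q = g i q"
  shows "Ck_on (Suc k) U f"
  using assms Ck_on_cong[OF assms(1), of "partial i f" "g i" for i]
  by (simp add: differentiable_on_eq_differentiable_at)

lemma Ck_on_SucE:
  assumes "open U" "Ck_on (Suc k) U f" "q \<in> U"
  shows "f differentiable at q"
  using assms by (simp add: differentiable_on_eq_differentiable_at)

lemma Ck_on_const: "open U \<Longrightarrow> Ck_on k U (\<lambda>q. c)"
proof (induction k arbitrary: c)
  case (Suc k)
  show ?case by (rule Ck_on_SucI[where g = "\<lambda>_ _. 0"]) (use Suc in auto)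
qed simp

lemma Ck_on_coord: "open U \<Longrightarrow> Ck_on k U (\<lambda>q. q $ j)"
proof (induction k)
  case 0
  then show ?case by (simp add: continuous_on_component)
next
  case (Suc k)
  show ?case
    by (rule Ck_on_SucI[where g = "\<lambda>i _. if i = j then 1 else 0"]) (use Suc Ck_on_const in auto)
qed

lemma Ck_on_add:
  assumes "open U"
  shows "Ck_on k U f \<Longrightarrow> Ck_on k U g \<Longrightarrow> Ck_on k U (\<lambda>q. f q + g q)"
proof (induction k arbitrary: f g)
  case 0
  then show ?case by (simp add: continuous_on_add)
next
  case (Suc k)
  note d = Ck_on_SucE[OF assms]
  show ?case
    by (rule Ck_on_SucI[where g = "\<lambda>i q. partial i f q + partial i g q"])
      (use assms Suc d in \<open>auto simp: partial_simps\<close>)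
qed

lemma Ck_on_mult:
  assumes "open U"
  shows "Ck_on k U f \<Longrightarrow> Ck_on k U g \<Longrightarrow> Ck_on k U (\<lambda>q. f q * g q)"
proof (induction k arbitrary: f g)
  case 0
  then show ?case by (simp add: continuous_on_mult)
next
  case (Suc k)
  note d = Ck_on_SucE[OF assms]
  show ?case
  proof (rule Ck_on_SucI[where g = "\<lambda>i q. f q * partial i g q + partial i f q * g q"])
    show "Ck_on k U (\<lambda>q. f q * partial i g q + partial i f q * g q)" for i
      using Suc Ck_on_SucD by (intro Ck_on_add[OF assms] Suc.IH) auto
  qed (use assms Suc d in \<open>auto simp: partial_simps\<close>)
qed

text \<open>A tower \<open>h 0\<close>, \<open>h 1\<close>, ... closed under differentiation up to
  factors \<open>c n\<close> turns the chain rule into an induction on \<open>k\<close> with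
  \<open>n\<close> arbitrary. Powers, \<open>exp\<close> and \<open>ln\<close> each fit into such a
  tower.\<close>

lemma Ck_on_compose:
  assumes "open U" "\<And>n t. t \<in> T \<Longrightarrow> (h n has_real_derivative c n * h (Suc n) t) (at t)"
    "\<And>q. q \<in> U \<Longrightarrow> f q \<in> T"
  shows "Ck_on k U f \<Longrightarrow> Ck_on k U (\<lambda>q. h n (f q))"
proof (induction k arbitrary: n)
  case 0
  have "continuous_on T (h n)"
    using assms(2) DERIV_isCont continuous_at_imp_continuous_on by blast
  then show ?case using 0 assms(3) by (auto intro!: continuous_on_compose2[of T "h n"])
next
  case (Suc k)
  note d = Ck_on_SucE[OF assms(1) Suc.prems]
  show ?case
  proof (rule Ck_on_SucI[where g = "\<lambda>i q. (c n * h (Suc n) (f q)) * partial i f q"])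
    show "Ck_on k U (\<lambda>q. (c n * h (Suc n) (f q)) * partial i f q)" for i
      using Suc Ck_on_SucD by (intro Ck_on_mult[OF assms(1)] Ck_on_const[OF assms(1)] Suc.IH) auto
  qed (use assms(1) partial_chain[OF d assms(2)[OF assms(3)]] in auto)
qed

lemma smooth_on_const: "open U \<Longrightarrow> smooth_on U (\<lambda>q. c)"
  by (simp add: smooth_on_def Ck_on_const)

lemma smooth_on_coord: "open U \<Longrightarrow> smooth_on U (\<lambda>q. q $ j)"
  by (simp add: smooth_on_def Ck_on_coord)

lemma smooth_on_add:
  "open U \<Longrightarrow> smooth_on U f \<Longrightarrow> smooth_on U g \<Longrightarrow> smooth_on U (\<lambda>q. f q + g q)"
  by (simp add: smooth_on_def Ck_on_add)

lemma smooth_on_mult: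
  "open U \<Longrightarrow> smooth_on U f \<Longrightarrow> smooth_on U g \<Longrightarrow> smooth_on U (\<lambda>q. f q * g q)"
  by (simp add: smooth_on_def Ck_on_mult)

lemma smooth_on_uminus: "open U \<Longrightarrow> smooth_on U f \<Longrightarrow> smooth_on U (\<lambda>q. - f q)"
  using smooth_on_mult[OF _ smooth_on_const, of U f "-1"] by simp

lemma smooth_on_diff:
  "open U \<Longrightarrow> smooth_on U f \<Longrightarrow> smooth_on U g \<Longrightarrow> smooth_on U (\<lambda>q. f q - g q)"
  using smooth_on_add[OF _ _ smooth_on_uminus, of U f g] by simp

lemma smooth_on_power:
  "open U \<Longrightarrow> smooth_on U f \<Longrightarrow> smooth_on U (\<lambda>q. f q ^ n)"
  by (induction n) (auto intro: smooth_on_const smooth_on_mult)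

lemma smooth_on_compose:
  assumes "open U" "\<And>n t. t \<in> T \<Longrightarrow> (h n has_real_derivative c n * h (Suc n) t) (at t)"
    "\<And>q. q \<in> U \<Longrightarrow> f q \<in> T" "smooth_on U f"
  shows "smooth_on U (\<lambda>q. h n (f q))"
  using assms Ck_on_compose[of U T h c f] by (simp add: smooth_on_def)

lemma smooth_on_powr:
  assumes "open U" "\<And>q. q \<in> U \<Longrightarrow> 0 < f q" "smooth_on U f"
  shows "smooth_on U (\<lambda>q. f q powr a)"
proof -
  have "smooth_on U (\<lambda>q. (\<lambda>n t. t powr (a - real n)) 0 (f q))"
    by (rule smooth_on_compose[where T = "{0<..}" and c = "\<lambda>n. a - real n"])
      (use assms in \<open>auto intro!: derivative_eq_intros simp: algebra_simps\<close>)
  then show ?thesis by simp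
qed

lemma smooth_on_exp: "open U \<Longrightarrow> smooth_on U f \<Longrightarrow> smooth_on U (\<lambda>q. exp (f q))"
  using smooth_on_compose[of U UNIV "\<lambda>_. exp" "\<lambda>_. 1" f] by (simp add: DERIV_exp)

lemma smooth_on_ln:
  assumes "open U" "\<And>q. q \<in> U \<Longrightarrow> 0 < f q" "smooth_on U f"
  shows "smooth_on U (\<lambda>q. ln (f q))"
proof -
  \<comment> \<open>The tower ln t, 1 / t, 1 / t^2, ... with the factors 1, -1, -2, ...\<close>
  define h where "h n t = (if n = 0 then ln t else t powr - real n)" for n and t :: real
  have "smooth_on U (\<lambda>q. h 0 (f q))"
  proof (rule smooth_on_compose[where h = h and T = "{0<..}" and c = "\<lambda>n. if n = 0 then 1 else - real n"])
    show "(h n has_real_derivative (if n = 0 then 1 else - real n) * h (Suc n) t) (at t)"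
      if "t \<in> {0<..}" for n t
    proof (cases "n = 0")
      case True
      then have "h n = ln" by (auto simp: h_def)
      then show ?thesis using that True
        by (auto simp: h_def powr_minus_divide intro!: derivative_eq_intros)
    next
      case False
      then have "h n = (\<lambda>t. t powr - real n)" by (auto simp: h_def)
      moreover have "h (Suc n) t = t powr (- real n - 1)"
        unfolding h_def by (simp, intro arg_cong2[where f = "(powr)"]) auto
      ultimately show ?thesis using that False
        by (auto intro!: derivative_eq_intros)
    qed
  qed (use assms in auto)
  then show ?thesis by (simp add: h_def)
qed

lemma smooth_on_divide:
  assumes "open U" "\<And>q. q \<in> U \<Longrightarrow> 0 < g q" "smooth_on U f" "smooth_on U g"
  shows "smooth_on U (\<lambda>q. f q / g q)"
proof -
  have "smooth_on U (\<lambda>q. f q * g q powr - 1)"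
    using assms by (intro smooth_on_mult smooth_on_powr)
  moreover have "f q * g q powr - 1 = f q / g q" if "q \<in> U" for q
    using assms(2)[OF that] by (simp add: powr_minus_divide)
  ultimately show ?thesis
    using Ck_on_cong[OF assms(1), of "\<lambda>q. f q * g q powr - 1" "\<lambda>q. f q / g q"]
    by (simp add: smooth_on_def)
qed

lemmas smooth_intros = smooth_on_const smooth_on_coord smooth_on_add smooth_on_mult
  smooth_on_uminus smooth_on_diff smooth_on_power smooth_on_powr smooth_on_exp smooth_on_ln
  smooth_on_divide

lemma smooth_on_cong:
  assumes "open U" "\<And>q. q \<in> U \<Longrightarrow> f q = g q"
  shows "smooth_on U f \<longleftrightarrow> smooth_on U g"
  using Ck_on_cong[OF assms] by (simp add: smooth_on_def)

lemma smooth_on_differentiable: "open U \<Longrightarrow> smooth_on U f \<Longrightarrow> q \<in> U \<Longrightarrow> f differentiable at q"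
  unfolding smooth_on_def using Ck_on_SucE by blast

lemma smooth_on_partial: "smooth_on U f \<Longrightarrow> smooth_on U (partial i f)"
  unfolding smooth_on_def using Ck_on.simps(2) by blast

lemma smooth_on_continuous: "smooth_on U f \<Longrightarrow> continuous_on U f"
  unfolding smooth_on_def using Ck_on.simps(1) by blast

section \<open>Symmetry of mixed partial derivatives\<close>

lemma partial_line:
  assumes "f differentiable at (a + t *\<^sub>R axis i 1)"
  shows "((\<lambda>s. f (a + s *\<^sub>R axis i 1)) has_real_derivative partial i f (a + t *\<^sub>R axis i 1)) (at t)"
proof -
  let ?p = "a + t *\<^sub>R axis i 1"
  have "((\<lambda>s. f (a + s *\<^sub>R axis i 1)) has_derivative
     (\<lambda>s. partial 1 f ?p * (s *\<^sub>R axis i 1) $ 1 + partial 2 f ?p * (s *\<^sub>R axis i 1) $ 2)) (at t)"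
    by (rule has_derivative_compose[of "\<lambda>s. a + s *\<^sub>R axis i 1" "\<lambda>s. s *\<^sub>R axis i 1" t UNIV f,
          OF _ has_derivative_partial[OF assms]])
      (auto intro!: derivative_eq_intros)
  moreover have "partial 1 f ?p * (s *\<^sub>R axis i 1) $ 1 + partial 2 f ?p * (s *\<^sub>R axis i 1) $ 2
      = partial i f ?p * s" for s
    using exhaust_2[of i] by auto
  ultimately show ?thesis by (simp add: has_field_derivative_def)
qed

text \<open>The mean value theorem, used in direction \<open>i\<close> and then in direction
  \<open>j\<close>, turns the second difference over a square into a mixed derivative at an inner
  point.\<close>

lemma second_difference:
  assumes U: "open U" "smooth_on U f" and h: "0 < h"
    and box: "\<And>s t. 0 \<le> s \<Longrightarrow> s \<le> h \<Longrightarrow> 0 \<le> t \<Longrightarrow> t \<le> h \<Longrightarrow> p + s *\<^sub>R axis i 1 + t *\<^sub>R axis j 1 \<in> U"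
  obtains s t where "0 < s" "s < h" "0 < t" "t < h"
    "f (p + h *\<^sub>R axis i 1 + h *\<^sub>R axis j 1) - f (p + h *\<^sub>R axis i 1)
      - (f (p + h *\<^sub>R axis j 1) - f p) =
     h * h * partial j (partial i f) (p + s *\<^sub>R axis i 1 + t *\<^sub>R axis j 1)"
proof -
  let ?P = "\<lambda>s t. p + s *\<^sub>R axis i 1 + t *\<^sub>R axis j 1"
  have d: "f differentiable at q" "partial i f differentiable at q" if "q \<in> U" for q
    using smooth_on_differentiable smooth_on_partial U that by blast+
  define G where "G s = f (?P s h) - f (?P s 0)" for s
  have "(G has_real_derivative partial i f (?P s h) - partial i f (?P s 0)) (at s)"
    if "0 \<le> s" "s \<le> h" for s
  proof -
    have "((\<lambda>s. f (?P s t)) has_real_derivative partial i f (?P s t)) (at s)"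
      if "0 \<le> t" "t \<le> h" for t
      using partial_line[of f "p + t *\<^sub>R axis j 1" s i] d(1)[OF box[of s t]] \<open>0 \<le> s\<close> \<open>s \<le> h\<close> that
      by (simp add: add_ac)
    from this[of h] this[of 0] show ?thesis
      using h unfolding G_def by (intro DERIV_diff) auto
  qed
  with MVT2[of 0 h G "\<lambda>s. partial i f (?P s h) - partial i f (?P s 0)"] h obtain s where s: "0 < s" "s < h"
    "G h - G 0 = h * (partial i f (?P s h) - partial i f (?P s 0))" by auto
  have "((\<lambda>t. partial i f (?P s t)) has_real_derivative partial j (partial i f) (?P s t)) (at t)"
    if "0 \<le> t" "t \<le> h" for t
    using partial_line[of "partial i f" "p + s *\<^sub>R axis i 1" t j] d(2)[OF box[of s t]] s that by simp
  with MVT2[of 0 h "\<lambda>t. partial i f (?P s t)" "\<lambda>t. partial j (partial i f) (?P s t)"] h obtain t where t: "0 < t" "t < h"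
    "partial i f (?P s h) - partial i f (?P s 0) = h * partial j (partial i f) (?P s t)" by auto
  from s t have "G h - G 0 = h * h * partial j (partial i f) (?P s t)" by simp
  with s(1,2) t(1,2) that show ?thesis by (simp add: G_def)
qed

text \<open>Schwarz's theorem. The second difference over a small square is symmetric in
  \<open>i\<close> and \<open>j\<close>, so the two mixed derivatives share a value near
  \<open>p\<close>, at possibly different points; continuity brings both to
  \<open>p\<close>.\<close>

lemma partial_commute:
  assumes U: "open U" "smooth_on U f" "p \<in> U"
  shows "partial i (partial j f) p = partial j (partial i f) p"
proof (rule ccontr)
  assume ne: "partial i (partial j f) p \<noteq> partial j (partial i f) p"
  let ?a = "partial i (partial j f)" and ?b = "partial j (partial i f)"
  let ?e = "\<bar>?a p - ?b p\<bar> / 2"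
  have e: "?e > 0" using ne by simp
  have "continuous_on U ?a" "continuous_on U ?b"
    using U smooth_on_partial smooth_on_continuous by blast+
  then have "isCont ?a p" "isCont ?b p"
    using U continuous_on_eq_continuous_at by blast+
  then obtain d1 d2 where d: "d1 > 0" "d2 > 0" "\<And>q. dist q p < d1 \<Longrightarrow> dist (?a q) (?a p) < ?e"
     "\<And>q. dist q p < d2 \<Longrightarrow> dist (?b q) (?b p) < ?e"
    using e unfolding continuous_at_eps_delta by metis
  obtain d0 where d0: "d0 > 0" "ball p d0 \<subseteq> U" using U openE by blast
  \<comment> \<open>The divisor 3 leaves room: two steps of length at most \<open>h\<close> stay
    strictly inside all three balls.\<close>
  define h where "h = min d0 (min d1 d2) / 3"
  have h: "h > 0" using d d0 by (simp add: h_def)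
  have near: "dist (p + s *\<^sub>R axis i 1 + t *\<^sub>R axis j 1) p < min d0 (min d1 d2)"
    if "0 \<le> s" "s \<le> h" "0 \<le> t" "t \<le> h" for s t and i j :: 2
  proof -
    have "norm (s *\<^sub>R axis i (1::real) + t *\<^sub>R axis j 1) \<le> s + t"
      by (rule order_trans[OF norm_triangle_ineq]) (use that in \<open>simp add: norm_axis_1\<close>)
    also have "\<dots> < 3 * h" using that h by simp
    finally show ?thesis by (simp add: dist_norm h_def add.assoc)
  qed
  have box: "p + s *\<^sub>R axis i 1 + t *\<^sub>R axis j 1 \<in> U"
    if "0 \<le> s" "s \<le> h" "0 \<le> t" "t \<le> h" for s t and i j :: 2
    using near[OF that, of i j] d0 by (auto simp: dist_commute subset_iff)
  obtain s t where st: "0 < s" "s < h" "0 < t" "t < h"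
    "f (p + h *\<^sub>R axis i 1 + h *\<^sub>R axis j 1) - f (p + h *\<^sub>R axis i 1)
      - (f (p + h *\<^sub>R axis j 1) - f p) = h * h * ?b (p + s *\<^sub>R axis i 1 + t *\<^sub>R axis j 1)"
    using second_difference[OF U(1,2) h box] by blast
  obtain s' t' where st': "0 < s'" "s' < h" "0 < t'" "t' < h"
    "f (p + h *\<^sub>R axis j 1 + h *\<^sub>R axis i 1) - f (p + h *\<^sub>R axis j 1)
      - (f (p + h *\<^sub>R axis i 1) - f p) = h * h * ?a (p + s' *\<^sub>R axis j 1 + t' *\<^sub>R axis i 1)"
    using second_difference[OF U(1,2) h box] by blast
  have swap: "p + h *\<^sub>R axis j 1 + h *\<^sub>R axis i 1 = p + h *\<^sub>R axis i 1 + h *\<^sub>R axis j (1::real)"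
    by (simp add: add_ac)
  from st(5) st'(5)[unfolded swap] have "h * h * ?b (p + s *\<^sub>R axis i 1 + t *\<^sub>R axis j 1) =
      h * h * ?a (p + s' *\<^sub>R axis j 1 + t' *\<^sub>R axis i 1)" by linarith
  with h have "?b (p + s *\<^sub>R axis i 1 + t *\<^sub>R axis j 1) = ?a (p + s' *\<^sub>R axis j 1 + t' *\<^sub>R axis i 1)"
    by simp
  moreover have "dist (?b (p + s *\<^sub>R axis i 1 + t *\<^sub>R axis j 1)) (?b p) < ?e"
    using near[of s t i j] st d by simp
  moreover have "dist (?a (p + s' *\<^sub>R axis j 1 + t' *\<^sub>R axis i 1)) (?a p) < ?e"
    using near[of s' t' j i] st' d by simp
  ultimately show False by (simp add: dist_real_def abs_if split: if_splits)
qed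

subsection \<open>Lie derivative, curvature and Ricci tensor in coordinates\<close>

text \<open>The component \<open>k\<close> of the Lie derivative of the connection on (\<partial>_i,
  \<partial>_j), in its classical coordinate form.\<close>

definition lie_coeff :: "connection \<Rightarrow> vfield \<Rightarrow> 2 \<Rightarrow> 2 \<Rightarrow> 2 \<Rightarrow> point \<Rightarrow> real" where
  "lie_coeff \<Gamma> X i j k p = partial i (partial j (\<lambda>q. X q $ k)) p +
     (\<Sum>l\<in>UNIV. X p $ l * partial l (\<lambda>q. \<Gamma> q i j k) p - \<Gamma> p i j l * partial l (\<lambda>q. X q $ k) p
       + \<Gamma> p l j k * partial i (\<lambda>q. X q $ l) p + \<Gamma> p i l k * partial j (\<lambda>q. X q $ l) p)"

text \<open>The component \<open>k\<close> of R(\<partial>_1, \<partial>_2) \<partial>_l; on a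
  surface these determine the whole curvature.\<close>

definition curv_coeff :: "connection \<Rightarrow> 2 \<Rightarrow> 2 \<Rightarrow> point \<Rightarrow> real" where
  "curv_coeff \<Gamma> l k p = partial 1 (\<lambda>q. \<Gamma> q 2 l k) p - partial 2 (\<lambda>q. \<Gamma> q 1 l k) p +
     (\<Sum>m\<in>UNIV. \<Gamma> p 2 l m * \<Gamma> p 1 m k - \<Gamma> p 1 l m * \<Gamma> p 2 m k)"

lemma smooth_map_on_const: "open U \<Longrightarrow> smooth_map_on U (\<lambda>_. v)"
  by (simp add: smooth_map_on_def smooth_on_const)

text \<open>Tensoriality: the second derivatives of \<open>Z\<close> cancel by symmetry and the
  first derivatives of \<open>Y\<close> and \<open>Z\<close> cancel outright, so coordinate fields
  suffice as test fields.\<close>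

lemma lie_deriv_conn_formula:
  assumes U: "open U" "p \<in> U" and XYZ: "smooth_map_on U X" "smooth_map_on U Y" "smooth_map_on U Z"
    and \<Gamma>: "\<And>i j k. smooth_on U (\<lambda>q. \<Gamma> q i j k)"
  shows "lie_deriv_conn \<Gamma> X Y Z p $ k =
    (\<Sum>i\<in>UNIV. \<Sum>j\<in>UNIV. Y p $ i * Z p $ j * lie_coeff \<Gamma> X i j k p)"
proof -
  have d: "(\<lambda>q. X q $ i) differentiable at p" "(\<lambda>q. Y q $ i) differentiable at p"
    "(\<lambda>q. Z q $ i) differentiable at p" "partial j (\<lambda>q. X q $ i) differentiable at p"
    "partial j (\<lambda>q. Z q $ i) differentiable at p" "(\<lambda>q. \<Gamma> q i j k) differentiable at p" for i j k
    using XYZ \<Gamma> U smooth_on_differentiable smooth_on_partial unfolding smooth_map_on_def by blast+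
  have c: "partial 1 (partial 2 (\<lambda>q. Z q $ k)) p = partial 2 (partial 1 (\<lambda>q. Z q $ k)) p"
    using XYZ U unfolding smooth_map_on_def by (intro partial_commute[of U]) auto
  show ?thesis
    unfolding lie_deriv_conn_def lie_bracket_def cov_deriv_def directional_def lie_coeff_def
    by (simp add: sum_2 partial_simps d c) algebra
qed

lemma curvature_formula:
  assumes U: "open U" "p \<in> U" and XYZ: "smooth_map_on U X" "smooth_map_on U Y" "smooth_map_on U Z"
    and \<Gamma>: "\<And>i j k. smooth_on U (\<lambda>q. \<Gamma> q i j k)"
  shows "curvature \<Gamma> X Y Z p $ k =
    (X p $ 1 * Y p $ 2 - X p $ 2 * Y p $ 1) * (\<Sum>l\<in>UNIV. Z p $ l * curv_coeff \<Gamma> l k p)"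
proof -
  have d: "(\<lambda>q. X q $ i) differentiable at p" "(\<lambda>q. Y q $ i) differentiable at p"
    "(\<lambda>q. Z q $ i) differentiable at p"
    "partial j (\<lambda>q. Z q $ i) differentiable at p" "(\<lambda>q. \<Gamma> q i j k) differentiable at p" for i j k
    using XYZ \<Gamma> U smooth_on_differentiable smooth_on_partial unfolding smooth_map_on_def by blast+
  have c: "partial 1 (partial 2 (\<lambda>q. Z q $ k)) p = partial 2 (partial 1 (\<lambda>q. Z q $ k)) p"
    using XYZ U unfolding smooth_map_on_def by (intro partial_commute[of U]) auto
  show ?thesis
    unfolding curvature_def lie_bracket_def cov_deriv_def directional_def curv_coeff_def
    by (simp add: sum_2 partial_simps d c) algebra
qed

section \<open>Connections C / x on the half plane and their Killing equation\<close>

lemma open_half_plane: "open half_plane"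
  unfolding half_plane_def by (rule open_halfspace_component_gt_cart)

lemma convex_half_plane: "convex half_plane"
  using convex_halfspace_gt[of 0 "axis 1 1 :: point"]
  by (simp add: half_plane_def inner_axis')

lemma connected_half_plane: "connected half_plane"
  by (rule convex_connected[OF convex_half_plane])

lemma half_plane_pos: "p \<in> half_plane \<Longrightarrow> p $ 1 > 0"
  by (simp add: half_plane_def)

lemma smooth_on_conn: 
  assumes "open U" "U \<subseteq> half_plane"
  shows "smooth_on U (\<lambda>q. conn C q i j k)"
  unfolding conn_def by (intro smooth_intros assms) (use assms half_plane_pos in auto)

lemma partial_conn:
  assumes "p \<in> half_plane"
  shows "partial l (\<lambda>q. conn C q i j k) p = (if l = 1 then - C i j k / (p $ 1)\<^sup>2 else 0)"
  using half_plane_pos[OF assms] by (simp add: conn_def partial_div)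

text \<open>The constant matrix R of the overview, that is, the coefficients of x^2 R(\<partial>_1,
  \<partial>_2). The summand - \<open>C 2 l k\<close> comes from differentiating 1 / x.\<close>

definition curv :: "(2 \<Rightarrow> 2 \<Rightarrow> 2 \<Rightarrow> real) \<Rightarrow> 2 \<Rightarrow> 2 \<Rightarrow> real" where
  "curv C l k = C 2 l 1 * C 1 1 k + C 2 l 2 * C 1 2 k
     - C 1 l 1 * C 2 1 k - C 1 l 2 * C 2 2 k - C 2 l k"

lemma curv_coeff_conn:
  assumes "p \<in> half_plane"
  shows "curv_coeff (conn C) l k p = curv C l k / (p $ 1)\<^sup>2"
  using half_plane_pos[OF assms]
  by (simp add: curv_coeff_def partial_conn[OF assms] sum_2 curv_def)
    (simp add: conn_def field_simps power2_eq_square)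

lemma curvature_conn:
  assumes U: "open U" "U \<subseteq> half_plane" "p \<in> U"
    and XYZ: "smooth_map_on U X" "smooth_map_on U Y" "smooth_map_on U Z"
  shows "curvature (conn C) X Y Z p $ k =
    (X p $ 1 * Y p $ 2 - X p $ 2 * Y p $ 1) * (Z p $ 1 * curv C 1 k + Z p $ 2 * curv C 2 k) / (p $ 1)\<^sup>2"
  using curvature_formula[where \<Gamma> = "conn C", OF U(1,3) XYZ smooth_on_conn[OF U(1,2)]]
    curv_coeff_conn[of p C] U
  by (simp add: sum_2 subset_iff flip: add_divide_distrib)

lemma vector_field_restrict:
  assumes "open U" "smooth_map_on U X"
  shows "vector_field U (restrict_vf U X)"
proof -
  have "smooth_on U (\<lambda>p. restrict_vf U X p $ k) \<longleftrightarrow> smooth_on U (\<lambda>p. X p $ k)" for k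
    by (rule smooth_on_cong[OF assms(1)]) (simp add: restrict_vf_def)
  with assms(2) show ?thesis
    by (simp add: vector_field_def smooth_map_on_def restrict_vf_def)
qed

lemma vector_field_restrict_const: "open U \<Longrightarrow> vector_field U (restrict_vf U (\<lambda>_. v))"
  by (rule vector_field_restrict[OF _ smooth_map_on_const])

lemma vector_field_smooth: "vector_field U X \<Longrightarrow> smooth_map_on U X"
  by (simp add: vector_field_def)

lemma point_in_half_plane: "vector [1, 0] \<in> half_plane"
  by (simp add: half_plane_def)

text \<open>Coordinate fields, cut off outside the half plane, detect the curvature already at the
  point (1, 0), where the factor x^2 is 1.\<close>

lemma flat_conn_iff: "flat half_plane (conn C) \<longleftrightarrow> (\<forall>l k. curv C l k = 0)"
proof
  assume flat: "flat half_plane (conn C)"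
  show "\<forall>l k. curv C l k = 0"
  proof (intro allI)
    fix l k
    let ?R = "\<lambda>v. restrict_vf half_plane (\<lambda>_. v)"
    let ?p = "vector [1, 0] :: point"
    note v = vector_field_restrict_const[OF open_half_plane]
    from flat v point_in_half_plane
    have "curvature (conn C) (?R (axis 1 1)) (?R (axis 2 1)) (?R (axis l 1)) ?p $ k = 0"
      unfolding flat_def by (metis zero_index)
    then show "curv C l k = 0"
      using curvature_conn[OF open_half_plane order_refl point_in_half_plane
          v[of "axis 1 1", THEN vector_field_smooth] v[of "axis 2 1", THEN vector_field_smooth]
          v[of "axis l 1", THEN vector_field_smooth], of C k] exhaust_2[of l]
      by (auto simp: restrict_vf_def point_in_half_plane)
  qed
next
  assume "\<forall>l k. curv C l k = 0"
  then show "flat half_plane (conn C)"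
    using curvature_conn[OF open_half_plane order_refl _ vector_field_smooth vector_field_smooth
        vector_field_smooth]
    by (simp add: flat_def vec_eq_iff)
qed

lemma ricci_conn:
  assumes U: "open U" "U \<subseteq> half_plane" "p \<in> U"
    and XY: "smooth_map_on U X" "smooth_map_on U Y"
  shows "ricci (conn C) X Y p =
    (X p $ 2 * (Y p $ 1 * curv C 1 1 + Y p $ 2 * curv C 2 1)
      - X p $ 1 * (Y p $ 1 * curv C 1 2 + Y p $ 2 * curv C 2 2)) / (p $ 1)\<^sup>2"
  using curvature_conn[OF U smooth_map_on_const[OF U(1)] XY]
  by (simp add: ricci_def trace_def sum_2 diff_divide_distrib)

text \<open>\<open>lie_coeff\<close> of \<open>conn C\<close> multiplied by x^2, which removes all
  divisions.\<close>

definition kill_coeff :: "(2 \<Rightarrow> 2 \<Rightarrow> 2 \<Rightarrow> real) \<Rightarrow> vfield \<Rightarrow> 2 \<Rightarrow> 2 \<Rightarrow> 2 \<Rightarrow> point \<Rightarrow> real" where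
  "kill_coeff C X i j k p = (p $ 1)\<^sup>2 * partial i (partial j (\<lambda>q. X q $ k)) p - C i j k * X p $ 1 +
     p $ 1 * (\<Sum>l\<in>UNIV. C l j k * partial i (\<lambda>q. X q $ l) p
       + C i l k * partial j (\<lambda>q. X q $ l) p - C i j l * partial l (\<lambda>q. X q $ k) p)"

lemma lie_coeff_conn:
  assumes "p \<in> half_plane"
  shows "lie_coeff (conn C) X i j k p = kill_coeff C X i j k p / (p $ 1)\<^sup>2"
  using half_plane_pos[OF assms]
  by (simp add: lie_coeff_def partial_conn[OF assms] sum_2 kill_coeff_def)
    (simp add: conn_def field_simps power2_eq_square)

lemma killing_iff:
  "X \<in> killing C \<longleftrightarrow> vector_field half_plane X \<and>
     (\<forall>p\<in>half_plane. \<forall>i j k. kill_coeff C X i j k p = 0)"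
proof -
  note f = lie_deriv_conn_formula[where \<Gamma> = "conn C", OF open_half_plane _ vector_field_smooth vector_field_smooth
      vector_field_smooth smooth_on_conn[OF open_half_plane order_refl]]
  have "kill_coeff C X i j k p = 0"
    if X: "X \<in> killing C" and p: "p \<in> half_plane" for i j k p
  proof -
    let ?R = "\<lambda>v. restrict_vf half_plane (\<lambda>_. v)"
    note v = vector_field_restrict_const[OF open_half_plane]
    from X v p have "lie_deriv_conn (conn C) X (?R (axis i 1)) (?R (axis j 1)) p $ k = 0"
      unfolding affine_killing_def by simp
    with f[OF p _ v v, of X] X
    have "0 = (\<Sum>a\<in>UNIV. \<Sum>b\<in>UNIV. axis i 1 $ a * axis j 1 $ b * lie_coeff (conn C) X a b k p)"
      using p by (simp add: affine_killing_def restrict_vf_def)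
    then have "lie_coeff (conn C) X i j k p = 0"
      using exhaust_2[of i] exhaust_2[of j] by (auto simp: sum_2)
    then show ?thesis using half_plane_pos[OF p] by (simp add: lie_coeff_conn[OF p])
  qed
  moreover have "lie_deriv_conn (conn C) X Y Z p = 0"
    if "vector_field half_plane X" "\<forall>p\<in>half_plane. \<forall>i j k. kill_coeff C X i j k p = 0"
      "vector_field half_plane Y" "vector_field half_plane Z" "p \<in> half_plane" for Y Z p
    using that by (simp add: vec_eq_iff f lie_coeff_conn)
  ultimately show ?thesis unfolding affine_killing_def by blast
qed

subsection \<open>The invariant frame and the Killing system\<close>

lemma vector_4 [simp]:
  "(vector [a, b, c, d] :: ('a::zero)^4) $ 1 = a" "(vector [a, b, c, d] :: ('a::zero)^4) $ 2 = b"
  "(vector [a, b, c, d] :: ('a::zero)^4) $ 3 = c" "(vector [a, b, c, d] :: ('a::zero)^4) $ 4 = d"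
  unfolding vector_def by simp_all

text \<open>\<open>framed \<beta> \<gamma> C C'\<close>: \<open>C'\<close> is the pull-back of \<open>C\<close> by \<open>(x, y) \<mapsto> (x, \<beta> x + \<gamma> y)\<close>. Equivalently, the
  frame \<open>e1 = x (\<partial>\<^sub>1 + \<beta> \<partial>\<^sub>2)\<close>, \<open>e2 = \<gamma> x \<partial>\<^sub>2\<close>, which commutes with the fields in \<^const>\<open>K0B\<close>, has the
  constant connection coefficients \<open>\<nabla>\<^sub>e\<^sub>i e\<^sub>j = \<delta>\<^sub>i\<^sub>1 e\<^sub>j + C'\<^sub>i\<^sub>j\<^sup>k e\<^sub>k\<close>.\<close>

definition framed :: "real \<Rightarrow> real \<Rightarrow> (2 \<Rightarrow> 2 \<Rightarrow> 2 \<Rightarrow> real) \<Rightarrow> (2 \<Rightarrow> 2 \<Rightarrow> 2 \<Rightarrow> real) \<Rightarrow> bool" where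
  "framed \<beta> \<gamma> C C' \<longleftrightarrow> \<gamma> \<noteq> 0 \<and>
     C 1 2 1 = C 2 1 1 \<and> C 1 2 2 = C 2 1 2 \<and> C' 1 2 1 = C' 2 1 1 \<and> C' 1 2 2 = C' 2 1 2 \<and>
     C' 1 1 1 = C 1 1 1 + 2 * \<beta> * C 1 2 1 + \<beta>\<^sup>2 * C 2 2 1 \<and>
     \<beta> * C' 1 1 1 + \<gamma> * C' 1 1 2 = C 1 1 2 + 2 * \<beta> * C 1 2 2 + \<beta>\<^sup>2 * C 2 2 2 \<and>
     C' 1 2 1 = \<gamma> * (C 1 2 1 + \<beta> * C 2 2 1) \<and>
     \<beta> * C' 1 2 1 + \<gamma> * C' 1 2 2 = \<gamma> * (C 1 2 2 + \<beta> * C 2 2 2) \<and>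
     C' 2 2 1 = \<gamma>\<^sup>2 * C 2 2 1 \<and> \<beta> * C' 2 2 1 + \<gamma> * C' 2 2 2 = \<gamma>\<^sup>2 * C 2 2 2"

text \<open>The endomorphism \<open>A\<close> with \<open>A e\<^sub>j = - [X, e\<^sub>j]\<close>, in the order 1/1, 1/2, 2/1, 2/2 (row / column).
  It vanishes identically iff \<open>X\<close> commutes with the frame.\<close>

definition kA :: "real \<Rightarrow> real \<Rightarrow> vfield \<Rightarrow> point \<Rightarrow> real^4" where
  "kA \<beta> \<gamma> X p = vector
    [partial 1 (\<lambda>q. X q $ 1) p + \<beta> * partial 2 (\<lambda>q. X q $ 1) p - X p $ 1 / p $ 1,
     \<gamma> * partial 2 (\<lambda>q. X q $ 1) p,
     (partial 1 (\<lambda>q. X q $ 2) p - \<beta> * partial 1 (\<lambda>q. X q $ 1) p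
       + \<beta> * (partial 2 (\<lambda>q. X q $ 2) p - \<beta> * partial 2 (\<lambda>q. X q $ 1) p)) / \<gamma>,
     partial 2 (\<lambda>q. X q $ 2) p - \<beta> * partial 2 (\<lambda>q. X q $ 1) p - X p $ 1 / p $ 1]"

text \<open>The Killing equation expresses the derivatives of \<^const>\<open>kA\<close> along the frame through its values.\<close>

definition dA1 :: "(2 \<Rightarrow> 2 \<Rightarrow> 2 \<Rightarrow> real) \<Rightarrow> real^4 \<Rightarrow> real^4" where
  "dA1 C v = vector
    [- (v $ 1 * (1 + C 1 1 1) + 2 * v $ 3 * C 1 2 1 - v $ 2 * C 1 1 2),
     - (v $ 3 * C 2 2 1 + v $ 2 * (C 1 1 1 - C 1 2 2) + v $ 4 * C 1 2 1),
     - (2 * v $ 1 * C 1 1 2 + v $ 3 * (2 * C 1 2 2 - C 1 1 1) - v $ 4 * C 1 1 2),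
     - (v $ 1 * (1 + C 1 2 2) + v $ 3 * C 2 2 2 + v $ 2 * C 1 1 2 - v $ 3 * C 1 2 1)]"

definition dA2 :: "(2 \<Rightarrow> 2 \<Rightarrow> 2 \<Rightarrow> real) \<Rightarrow> real^4 \<Rightarrow> real^4" where
  "dA2 C v = vector
    [- (v $ 2 * (1 + C 1 1 1 - C 1 2 2) + v $ 4 * C 1 2 1 + v $ 3 * C 2 2 1),
     - (2 * v $ 2 * C 1 2 1 + 2 * v $ 4 * C 2 2 1 - v $ 1 * C 2 2 1 - v $ 2 * C 2 2 2),
     - (v $ 2 * C 1 1 2 + v $ 1 * C 1 2 2 + v $ 3 * C 2 2 2 - v $ 3 * C 1 2 1),
     - (v $ 2 * (1 + 2 * C 1 2 2) + v $ 4 * C 2 2 2 - v $ 3 * C 2 2 1)]"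

lemma linear_dA1: "linear (dA1 C)"
  by (rule linearI) (simp_all add: dA1_def vec_eq_iff forall_4 algebra_simps)

lemma linear_dA2: "linear (dA2 C)"
  by (rule linearI) (simp_all add: dA2_def vec_eq_iff forall_4 algebra_simps)

text \<open>Stated for arbitrary functions \<open>A\<close> and not just for \<open>kA\<close> of a
  Killing field: derivatives of solutions along symmetries are solutions again, and can be used
  without integrating them back to vector fields.\<close>

definition A_system :: "real \<Rightarrow> real \<Rightarrow> (2 \<Rightarrow> 2 \<Rightarrow> 2 \<Rightarrow> real) \<Rightarrow> (point \<Rightarrow> real^4) \<Rightarrow> bool" where
  "A_system \<beta> \<gamma> C A \<longleftrightarrow> (\<forall>k. smooth_on half_plane (\<lambda>p. A p $ k)) \<and>
     (\<forall>p\<in>half_plane. \<forall>k.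
        p $ 1 * (partial 1 (\<lambda>q. A q $ k) p + \<beta> * partial 2 (\<lambda>q. A q $ k) p) = dA1 C (A p) $ k \<and>
        \<gamma> * p $ 1 * partial 2 (\<lambda>q. A q $ k) p = dA2 C (A p) $ k)"

lemma vector_field_comp_smooth:
  "vector_field U X \<Longrightarrow> smooth_on U (\<lambda>q. X q $ k)"
  by (simp add: vector_field_def smooth_map_on_def)

lemma smooth_kA:
  assumes "vector_field half_plane X"
  shows "smooth_on half_plane (\<lambda>p. kA \<beta> \<gamma> X p $ k)"
proof -
  note s = vector_field_comp_smooth[OF assms]
  have "\<forall>k. smooth_on half_plane (\<lambda>p. kA \<beta> \<gamma> X p $ k)"
    unfolding kA_def forall_4 vector_4 divide_inverse[of _ \<gamma>]
    by (intro conjI smooth_intros smooth_on_partial s open_half_plane half_plane_pos)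
  then show ?thesis ..
qed

lemma A_system_kA:
  assumes "X \<in> killing C" and fr: "framed \<beta> \<gamma> C C'"
  shows "A_system \<beta> \<gamma> C' (kA \<beta> \<gamma> X)"
proof -
  have X: "vector_field half_plane X" "\<And>p i j k. p \<in> half_plane \<Longrightarrow> kill_coeff C X i j k p = 0"
    using assms(1) killing_iff by auto
  have "p $ 1 * (partial 1 (\<lambda>q. kA \<beta> \<gamma> X q $ k) p + \<beta> * partial 2 (\<lambda>q. kA \<beta> \<gamma> X q $ k) p)
      = dA1 C' (kA \<beta> \<gamma> X p) $ k \<and>
      \<gamma> * p $ 1 * partial 2 (\<lambda>q. kA \<beta> \<gamma> X q $ k) p = dA2 C' (kA \<beta> \<gamma> X p) $ k"
    if p: "p \<in> half_plane" for p k
  proof -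
    let ?u = "\<lambda>q. X q $ 1" and ?v = "\<lambda>q. X q $ 2"
    note x = half_plane_pos[OF p]
    have d: "(\<lambda>q. X q $ i) differentiable at p" "partial j (\<lambda>q. X q $ i) differentiable at p" for i j
      using smooth_on_differentiable[OF open_half_plane _ p] smooth_on_partial
        vector_field_comp_smooth[OF X(1)] by blast+
    have c: "partial 2 (partial 1 (\<lambda>q. X q $ i)) p = partial 1 (partial 2 (\<lambda>q. X q $ i)) p" for i
      by (rule partial_commute[OF open_half_plane vector_field_comp_smooth[OF X(1)] p])
    have g: "\<gamma> \<noteq> 0" and s: "C 2 1 1 = C 1 2 1" "C 2 1 2 = C 1 2 2"
      using fr by (simp_all add: framed_def)
    have K: "kill_coeff C X i j k p = 0" for i j k by (rule X(2)[OF p])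
    define x where "x = p $ 1"
    define u v where "u = X p $ 1" and "v = X p $ 2"
    define u1 u2 v1 v2 where "u1 = partial 1 ?u p" and "u2 = partial 2 ?u p"
      and "v1 = partial 1 ?v p" and "v2 = partial 2 ?v p"
    define u11 u12 u22 where "u11 = partial 1 (partial 1 ?u) p"
      and "u12 = partial 1 (partial 2 ?u) p" and "u22 = partial 2 (partial 2 ?u) p"
    define v11 v12 v22 where "v11 = partial 1 (partial 1 ?v) p"
      and "v12 = partial 1 (partial 2 ?v) p" and "v22 = partial 2 (partial 2 ?v) p"
    note defs = u_def[symmetric] v_def[symmetric] u1_def[symmetric] u2_def[symmetric]
      v1_def[symmetric] v2_def[symmetric] u11_def[symmetric] u12_def[symmetric] u22_def[symmetric]
      v11_def[symmetric] v12_def[symmetric] v22_def[symmetric] x_def[symmetric]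
    have xp: "x > 0" using x by (simp add: x_def)
    have C': "C' 1 1 1 = C 1 1 1 + 2 * \<beta> * C 1 2 1 + \<beta>\<^sup>2 * C 2 2 1"
      "C' 1 2 1 = \<gamma> * (C 1 2 1 + \<beta> * C 2 2 1)" "C' 2 2 1 = \<gamma>\<^sup>2 * C 2 2 1"
      using fr unfolding framed_def by blast+
    have "C' 1 1 2 = (C 1 1 2 + 2 * \<beta> * C 1 2 2 + \<beta>\<^sup>2 * C 2 2 2 - \<beta> * C' 1 1 1) / \<gamma>"
      "C' 1 2 2 = (\<gamma> * (C 1 2 2 + \<beta> * C 2 2 2) - \<beta> * C' 1 2 1) / \<gamma>"
      "C' 2 2 2 = (\<gamma>\<^sup>2 * C 2 2 2 - \<beta> * C' 2 2 1) / \<gamma>"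
    proof -
      have "\<beta> * C' 1 1 1 + \<gamma> * C' 1 1 2 = C 1 1 2 + 2 * \<beta> * C 1 2 2 + \<beta>\<^sup>2 * C 2 2 2"
        "\<beta> * C' 1 2 1 + \<gamma> * C' 1 2 2 = \<gamma> * (C 1 2 2 + \<beta> * C 2 2 2)"
        "\<beta> * C' 2 2 1 + \<gamma> * C' 2 2 2 = \<gamma>\<^sup>2 * C 2 2 2"
        using fr unfolding framed_def by blast+
      with g show "C' 1 1 2 = (C 1 1 2 + 2 * \<beta> * C 1 2 2 + \<beta>\<^sup>2 * C 2 2 2 - \<beta> * C' 1 1 1) / \<gamma>"
        "C' 1 2 2 = (\<gamma> * (C 1 2 2 + \<beta> * C 2 2 2) - \<beta> * C' 1 2 1) / \<gamma>"
        "C' 2 2 2 = (\<gamma>\<^sup>2 * C 2 2 2 - \<beta> * C' 2 2 1) / \<gamma>"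
        by (simp_all add: nonzero_eq_divide_eq algebra_simps)
    qed
    note C'2 = this[unfolded C']
    \<comment> \<open>The Killing equation contains the undifferentiated \<open>u\<close> only as u
      / x; in terms of \<open>w\<close> a factor x splits off from all six components.\<close>
    define w where "w = u / x"
    have uw: "u = x * w" using xp by (simp add: w_def)
    have "x * (x * u11) = x * (C 1 1 1 * w - C 1 1 1 * u1 - 2 * C 1 2 1 * v1 + C 1 1 2 * u2)"
      "x * (x * u12) = x * (C 1 2 1 * w - C 1 1 1 * u2 - C 2 2 1 * v1 - C 1 2 1 * v2 + C 1 2 2 * u2)"
      "x * (x * u22) = x * (C 2 2 1 * w - 2 * C 1 2 1 * u2 + C 2 2 1 * u1 - 2 * C 2 2 1 * v2 + C 2 2 2 * u2)"
      "x * (x * v11) = x * (C 1 1 2 * w - 2 * C 1 1 2 * u1 + C 1 1 1 * v1 - 2 * C 1 2 2 * v1 + C 1 1 2 * v2)"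
      "x * (x * v12) = x * (C 1 2 2 * w - C 1 2 2 * u1 - C 1 1 2 * u2 + C 1 2 1 * v1 - C 2 2 2 * v1)"
      "x * (x * v22) = x * (C 2 2 2 * w - 2 * C 1 2 2 * u2 + C 2 2 1 * v1 - C 2 2 2 * v2)"
      using K[of 1 1 1] K[of 1 2 1] K[of 2 2 1] K[of 1 1 2] K[of 1 2 2] K[of 2 2 2]
      unfolding kill_coeff_def sum_2 s c defs uw
      by (simp_all add: s power2_eq_square algebra_simps)
    note k = this[THEN mult_left_cancel[OF less_imp_neq[OF xp, THEN not_sym], THEN iffD1]]
    \<comment> \<open>Naming 1 / \<gamma>, and 1 / x below, brings all denominators into a common
      form before the eight identities are compared.\<close>
    define \<delta> where "\<delta> = 1 / \<gamma>"
    have \<delta>: "\<gamma> * \<delta> = 1" "\<And>a. a / \<gamma> = a * \<delta>" using g by (simp_all add: \<delta>_def)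
    have \<delta>2: "a * \<gamma> / \<gamma>\<^sup>2 = a * \<delta>" for a using g by (simp add: \<delta>_def power2_eq_square)
    have x2: "a * x / x\<^sup>2 = a / x" for a using xp by (simp add: power2_eq_square)
    have x3: "(a * x - x * w) / x\<^sup>2 = (a - w) / x" for a using xp by (simp add: power2_eq_square field_simps)
    have x4: "x * w / x = w" "x * (a / x) = a" "2 * (x * w) / x = 2 * w" for a using xp by simp_all
    define \<xi> where "\<xi> = 1 / x"
    have kk: "a = b * \<xi>" if "x * a = b" for a b using xp that by (simp add: \<xi>_def field_simps)
    have \<xi>: "x * \<xi> = 1" "\<And>a. a / x = a * \<xi>" using xp by (simp_all add: \<xi>_def)
    have "\<forall>k. p $ 1 * (partial 1 (\<lambda>q. kA \<beta> \<gamma> X q $ k) p + \<beta> * partial 2 (\<lambda>q. kA \<beta> \<gamma> X q $ k) p)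
      = dA1 C' (kA \<beta> \<gamma> X p) $ k \<and>
      \<gamma> * p $ 1 * partial 2 (\<lambda>q. kA \<beta> \<gamma> X q $ k) p = dA2 C' (kA \<beta> \<gamma> X p) $ k"
      unfolding forall_4 kA_def dA1_def dA2_def vector_4
      using x g
      by (simp add: partial_simps d c)
        (unfold defs C' C'2 uw x2 x3 x4 \<delta>(2) \<delta>2 distrib_left[of x] right_diff_distrib[of x] \<xi>(2) k[THEN kk],
          intro conjI, use \<xi>(1) \<delta>(1) in \<open>simp_all add: \<delta>_def \<xi>_def field_simps power2_eq_square\<close>)
    then show ?thesis ..
  qed
  then show ?thesis
    unfolding A_system_def using smooth_kA[OF X(1)] by blast
qed

text \<open>Linear maps commute with differentiation, so one statement covers \<open>A\<close>
  itself and both right-hand sides, which are differentiated once more for the integrability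
  condition.\<close>

lemma A_system_partial:
  assumes A: "A_system \<beta> \<gamma> C A" and p: "p \<in> half_plane" and g: "\<gamma> \<noteq> 0" and L: "linear L"
  shows "(\<lambda>q. L (A q) $ k) differentiable at p"
    "partial 2 (\<lambda>q. L (A q) $ k) p = L (dA2 C (A p)) $ k / (\<gamma> * p $ 1)"
    "partial 1 (\<lambda>q. L (A q) $ k) p = L (dA1 C (A p)) $ k / p $ 1 - \<beta> * (L (dA2 C (A p)) $ k / (\<gamma> * p $ 1))"
proof -
  \<comment> \<open>The total derivative: a vector v has the frame coefficients v_1 / x and (v_2 -
    \<beta> v_1) / (\<gamma> x).\<close>
  let ?D = "\<lambda>v. (v $ 1 / p $ 1) *\<^sub>R dA1 C (A p) + ((v $ 2 - \<beta> * v $ 1) / (\<gamma> * p $ 1)) *\<^sub>R dA2 C (A p)"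
  note x = half_plane_pos[OF p]
  have "((\<lambda>q. A q $ k) has_derivative (\<lambda>v. ?D v $ k)) (at p)" for k
  proof -
    have "(\<lambda>q. A q $ k) differentiable at p"
      using A p smooth_on_differentiable[OF open_half_plane] by (simp add: A_system_def)
    note h = has_derivative_partial[OF this]
    from A p have e: "p $ 1 * (partial 1 (\<lambda>q. A q $ k) p + \<beta> * partial 2 (\<lambda>q. A q $ k) p) = dA1 C (A p) $ k"
      "\<gamma> * p $ 1 * partial 2 (\<lambda>q. A q $ k) p = dA2 C (A p) $ k"
      by (simp_all add: A_system_def)
    from e(2) have e2: "partial 2 (\<lambda>q. A q $ k) p = dA2 C (A p) $ k / (\<gamma> * p $ 1)"
      using g x by (simp add: field_simps)
    from e(1) have "partial 1 (\<lambda>q. A q $ k) p = dA1 C (A p) $ k / p $ 1 - \<beta> * partial 2 (\<lambda>q. A q $ k) p"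
      using x by (simp add: field_simps)
    note e1 = this[unfolded e2]
    show ?thesis
      using h unfolding e1 e2
      by (rule has_derivative_eq_rhs) (simp add: fun_eq_iff algebra_simps diff_divide_distrib)
  qed
  then have "(A has_derivative ?D) (at p)"
    by (subst has_derivative_componentwise_within) (auto simp: Basis_vec_def inner_axis)
  from bounded_linear.has_derivative[OF _ this, of L] L
  have "((\<lambda>q. L (A q)) has_derivative (\<lambda>v. L (?D v))) (at p)"
    by (simp add: linear_conv_bounded_linear)
  from bounded_linear.has_derivative[OF bounded_linear_vec_nth this, of k]
  have D: "((\<lambda>q. L (A q) $ k) has_derivative (\<lambda>v. L (?D v) $ k)) (at p)" .
  then show "(\<lambda>q. L (A q) $ k) differentiable at p" by (auto simp: differentiable_def)
  show "partial 2 (\<lambda>q. L (A q) $ k) p = L (dA2 C (A p)) $ k / (\<gamma> * p $ 1)"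
    "partial 1 (\<lambda>q. L (A q) $ k) p = L (dA1 C (A p)) $ k / p $ 1 - \<beta> * (L (dA2 C (A p)) $ k / (\<gamma> * p $ 1))"
    by (simp_all add: partial_eqI[OF D] linear_add[OF L] linear_cmul[OF L] linear_diff[OF L])
qed

text \<open>The bracket [e1, e2] = e2 applied to \<open>A\<close>. Constant matrices commute with
  derivations, so e1 (e2 A) is \<open>dA2 C (dA1 C A)\<close>: the order of the factors is
  reversed.\<close>

lemma A_system_commute:
  assumes A: "A_system \<beta> \<gamma> C A" and p: "p \<in> half_plane" and g: "\<gamma> \<noteq> 0"
  shows "dA2 C (dA1 C (A p)) - dA1 C (dA2 C (A p)) = dA2 C (A p)"
proof -
  note x = half_plane_pos[OF p]
  have "dA2 C (dA1 C (A p)) $ k - dA1 C (dA2 C (A p)) $ k = dA2 C (A p) $ k" for k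
  proof -
    note P = A_system_partial[OF A _ g]
    have "smooth_on half_plane (\<lambda>p. A p $ k)" using A by (simp add: A_system_def)
    from partial_commute[OF open_half_plane this p, of 2 1]
    have c: "partial 2 (partial 1 (\<lambda>p. A p $ k)) p = partial 1 (partial 2 (\<lambda>p. A p $ k)) p" .
    have 1: "partial 2 (partial 1 (\<lambda>p. A p $ k)) p =
       partial 2 (\<lambda>q. dA1 C (A q) $ k / q $ 1 - \<beta> * (dA2 C (A q) $ k / (\<gamma> * q $ 1))) p"
      by (rule partial_cong[OF open_half_plane p]) (rule P(3)[OF _ linear_id, unfolded id_def])
    have 2: "partial 1 (partial 2 (\<lambda>p. A p $ k)) p =
       partial 1 (\<lambda>q. dA2 C (A q) $ k / (\<gamma> * q $ 1)) p"
      by (rule partial_cong[OF open_half_plane p]) (rule P(2)[OF _ linear_id, unfolded id_def])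
    note d = P(1)[OF p linear_dA1] P(1)[OF p linear_dA2]
    from c[unfolded 1 2] x g
    show ?thesis
      by (simp add: partial_simps d P(2,3)[OF p linear_dA1] P(2,3)[OF p linear_dA2])
        (simp add: field_simps power2_eq_square, simp flip: distrib_left)
  qed
  then show ?thesis by (simp add: vec_eq_iff)
qed

section \<open>Symmetries of the Killing system\<close>

lemma smooth_linear_comp:
  fixes L :: "real^4 \<Rightarrow> real^4"
  assumes L: "linear L" and A: "\<And>k. smooth_on U (\<lambda>q. A q $ k)" and U: "open U"
  shows "smooth_on U (\<lambda>q. L (A q) $ k)"
proof -
  have "L v $ k = v $ 1 * L (axis 1 1) $ k + v $ 2 * L (axis 2 1) $ k
     + v $ 3 * L (axis 3 1) $ k + v $ 4 * L (axis 4 1) $ k" for v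
  proof -
    have "v = v $ 1 *\<^sub>R axis 1 1 + v $ 2 *\<^sub>R axis 2 1 + v $ 3 *\<^sub>R axis 3 1 + v $ 4 *\<^sub>R axis 4 1"
      by (simp add: vec_eq_iff forall_4 axis_def)
    then have "L v = v $ 1 *\<^sub>R L (axis 1 1) + v $ 2 *\<^sub>R L (axis 2 1) + v $ 3 *\<^sub>R L (axis 3 1)
       + v $ 4 *\<^sub>R L (axis 4 1)"
      by (metis linear_add[OF L] linear_cmul[OF L])
    then show ?thesis by simp
  qed
  then have e: "(\<lambda>q. L (A q) $ k) = (\<lambda>q. A q $ 1 * L (axis 1 1) $ k + A q $ 2 * L (axis 2 1) $ k
     + A q $ 3 * L (axis 3 1) $ k + A q $ 4 * L (axis 4 1) $ k)" by (intro ext)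
  show ?thesis unfolding e by (intro smooth_intros U A)
qed

text \<open>The new solution is \<partial>_2 A, as the system does not depend on y.\<close>

lemma A_system_dA2:
  assumes A: "A_system 0 1 C A"
  shows "A_system 0 1 C (\<lambda>q. (1 / q $ 1) *\<^sub>R dA2 C (A q))"
proof -
  note l = linear_dA1[of C] linear_dA2[of C]
  have s: "smooth_on half_plane (\<lambda>q. dA2 C (A q) $ k)" for k
    by (rule smooth_linear_comp[OF l(2) _ open_half_plane]) (use A in \<open>simp add: A_system_def\<close>)
  show ?thesis
    unfolding A_system_def
  proof (intro conjI allI ballI)
    show "smooth_on half_plane (\<lambda>p. ((1 / p $ 1) *\<^sub>R dA2 C (A p)) $ k)" for k
      unfolding vector_scaleR_component real_scaleR_def
      by (intro smooth_intros open_half_plane half_plane_pos s)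
  next
    fix p k assume p: "p \<in> half_plane"
    note x = half_plane_pos[OF p] and P = A_system_partial[OF A p _ l(2), simplified]
    have c: "dA2 C (dA1 C (A p)) = dA1 C (dA2 C (A p)) + dA2 C (A p)"
      using A_system_commute[OF A p] by (simp add: algebra_simps)
    have d: "(\<lambda>q::point. 1 / q $ 1) differentiable at p"
      using x by (intro differentiable_div) auto
    show "p $ 1 * (partial 1 (\<lambda>q. ((1 / q $ 1) *\<^sub>R dA2 C (A q)) $ k) p
        + 0 * partial 2 (\<lambda>q. ((1 / q $ 1) *\<^sub>R dA2 C (A q)) $ k) p)
      = dA1 C ((1 / p $ 1) *\<^sub>R dA2 C (A p)) $ k"
      unfolding vector_scaleR_component real_scaleR_def partial_mult[OF d P(1)]
      using x by (simp add: P(2,3) partial_simps c linear_cmul[OF l(1)])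
        (simp add: field_simps power2_eq_square)
    show "1 * p $ 1 * partial 2 (\<lambda>q. ((1 / q $ 1) *\<^sub>R dA2 C (A q)) $ k) p
      = dA2 C ((1 / p $ 1) *\<^sub>R dA2 C (A p)) $ k"
      unfolding vector_scaleR_component real_scaleR_def partial_mult[OF d P(1)]
      using x by (simp add: P(2,3) partial_simps c linear_cmul[OF l(2)])
  qed
qed

text \<open>The new solution is x \<partial>_1 A + (y - b) \<partial>_2 A, the derivative along the
  dilation about (0, b), which preserves the frame. The free centre later makes the second summand
  vanish at a given point.\<close>

lemma A_system_dA1:
  assumes A: "A_system 0 1 C A"
  shows "A_system 0 1 C (\<lambda>q. dA1 C (A q) + ((q $ 2 - b) / q $ 1) *\<^sub>R dA2 C (A q))"
proof -
  note l = linear_dA1[of C] linear_dA2[of C]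
  have s: "smooth_on half_plane (\<lambda>q. dA2 C (A q) $ k)" "smooth_on half_plane (\<lambda>q. dA1 C (A q) $ k)" for k
    by (rule smooth_linear_comp[OF _ _ open_half_plane], use A l in \<open>auto simp add: A_system_def\<close>)+
  show ?thesis
    unfolding A_system_def
  proof (intro conjI allI ballI)
    show "smooth_on half_plane (\<lambda>q. (dA1 C (A q) + ((q $ 2 - b) / q $ 1) *\<^sub>R dA2 C (A q)) $ k)" for k
      unfolding vector_scaleR_component real_scaleR_def vector_add_component
      by (intro smooth_intros open_half_plane half_plane_pos s)
  next
    fix p k assume p: "p \<in> half_plane"
    note x = half_plane_pos[OF p] and P1 = A_system_partial[OF A p _ l(1), simplified]
      and P2 = A_system_partial[OF A p _ l(2), simplified]
    have c: "dA2 C (dA1 C (A p)) = dA1 C (dA2 C (A p)) + dA2 C (A p)"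
      using A_system_commute[OF A p] by (simp add: algebra_simps)
    have d: "(\<lambda>q::point. (q $ 2 - b) / q $ 1) differentiable at p"
      "(\<lambda>q::point. q $ 2 - b) differentiable at p"
      using x by (auto intro!: partial_simps)
    have d': "(\<lambda>q. (q $ 2 - b) / q $ 1 * dA2 C (A q) $ k) differentiable at p"
      by (rule differentiable_arith(3)[OF d(1) P2(1)])
    have x': "p $ 1 \<noteq> 0" using x by simp
    have e: "partial i (\<lambda>q. (dA1 C (A q) + ((q $ 2 - b) / q $ 1) *\<^sub>R dA2 C (A q)) $ k) p =
       partial i (\<lambda>q. dA1 C (A q) $ k) p + ((p $ 2 - b) / p $ 1 * partial i (\<lambda>q. dA2 C (A q) $ k) p
        + (partial i (\<lambda>q. q $ 2 - b) p * p $ 1 - (p $ 2 - b) * partial i (\<lambda>q. q $ 1) p) / (p $ 1)\<^sup>2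
           * dA2 C (A p) $ k)" for i
      unfolding vector_scaleR_component real_scaleR_def vector_add_component partial_add[OF P1(1) d']
        partial_mult[OF d(1) P2(1)] partial_div[OF d(2) differentiable_coord x'] by simp
    show "p $ 1 * (partial 1 (\<lambda>q. (dA1 C (A q) + ((q $ 2 - b) / q $ 1) *\<^sub>R dA2 C (A q)) $ k) p
        + 0 * partial 2 (\<lambda>q. (dA1 C (A q) + ((q $ 2 - b) / q $ 1) *\<^sub>R dA2 C (A q)) $ k) p)
      = dA1 C (dA1 C (A p) + ((p $ 2 - b) / p $ 1) *\<^sub>R dA2 C (A p)) $ k"
      unfolding e using x by (simp add: P1(2,3) P2(2,3) partial_simps c linear_cmul[OF l(1)] linear_add[OF l(1)])
        (simp add: field_simps power2_eq_square)
    show "1 * p $ 1 * partial 2 (\<lambda>q. (dA1 C (A q) + ((q $ 2 - b) / q $ 1) *\<^sub>R dA2 C (A q)) $ k) p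
      = dA2 C (dA1 C (A p) + ((p $ 2 - b) / p $ 1) *\<^sub>R dA2 C (A p)) $ k"
      unfolding e using x by (simp add: P1(2,3) P2(2,3) partial_simps c linear_cmul[OF l(2)] linear_add[OF l(2)])
        (simp add: field_simps power2_eq_square)
  qed
qed

lemma A_system_add:
  assumes "A_system 0 1 C A" "A_system 0 1 C B"
  shows "A_system 0 1 C (\<lambda>q. A q + c *\<^sub>R B q)"
  unfolding A_system_def
proof (intro conjI allI ballI)
  show "smooth_on half_plane (\<lambda>p. (A p + c *\<^sub>R B p) $ k)" for k
    unfolding vector_scaleR_component real_scaleR_def vector_add_component
    using assms by (intro smooth_intros open_half_plane) (auto simp: A_system_def)
next
  fix p k assume p: "p \<in> half_plane"
  have d: "(\<lambda>q. A q $ k) differentiable at p" "(\<lambda>q. B q $ k) differentiable at p"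
    using assms p smooth_on_differentiable[OF open_half_plane] by (simp_all add: A_system_def)
  note [simp] = linear_cmul[OF linear_dA1] linear_add[OF linear_dA1]
    linear_cmul[OF linear_dA2] linear_add[OF linear_dA2]
  have "p $ 1 * partial 1 (\<lambda>q. A q $ k) p = dA1 C (A p) $ k" "p $ 1 * partial 2 (\<lambda>q. A q $ k) p = dA2 C (A p) $ k"
    "p $ 1 * partial 1 (\<lambda>q. B q $ k) p = dA1 C (B p) $ k" "p $ 1 * partial 2 (\<lambda>q. B q $ k) p = dA2 C (B p) $ k"
    using assms p by (auto simp: A_system_def)
  note e = this[symmetric]
  show "p $ 1 * (partial 1 (\<lambda>q. (A q + c *\<^sub>R B q) $ k) p + 0 * partial 2 (\<lambda>q. (A q + c *\<^sub>R B q) $ k) p)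
    = dA1 C (A p + c *\<^sub>R B p) $ k"
    by (simp add: partial_simps d e algebra_simps)
  show "1 * p $ 1 * partial 2 (\<lambda>q. (A q + c *\<^sub>R B q) $ k) p = dA2 C (A p + c *\<^sub>R B p) $ k"
    by (simp add: partial_simps d e algebra_simps)
qed

subsection \<open>Nilpotency and normal forms\<close>

text \<open>Powers of an endomorphism of a finite-dimensional space are linearly dependent. If \<open>P(N)\<close> is the
  annihilating polynomial of least degree \<open>d\<close>, then commuting it with \<open>M\<close> shows that \<open>N P'(N)\<close> vanishes
  too, so \<open>d P - t P'\<close> is zero and \<open>P = t\<^sup>d\<close>.\<close>

lemma nilpotent_of_commutator:
  fixes M N :: "real^'n::finite \<Rightarrow> real^'n"
  assumes lin: "linear M" "linear N"
    and M: "\<And>w. w \<in> W \<Longrightarrow> M w \<in> W" and N: "\<And>w. w \<in> W \<Longrightarrow> N w \<in> W"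
    and comm: "\<And>w. w \<in> W \<Longrightarrow> N (M w) = M (N w) + N w"
  obtains d where "\<And>w. w \<in> W \<Longrightarrow> (N ^^ d) w = 0"
proof -
  have linp: "linear (N ^^ n)" for n
    by (induction n) (use lin linear_compose[of _ N] in \<open>auto simp: linear_ident o_def\<close>)
  have Np: "(N ^^ n) w \<in> W" if "w \<in> W" for n w
    using that N by (induction n) auto
  have commp: "(N ^^ n) (M w) = M ((N ^^ n) w) + real n *\<^sub>R (N ^^ n) w" if "w \<in> W" for n w
  proof (induction n)
    case (Suc n)
    then show ?case
      by (simp add: linear_add[OF lin(2)] linear_cmul[OF lin(2)] comm[OF Np[OF that]] algebra_simps)
  qed simp
  \<comment> \<open>The powers of \<open>N\<close> are compared as matrices, which are vectors of a
    space of known finite dimension.\<close>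
  define x where "x n = matrix (N ^^ n)" for n
  have x: "x n *v w = (N ^^ n) w" for n w
    unfolding x_def using fun_cong[OF matrix_vector_mul(2)[OF linp[of n]]] .
  define Q where "Q d \<longleftrightarrow> (\<exists>c::nat \<Rightarrow> real. \<forall>w\<in>W. (N ^^ d) w = (\<Sum>k<d. c k *\<^sub>R (N ^^ k) w))" for d
  have "\<exists>d. x d \<in> span (x ` {..<d})"
  proof (rule ccontr)
    assume no: "\<nexists>d. x d \<in> span (x ` {..<d})"
    have "independent (x ` {..<n}) \<and> card (x ` {..<n}) = n" for n
    proof (induction n)
      case (Suc n)
      have "x n \<notin> x ` {..<n}" using no span_base[of "x n" "x ` {..<n}"] by auto
      then show ?case using Suc no[unfolded not_ex, rule_format, of n]
        by (simp add: lessThan_Suc independent_insert)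
    qed (simp add: independent_empty)
    from this[of "Suc (DIM((real^'n)^'n))"] independent_bound[of "x ` {..<Suc (DIM((real^'n)^'n))}"]
    show False by linarith
  qed
  then obtain d where "x d \<in> span (x ` {..<d})" ..
  then have "Q d"
  proof -
    have step0: "\<exists>c. y = (\<Sum>k<d. c k *\<^sub>R x k)" if "y \<in> span (x ` {..<d})" for y
      using that
    proof (induction rule: span_induct_alt)
      case base
      show ?case by (rule exI[of _ "\<lambda>_. 0"]) simp
    next
      case (step a z y)
      then obtain j c where j: "j < d" "z = x j" "y = (\<Sum>k<d. c k *\<^sub>R x k)" by auto
      have "a *\<^sub>R z = (\<Sum>k<d. (if k = j then a else 0) *\<^sub>R x k)"
        using j(1,2) sum.delta[of "{..<d}" j "\<lambda>k. a *\<^sub>R x k"]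
by (simp add: if_distribR if_distrib[of "\<lambda>r. r *\<^sub>R _"] cong: if_cong)
      then have "a *\<^sub>R z + y = (\<Sum>k<d. ((if k = j then a else 0) + c k) *\<^sub>R x k)"
        by (simp only: j(3) scaleR_add_left sum.distrib)
      then show ?case by (rule exI[of _ "\<lambda>k. (if k = j then a else 0) + c k"])
    qed
    have Fx: "(\<Sum>k<n. c k *\<^sub>R x k) *v w = (\<Sum>k<n. c k *\<^sub>R (x k *v w))" for n c w
      by (induction n) (simp_all add: matrix_vector_mult_add_rdistrib scaleR_matrix_vector_assoc)
    from step0 \<open>x d \<in> span (x ` {..<d})\<close> obtain c where c: "x d = (\<Sum>k<d. c k *\<^sub>R x k)" by blast
    have "x d *v w = (\<Sum>k<d. c k *\<^sub>R (x k *v w))" for w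
      unfolding c by (rule Fx)
    then show ?thesis unfolding Q_def x by (intro exI[of _ c]) simp
  qed
  then have "Q (LEAST d. Q d)" by (rule LeastI)
  moreover define e where "e = (LEAST d. Q d)"
  ultimately obtain c where c: "\<And>w. w \<in> W \<Longrightarrow> (N ^^ e) w = (\<Sum>k<e. c k *\<^sub>R (N ^^ k) w)"
    unfolding Q_def by blast
  have least: "\<not> Q j" if "j < e" for j
    using that not_less_Least unfolding e_def by blast
  \<comment> \<open>The relation for \<open>N ^^ e\<close> at \<open>M w\<close>, minus
    \<open>M\<close> of the relation at \<open>w\<close>, multiplies the \<open>k\<close>-th
    coefficient by \<open>k\<close> and the left side by \<open>e\<close>.\<close>
  have z: "(\<Sum>k<e. ((real e - real k) * c k) *\<^sub>R (N ^^ k) w) = 0" if w: "w \<in> W" for w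
  proof -
    have "M ((N ^^ e) w) + real e *\<^sub>R (N ^^ e) w = (\<Sum>k<e. c k *\<^sub>R (M ((N ^^ k) w) + real k *\<^sub>R (N ^^ k) w))"
      using c[OF M[OF w]] by (simp add: commp[OF w])
    also have "\<dots> = M (\<Sum>k<e. c k *\<^sub>R (N ^^ k) w) + (\<Sum>k<e. (real k * c k) *\<^sub>R (N ^^ k) w)"
      by (simp add: linear_sum[OF lin(1)] linear_cmul[OF lin(1)] scaleR_add_right sum.distrib mult.commute)
    finally have "real e *\<^sub>R (\<Sum>k<e. c k *\<^sub>R (N ^^ k) w) = (\<Sum>k<e. (real k * c k) *\<^sub>R (N ^^ k) w)"
      by (simp add: c[OF w])
    then show ?thesis
      by (simp add: scaleR_sum_right left_diff_distrib scaleR_diff_left sum_subtractf)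
  qed
  have "c k = 0" if "k < e" for k
  proof (rule ccontr)
    assume "c k \<noteq> 0"
    define J where "J = {k. k < e \<and> c k \<noteq> 0}"
    have fin: "finite J" "J \<noteq> {}" using \<open>c k \<noteq> 0\<close> that by (auto simp: J_def)
    \<comment> \<open>As e - j is nonzero, \<open>z\<close> can be solved for the power of highest
      index \<open>j\<close>, against the minimality of \<open>e\<close>.\<close>
    define j where "j = Max J"
    have j: "j < e" "c j \<noteq> 0" using Max_in[OF fin] by (auto simp: j_def J_def)
    have above: "c k = 0" if "j < k" "k < e" for k
    proof (rule ccontr)
      assume "c k \<noteq> 0"
      then have "k \<in> J" using that by (simp add: J_def)
      from Max_ge[OF fin(1) this] that show False by (simp add: j_def)
    qed
    have "Q j"
      unfolding Q_def
    proof (intro exI ballI)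
      fix w assume w: "w \<in> W"
      have "(\<Sum>k<e. ((real e - real k) * c k) *\<^sub>R (N ^^ k) w) =
        (\<Sum>k<Suc j. ((real e - real k) * c k) *\<^sub>R (N ^^ k) w)"
        using j above by (intro sum.mono_neutral_right) auto
      with z[OF w] have "((real e - real j) * c j) *\<^sub>R (N ^^ j) w =
        - (\<Sum>k<j. ((real e - real k) * c k) *\<^sub>R (N ^^ k) w)"
        by (simp add: eq_neg_iff_add_eq_0 add.commute)
      then have "(1 / ((real e - real j) * c j)) *\<^sub>R (((real e - real j) * c j) *\<^sub>R (N ^^ j) w) =
        (1 / ((real e - real j) * c j)) *\<^sub>R (- (\<Sum>k<j. ((real e - real k) * c k) *\<^sub>R (N ^^ k) w))"
        by simp
      then show "(N ^^ j) w = (\<Sum>k<j. (- ((real e - real k) * c k) / ((real e - real j) * c j)) *\<^sub>R (N ^^ k) w)"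
        using j by (simp add: scaleR_sum_right sum_negf)
    qed
    with least[OF j(1)] show False ..
  qed
  then have "(N ^^ e) w = 0" if "w \<in> W" for w using c[OF that] by simp
  then show ?thesis by (rule that)
qed

text \<open>The last nonzero iterate of \<open>N\<close> on \<open>w\<close> lies in the
  kernel.\<close>

lemma kernel_of_commutator:
  fixes M N :: "real^'n::finite \<Rightarrow> real^'n"
  assumes "linear M" "linear N"
    and "\<And>w. w \<in> W \<Longrightarrow> M w \<in> W" and N: "\<And>w. w \<in> W \<Longrightarrow> N w \<in> W"
    and "\<And>w. w \<in> W \<Longrightarrow> N (M w) = M (N w) + N w" and w: "w \<in> W" "w \<noteq> 0"
  obtains z where "z \<in> W" "z \<noteq> 0" "N z = 0"
proof -
  obtain d where "\<And>w. w \<in> W \<Longrightarrow> (N ^^ d) w = 0"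
    using nilpotent_of_commutator[OF assms(1-5)] by metis
  with w have "\<exists>n. (N ^^ n) w = 0" by blast
  define n where "n = (LEAST n. (N ^^ n) w = 0)"
  have n: "(N ^^ n) w = 0" unfolding n_def by (rule LeastI_ex) fact
  with w obtain m where m: "n = Suc m" by (cases n) auto
  have "(N ^^ m) w \<noteq> 0" using not_less_Least[of m "\<lambda>n. (N ^^ n) w = 0"] m by (simp add: n_def)
  moreover have "(N ^^ k) w \<in> W" for k using w N by (induction k) auto
  ultimately show ?thesis using that[of "(N ^^ m) w"] n m by simp
qed

text \<open>When \<open>C\<^sub>2\<^sub>2\<^sup>1 \<noteq> 0\<close>, such a \<open>w\<close> determines all constants, and they are those of a sheared copy of the
  flat connection with \<open>C\<^sub>1\<^sub>1\<^sup>1 = 1\<close> and \<open>C\<^sub>2\<^sub>2\<^sup>1\<close> as the only nonzero ones.\<close>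

lemma invariant_kernel_cases:
  assumes sym: "\<And>k. C 2 1 k = C 1 2 k"
    and W0: "\<And>w. w \<in> W0 \<Longrightarrow> dA2 C w = 0" "\<And>w. w \<in> W0 \<Longrightarrow> w $ 2 = 0" "\<And>w. w \<in> W0 \<Longrightarrow> dA1 C w \<in> W0"
    and w: "w \<in> W0" "w \<noteq> 0"
  shows "C 1 2 1 = 0 \<and> C 2 2 1 = 0 \<and> C 2 2 2 = 0 \<or> (\<forall>l k. curv C l k = 0)"
proof -
  have e: "w $ 4 * C 1 2 1 + w $ 3 * C 2 2 1 = 0" "2 * w $ 4 * C 2 2 1 = w $ 1 * C 2 2 1"
    "w $ 1 * C 1 2 2 + w $ 3 * C 2 2 2 - w $ 3 * C 1 2 1 = 0" "w $ 4 * C 2 2 2 = w $ 3 * C 2 2 1"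
    "dA1 C w $ 1 = - (w $ 1 * (1 + C 1 1 1) + 2 * w $ 3 * C 1 2 1)"
    "dA1 C w $ 3 = - (2 * w $ 1 * C 1 1 2 + w $ 3 * (2 * C 1 2 2 - C 1 1 1) - w $ 4 * C 1 1 2)"
    "dA1 C w $ 4 = - w $ 1" if "w \<in> W0" for w
    using W0(1,2)[OF that] by (auto simp: dA1_def dA2_def vec_eq_iff forall_4 algebra_simps)
  have nz: "w $ 1 \<noteq> 0 \<or> w $ 3 \<noteq> 0 \<or> w $ 4 \<noteq> 0"
    using w W0(2) by (auto simp: vec_eq_iff forall_4)
  note w1 = W0(3)[OF w(1)]
  note w2 = W0(3)[OF w1]
  show ?thesis
  proof (cases "C 2 2 1 = 0")
    case True
    have 4: ?thesis if "v \<in> W0" "v $ 4 \<noteq> 0" for v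
      using e(1,4)[OF that(1)] that(2) True by simp
    \<comment> \<open>The fourth entries of \<open>w\<close>, \<open>dA1 C w\<close> and
      \<open>dA1 C (dA1 C w)\<close> are w_4, -w_1 and the negative first entry of
      \<open>dA1 C w\<close>. If one of them is nonzero, that vector settles the claim; otherwise
      only w_3 survives.\<close>
    show ?thesis
    proof (cases "w $ 4 = 0 \<and> w $ 1 = 0 \<and> dA1 C w $ 1 = 0")
      case False
      then show ?thesis
        using 4[OF w(1)] 4[OF w1] 4[OF w2] e(7)[OF w(1)] e(7)[OF w1] by auto
    next
      case z: True
      then have "w $ 3 \<noteq> 0" using nz by blast
      with z e(3)[OF w(1)] e(5)[OF w(1)] True show ?thesis by auto
    qed
  next
    case h: False
    have q: "w $ 1 = 2 * w $ 4" using e(2)[OF w(1)] h by simp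
    have p: "w $ 4 \<noteq> 0"
      using e(4)[OF w(1)] h q nz by auto
    \<comment> \<open>The slope of the shear: \<open>dA2 C w = 0\<close> makes every element of
      \<open>W0\<close> a multiple of (2, 0, \<kappa>, 1).\<close>
    define \<kappa> where "\<kappa> = C 2 2 2 / C 2 2 1"
    have c222: "C 2 2 2 = \<kappa> * C 2 2 1" using h by (simp add: \<kappa>_def)
    have s: "w $ 3 = \<kappa> * w $ 4" using e(4)[OF w(1)] h by (simp add: \<kappa>_def field_simps)
    have "w $ 4 * (C 1 2 1 + C 2 2 2) = 0" using e(1,4)[OF w(1)] by (simp add: algebra_simps)
    then have c121: "C 1 2 1 = - \<kappa> * C 2 2 1" using p by (simp add: c222)
    have "w $ 4 * (2 * C 1 2 2 + 2 * \<kappa> * C 2 2 2) = 0"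
      using e(3)[OF w(1)] by (simp add: q s c121 c222 algebra_simps)
    then have c122: "C 1 2 2 = - \<kappa>\<^sup>2 * C 2 2 1" using p by (simp add: c222 power2_eq_square)
    \<comment> \<open>On this line \<open>dA1 C\<close> acts by -2, as the fourth entry -w_1 shows;
      the other entries of the eigenvector equation give \<open>C 1 1 1\<close> and
      \<open>C 1 1 2\<close>.\<close>
    have q0: "2 * dA1 C w $ 4 = dA1 C w $ 1" using e(2)[OF w1] h by simp
    have q1: "dA1 C w $ 1 = - 4 * w $ 4" using e(7)[OF w(1)] q q0 by simp
    have s1: "dA1 C w $ 3 = - 2 * \<kappa> * w $ 4"
    proof -
      have "(dA1 C w $ 4 * \<kappa> - dA1 C w $ 3) * C 2 2 1 = 0"
        using e(4)[OF w1] by (simp add: c222 algebra_simps)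
      then have "dA1 C w $ 4 * \<kappa> = dA1 C w $ 3" using h by (simp only: mult_eq_0_iff) simp
      then show ?thesis using e(7)[OF w(1)] q by (simp add: algebra_simps)
    qed
    have "w $ 4 * (2 * (1 + C 1 1 1) + 2 * \<kappa> * C 1 2 1 - 4) = 0"
      using e(5)[OF w(1)] by (simp add: q1 q s algebra_simps)
    then have c111: "C 1 1 1 = 1 + \<kappa>\<^sup>2 * C 2 2 1" using p by (simp add: c121 power2_eq_square)
    have "w $ 4 * (3 * C 1 1 2 + \<kappa> * (2 * C 1 2 2 - C 1 1 1) - 2 * \<kappa>) = 0"
      using e(6)[OF w(1)] by (simp add: s1 q s algebra_simps)
    then have "3 * C 1 1 2 + \<kappa> * (2 * C 1 2 2 - C 1 1 1) - 2 * \<kappa> = 0" using p by simp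
    then have c112: "C 1 1 2 = \<kappa> + \<kappa>^3 * C 2 2 1"
      by (simp add: c122 c111 power2_eq_square power3_eq_cube algebra_simps)
    have "\<forall>l k. curv C l k = 0"
      unfolding forall_2 curv_def sym c111 c112 c121 c122 c222
      by (simp add: algebra_simps power2_eq_square power3_eq_cube)
    then show ?thesis ..
  qed
qed

text \<open>On the kernel of \<open>dA2 C\<close> the map \<open>dA1 C\<close> keeps the second
  entry. So for a kernel vector \<open>z\<close> with nonzero second entry,
  \<open>dA1 C z - z\<close> is either zero, which is the last alternative, or a nonzero vector to
  which \<open>invariant_kernel_cases\<close> applies.\<close>

lemma invariant_subspace_cases:
  assumes sym: "\<And>k. C 2 1 k = C 1 2 k"
    and W: "subspace W" "\<And>w. w \<in> W \<Longrightarrow> dA1 C w \<in> W" "\<And>w. w \<in> W \<Longrightarrow> dA2 C w \<in> W"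
    and comm: "\<And>w. w \<in> W \<Longrightarrow> dA2 C (dA1 C w) = dA1 C (dA2 C w) + dA2 C w"
    and w: "w \<in> W" "w \<noteq> 0"
  shows "C 1 2 1 = 0 \<and> C 2 2 1 = 0 \<and> C 2 2 2 = 0 \<or> (\<forall>l k. curv C l k = 0) \<or>
     (\<exists>v. v $ 2 = 1 \<and> dA2 C v = 0 \<and> dA1 C v = v)"
proof -
  obtain z where z: "z \<in> W" "z \<noteq> 0" "dA2 C z = 0"
    using kernel_of_commutator[OF linear_dA1 linear_dA2 W(2,3) comm w] by blast
  define W0 where "W0 = {v \<in> W. dA2 C v = 0 \<and> v $ 2 = 0}"
  \<comment> \<open>\<open>dA1 C v $ 2 - v $ 2\<close> is the first entry of
    \<open>dA2 C v\<close>.\<close>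
  have t: "dA1 C v $ 2 = v $ 2" if "dA2 C v = 0" for v
  proof -
    have "dA2 C v $ 1 = 0" using that by simp
    then show ?thesis by (simp add: dA1_def dA2_def algebra_simps)
  qed
  have inv: "dA1 C v \<in> W0" if "v \<in> W0" for v
    using that W(2) comm[of v] t[of v] by (simp add: W0_def linear_0[OF linear_dA1])
  have *: ?thesis if v: "v \<in> W0" "v \<noteq> 0" for v
  proof -
    have "C 1 2 1 = 0 \<and> C 2 2 1 = 0 \<and> C 2 2 2 = 0 \<or> (\<forall>l k. curv C l k = 0)"
      by (rule invariant_kernel_cases[where C = C and ?W0.0 = W0 and w = v, OF sym _ _ inv v])
        (simp_all add: W0_def)
    then show ?thesis by (elim disjE) simp_all
  qed
  show ?thesis
  proof (cases "z $ 2 = 0")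
    case True
    then have "z \<in> W0" using z by (simp add: W0_def)
    then show ?thesis using z(2) by (rule *)
  next
    case False
    show ?thesis
    proof (cases "dA1 C z = z")
      case True
      have "((1 / z $ 2) *\<^sub>R z) $ 2 = 1" "dA2 C ((1 / z $ 2) *\<^sub>R z) = 0"
        "dA1 C ((1 / z $ 2) *\<^sub>R z) = (1 / z $ 2) *\<^sub>R z"
        using z(3) True False by (simp_all add: linear_cmul[OF linear_dA2] linear_cmul[OF linear_dA1])
      then show ?thesis by blast
    next
      case False
      have "dA2 C (dA1 C z) = 0" using comm[OF z(1)] z(3) by (simp add: linear_0[OF linear_dA1])
      then have "dA1 C z - z \<in> W0"
        using z W t[OF z(3)] by (simp add: W0_def linear_diff[OF linear_dA2] subspace_diff)
      moreover have "dA1 C z - z \<noteq> 0" using False by simp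
      ultimately show ?thesis by (rule *)
    qed
  qed
qed

text \<open>\<open>W\<close> consists of the values at \<open>p\<close> of all solutions, whether or
  not they come from Killing fields; the symmetries of the system make it stable under both
  matrices.\<close>

lemma A_system_cases:
  assumes sym: "\<And>k. C 2 1 k = C 1 2 k" and A: "A_system 0 1 C A" "p \<in> half_plane" "A p \<noteq> 0"
  shows "C 1 2 1 = 0 \<and> C 2 2 1 = 0 \<and> C 2 2 2 = 0 \<or> (\<forall>l k. curv C l k = 0) \<or>
     (\<exists>v. v $ 2 = 1 \<and> dA2 C v = 0 \<and> dA1 C v = v)"
proof -
  note x = half_plane_pos[OF A(2)]
  define W where "W = {B p |B. A_system 0 1 C B}"
  have 1: "A p \<in> W" using A by (auto simp: W_def)
  have lin: "u + c *\<^sub>R v \<in> W" if "u \<in> W" "v \<in> W" for u v c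
  proof -
    from that obtain B B' where "A_system 0 1 C B" "A_system 0 1 C B'" "u = B p" "v = B' p"
      by (auto simp: W_def)
    with A_system_add[of C B B' c] show ?thesis
      unfolding W_def by (intro CollectI exI[of _ "\<lambda>q. B q + c *\<^sub>R B' q"]) simp
  qed
  have z: "0 \<in> W" using lin[of "A p" "A p" "-1"] A by (auto simp: W_def)
  have cm: "c *\<^sub>R u \<in> W" if "u \<in> W" for u c using lin[OF z that, of c] by simp
  have 2: "subspace W"
    using z cm lin[of _ _ 1] by (simp add: subspace_def)
  have 3: "dA1 C w \<in> W" if "w \<in> W" for w
  proof -
    from that obtain B where B: "A_system 0 1 C B" "w = B p" by (auto simp: W_def)
    \<comment> \<open>The dilation is centred at the height of \<open>p\<close>, where the summand
      with \<open>dA2 C\<close> drops out.\<close>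
    from A_system_dA1[OF B(1), of "p $ 2"] have "dA1 C (B p) + ((p $ 2 - p $ 2) / p $ 1) *\<^sub>R dA2 C (B p) \<in> W"
      
      unfolding W_def
      by (intro CollectI exI[of _ "\<lambda>q. dA1 C (B q) + ((q $ 2 - p $ 2) / q $ 1) *\<^sub>R dA2 C (B q)"]) simp
    then show ?thesis by (simp add: B)
  qed
  have 4: "dA2 C w \<in> W" if "w \<in> W" for w
  proof -
    from that obtain B where B: "A_system 0 1 C B" "w = B p" by (auto simp: W_def)
    from A_system_dA2[OF B(1)] have "(1 / p $ 1) *\<^sub>R dA2 C (B p) \<in> W"
      unfolding W_def by (intro CollectI exI[of _ "\<lambda>q. (1 / q $ 1) *\<^sub>R dA2 C (B q)"]) simp
    from cm[OF this, of "p $ 1"] x show ?thesis by (simp add: B)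
  qed
  have 5: "dA2 C (dA1 C w) = dA1 C (dA2 C w) + dA2 C w" if "w \<in> W" for w
    using that A_system_commute[OF _ A(2), of 0 1 C] by (auto simp: W_def algebra_simps)
  show ?thesis
    by (rule invariant_subspace_cases[where C = C and W = W and w = "A p", OF sym 2 3 4 5 1 A(3)])
qed

text \<open>Solving \<open>dA2 C v = 0\<close>, \<open>dA1 C v = v\<close> for \<open>C\<close> with \<open>v = (0, 1, c, 0)\<close> leaves exactly these constants, with
  \<open>h1\<close>, \<open>h2\<close> free when \<open>c = 0\<close>. They are the connections that admit the Killing field \<^term>\<open>X_field c\<close>.\<close>

definition nform :: "(2 \<Rightarrow> 2 \<Rightarrow> 2 \<Rightarrow> real) \<Rightarrow> real \<Rightarrow> real \<Rightarrow> real \<Rightarrow> bool" where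
  "nform C c h1 h2 \<longleftrightarrow> C = consts6 (-3/2 - c * h1 / 2) (- c * h2 / 2) (h2 / 2) ((c * h1 - 1) / 2) h1 h2 \<and>
     c * h2 = 0 \<and> c * (1 + c * h1) = 0"

lemma consts6_simps [simp]:
  "consts6 a b c d e f 1 1 1 = a" "consts6 a b c d e f 1 1 2 = b"
  "consts6 a b c d e f 1 2 1 = c" "consts6 a b c d e f 1 2 2 = d"
  "consts6 a b c d e f 2 1 1 = c" "consts6 a b c d e f 2 1 2 = d"
  "consts6 a b c d e f 2 2 1 = e" "consts6 a b c d e f 2 2 2 = f"
  by (simp_all add: consts6_def)

lemma nform_exists:
  assumes sym: "\<And>k. C 2 1 k = C 1 2 k" and v: "v $ 2 = 1" "dA2 C v = 0" "dA1 C v = v"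
  obtains \<beta> c h1 h2 C' where "framed \<beta> 1 C C'" "nform C' c h1 h2"
proof -
  have e: "1 + C 1 1 1 - C 1 2 2 + v $ 4 * C 1 2 1 + v $ 3 * C 2 2 1 = 0"
    "2 * C 1 2 1 + 2 * v $ 4 * C 2 2 1 - v $ 1 * C 2 2 1 - C 2 2 2 = 0"
    "C 1 1 2 + v $ 1 * C 1 2 2 + v $ 3 * C 2 2 2 - v $ 3 * C 1 2 1 = 0"
    "1 + 2 * C 1 2 2 + v $ 4 * C 2 2 2 - v $ 3 * C 2 2 1 = 0"
    "v $ 1 = - (v $ 1 * (1 + C 1 1 1) + 2 * v $ 3 * C 1 2 1 - C 1 1 2)"
    "v $ 3 = - (2 * v $ 1 * C 1 1 2 + v $ 3 * (2 * C 1 2 2 - C 1 1 1) - v $ 4 * C 1 1 2)"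
    "v $ 4 = - (v $ 1 * (1 + C 1 2 2) + v $ 3 * C 2 2 2 + C 1 1 2 - v $ 3 * C 1 2 1)"
    using v by (auto simp: dA1_def dA2_def vec_eq_iff forall_4)
  \<comment> \<open>As an endomorphism \<open>v\<close> has trace zero, by the third and the seventh
    equation, and the new frame e1 + \<beta> e2, e2 brings it to the form (0, 1, c, 0).\<close>
  define \<beta> c where "\<beta> = v $ 4" and "c = v $ 3 + \<beta>\<^sup>2"
  have p: "v $ 4 = \<beta>" by (simp add: \<beta>_def)
  have q: "v $ 1 = - \<beta>" using e(3,7) by (simp add: \<beta>_def algebra_simps)
  have s: "v $ 3 = c - \<beta>\<^sup>2" by (simp add: c_def)
  define h1 h2 where "h1 = C 2 2 1" and "h2 = C 2 2 2 - \<beta> * C 2 2 1"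
  have c22: "C 2 2 1 = h1" "C 2 2 2 = h2 + \<beta> * h1" by (simp_all add: h1_def h2_def)
  note e' = e[unfolded p q s c22]
  have c121: "C 1 2 1 = h2 / 2 - \<beta> * h1" using e'(2) by (simp add: algebra_simps)
  have c122: "C 1 2 2 = (c * h1 - 1) / 2 - \<beta> * h2 / 2 - \<beta>\<^sup>2 * h1"
    using e'(4) by (simp add: field_simps power2_eq_square)
  have c111: "C 1 1 1 = -3/2 - c * h1 / 2 - \<beta> * h2 + \<beta>\<^sup>2 * h1"
    using e'(1) unfolding c121 c122 by (simp add: field_simps power2_eq_square)
  have c112: "C 1 1 2 = \<beta> * C 1 2 2 - (c - \<beta>\<^sup>2) * (h2 / 2 + 2 * \<beta> * h1)"
    using e'(3) unfolding c121 by (simp add: field_simps power2_eq_square)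
  have c1: "c * h2 = 0"
    using e'(5) unfolding c112 c122 c121 c111 by (simp add: field_simps power2_eq_square)
  \<comment> \<open>Entry 3 of the eigenvector equation yields 3/2 times c (1 + c h1), plus a
    multiple of c h2, which is already known to vanish.\<close>
  have c2: "c * (1 + c * h1) = 0"
  proof -
    have "3/2 * (c * (1 + c * h1) + \<beta> * (c * h2)) = c - \<beta>\<^sup>2 + (2 * - \<beta> * C 1 1 2
        + (c - \<beta>\<^sup>2) * (2 * C 1 2 2 - C 1 1 1) - \<beta> * C 1 1 2)"
      unfolding c112 c122 c111 by (simp add: field_simps power2_eq_square)
    moreover from e'(6) have "c - \<beta>\<^sup>2 + (2 * - \<beta> * C 1 1 2
        + (c - \<beta>\<^sup>2) * (2 * C 1 2 2 - C 1 1 1) - \<beta> * C 1 1 2) = 0" by linarith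
    ultimately have "3/2 * (c * (1 + c * h1) + \<beta> * (c * h2)) = 0" by (simp only:)
    then show ?thesis using c1 by auto
  qed
  define C' where "C' = consts6 (-3/2 - c * h1 / 2) (- c * h2 / 2) (h2 / 2) ((c * h1 - 1) / 2) h1 h2"
  have "framed \<beta> 1 C C'"
    unfolding framed_def C'_def consts6_simps sym c112 c122 c121 c111 c22
    by (simp add: field_simps power2_eq_square)
  moreover have "nform C' c h1 h2" unfolding nform_def C'_def by (intro conjI refl c1 c2)
  ultimately show ?thesis by (rule that)
qed

subsection \<open>Killing algebras isomorphic to su(1,1)\<close>

text \<open>Vector fields form an infinite-dimensional space; the dimensions of Killing algebras are
  read off from injective parametrisations.\<close>

lemma dim_range_linear:
  fixes F :: "'a::euclidean_space \<Rightarrow> 'b::real_vector"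
  assumes "linear F" "inj F"
  shows "dim (range F) = DIM('a)"
proof -
  have "independent (F ` Basis)"
    using linear_independent_injective_image[OF assms(1) independent_Basis]
      inj_on_subset[OF assms(2)] by blast
  from dim_span_eq_card_independent[OF this] show ?thesis
    using card_image[of F Basis] inj_on_subset[OF assms(2), of Basis]
    by (simp add: linear_span_image[OF assms(1)])
qed

section \<open>Vector fields given by their component functions\<close>

lemma hp_field_nth:
  "p \<in> half_plane \<Longrightarrow> hp_field u v p $ 1 = u (p $ 1) (p $ 2)"
  "p \<in> half_plane \<Longrightarrow> hp_field u v p $ 2 = v (p $ 1) (p $ 2)"
  by (simp_all add: hp_field_def restrict_vf_def)

lemma hp_field_cong:
  assumes "\<And>x y. x > 0 \<Longrightarrow> u x y = u' x y" "\<And>x y. x > 0 \<Longrightarrow> v x y = v' x y"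
  shows "hp_field u v = hp_field u' v'"
  using assms by (auto simp: hp_field_def restrict_vf_def fun_eq_iff half_plane_def)

lemma hp_field_plus:
  "hp_field u v + hp_field u' v' = hp_field (\<lambda>x y. u x y + u' x y) (\<lambda>x y. v x y + v' x y)"
  by (simp add: fun_eq_iff hp_field_def restrict_vf_def vec_eq_iff forall_2)

lemma hp_field_scaleR: "c *\<^sub>R hp_field u v = hp_field (\<lambda>x y. c * u x y) (\<lambda>x y. c * v x y)"
  by (simp add: fun_eq_iff hp_field_def restrict_vf_def scaleR_fun_def vec_eq_iff forall_2)

lemma hp_field_zero: "hp_field (\<lambda>x y. 0) (\<lambda>x y. 0) = 0"
  by (simp add: fun_eq_iff hp_field_def restrict_vf_def vec_eq_iff forall_2)

lemma hp_field_eq_iff: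
  "hp_field u v = hp_field u' v' \<longleftrightarrow> (\<forall>x y. x > 0 \<longrightarrow> u x y = u' x y \<and> v x y = v' x y)" (is "?L \<longleftrightarrow> ?R")
proof
  assume eq: ?L
  show ?R
  proof (intro allI impI)
    fix x y :: real assume "x > 0"
    then have "vector [x, y] \<in> half_plane" by (simp add: half_plane_def)
    from hp_field_nth[OF this, of u v] hp_field_nth[OF this, of u' v']
    show "u x y = u' x y \<and> v x y = v' x y" by (simp add: eq)
  qed
qed (auto intro: hp_field_cong)

lemma vector_field_eq_hp_field:
  assumes "vector_field half_plane X"
    "\<And>p. p \<in> half_plane \<Longrightarrow> X p $ 1 = u (p $ 1) (p $ 2)" "\<And>p. p \<in> half_plane \<Longrightarrow> X p $ 2 = v (p $ 1) (p $ 2)"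
  shows "X = hp_field u v"
  using assms by (auto simp: fun_eq_iff vec_eq_iff forall_2 hp_field_def restrict_vf_def vector_field_def)

lemma vector_field_hp_field:
  assumes "smooth_on half_plane (\<lambda>p. u (p $ 1) (p $ 2))" "smooth_on half_plane (\<lambda>p. v (p $ 1) (p $ 2))"
  shows "vector_field half_plane (hp_field u v)"
  unfolding hp_field_def
  by (rule vector_field_restrict[OF open_half_plane])
    (use assms in \<open>simp add: smooth_map_on_def forall_2\<close>)

lemma span_pair:
  fixes x y :: "'a::real_vector"
  shows "span {x, y} = {a *\<^sub>R x + b *\<^sub>R y |a b. True}"
proof -
  have "z \<in> span {x, y} \<longleftrightarrow> (\<exists>a b. z = a *\<^sub>R x + b *\<^sub>R y)" for z
    by (auto simp: span_insert span_singleton algebra_simps)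
  then show ?thesis by blast
qed

lemma K0B_eq: "K0B = {hp_field (\<lambda>x y. a * x) (\<lambda>x y. a * y + b) |a b. True}"
  unfolding K0B_def span_pair by (simp add: hp_field_scaleR hp_field_plus)

lemma kill_coeff_add:
  assumes X: "vector_field half_plane X" "vector_field half_plane Y" and p: "p \<in> half_plane"
  shows "kill_coeff C (X + c *\<^sub>R Y) i j k p = kill_coeff C X i j k p + c * kill_coeff C Y i j k p"
proof -
  have d: "(\<lambda>q. Z q $ i) differentiable at q" "partial j (\<lambda>q. Z q $ i) differentiable at q"
    if "vector_field half_plane Z" "q \<in> half_plane" for i j q Z
    using smooth_on_differentiable[OF open_half_plane _ that(2)] smooth_on_partial
      vector_field_comp_smooth[OF that(1)] by blast+
  have 1: "partial j (\<lambda>q. (X + c *\<^sub>R Y) q $ i) q = partial j (\<lambda>q. X q $ i) q + c * partial j (\<lambda>q. Y q $ i) q"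
    if "q \<in> half_plane" for i j q
    using d[OF X(1) that] d[OF X(2) that] by (simp add: scaleR_fun_def partial_simps)
  have 2: "partial i (partial j (\<lambda>q. (X + c *\<^sub>R Y) q $ k)) p
     = partial i (partial j (\<lambda>q. X q $ k)) p + c * partial i (partial j (\<lambda>q. Y q $ k)) p" for i j k
    by (subst partial_cong[OF open_half_plane p 1]) (use d[OF X(1) p] d[OF X(2) p] in \<open>simp_all add: partial_simps\<close>)
  show ?thesis
    unfolding kill_coeff_def 2 1[OF p] sum_2 by (simp add: scaleR_fun_def algebra_simps)
qed

lemma vector_field_add:
  assumes "vector_field half_plane X" "vector_field half_plane Y"
  shows "vector_field half_plane (X + c *\<^sub>R Y)"
  using assms unfolding vector_field_def smooth_map_on_def
  by (auto simp: scaleR_fun_def intro!: smooth_intros open_half_plane)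

lemma killing_add:
  assumes "X \<in> killing C" "Y \<in> killing C"
  shows "X + c *\<^sub>R Y \<in> killing C"
  using assms by (auto simp: killing_iff vector_field_add kill_coeff_add)

lemma kA_add:
  assumes X: "vector_field half_plane X" "vector_field half_plane Y" and p: "p \<in> half_plane"
  shows "kA \<beta> \<gamma> (X + c *\<^sub>R Y) p = kA \<beta> \<gamma> X p + c *\<^sub>R kA \<beta> \<gamma> Y p"
proof -
  have d: "(\<lambda>q. Z q $ i) differentiable at p" if "vector_field half_plane Z" for i Z
    using smooth_on_differentiable[OF open_half_plane _ p] vector_field_comp_smooth[OF that] by blast
  have 1: "partial j (\<lambda>q. (X + c *\<^sub>R Y) q $ i) p = partial j (\<lambda>q. X q $ i) p + c * partial j (\<lambda>q. Y q $ i) p" for i j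
    using d[OF X(1)] d[OF X(2)] by (simp add: scaleR_fun_def partial_simps)
  show ?thesis
    unfolding kA_def vec_eq_iff forall_4 1
    by (simp add: scaleR_fun_def algebra_simps add_divide_distrib diff_divide_distrib)
qed

lemma kill_coeff_hp_field:
  assumes p: "p \<in> half_plane"
    and 1: "\<And>q i. q \<in> half_plane \<Longrightarrow> partial i (\<lambda>q. u (q $ 1) (q $ 2)) q = du i q"
      "\<And>q i. q \<in> half_plane \<Longrightarrow> partial i (\<lambda>q. v (q $ 1) (q $ 2)) q = dv i q"
  shows "kill_coeff C (hp_field u v) i j 1 p =
      (p $ 1)\<^sup>2 * partial i (du j) p - C i j 1 * u (p $ 1) (p $ 2) +
        p $ 1 * (C 1 j 1 * du i p + C i 1 1 * du j p - C i j 1 * du 1 p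
          + C 2 j 1 * dv i p + C i 2 1 * dv j p - C i j 2 * du 2 p)" (is ?A)
    "kill_coeff C (hp_field u v) i j 2 p =
      (p $ 1)\<^sup>2 * partial i (dv j) p - C i j 2 * u (p $ 1) (p $ 2) +
        p $ 1 * (C 1 j 2 * du i p + C i 1 2 * du j p - C i j 1 * dv 1 p
          + C 2 j 2 * dv i p + C i 2 2 * dv j p - C i j 2 * dv 2 p)" (is ?B)
proof -
  have e1: "partial i (\<lambda>q. hp_field u v q $ 1) q = du i q" "partial i (\<lambda>q. hp_field u v q $ 2) q = dv i q"
    if "q \<in> half_plane" for i q
    using 1[OF that] partial_cong[OF open_half_plane that, of "\<lambda>q. hp_field u v q $ 1" "\<lambda>q. u (q $ 1) (q $ 2)"]
      partial_cong[OF open_half_plane that, of "\<lambda>q. hp_field u v q $ 2" "\<lambda>q. v (q $ 1) (q $ 2)"] hp_field_nth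
    by simp_all
  have e2: "partial i (partial j (\<lambda>q. hp_field u v q $ 1)) p = partial i (du j) p"
    "partial i (partial j (\<lambda>q. hp_field u v q $ 2)) p = partial i (dv j) p" for i j
    using partial_cong[OF open_half_plane p, of "partial j (\<lambda>q. hp_field u v q $ 1)" "du j"]
      partial_cong[OF open_half_plane p, of "partial j (\<lambda>q. hp_field u v q $ 2)" "dv j"] e1 by simp_all
  show ?A ?B
    unfolding kill_coeff_def sum_2 e1[OF p] e2 by (simp_all add: hp_field_nth[OF p] algebra_simps)
qed

text \<open>The flows are translations in y and dilations, which preserve C / x whatever the
  constants are.\<close>

lemma K0B_subset_killing: "K0B \<subseteq> killing C"
proof
  fix X assume "X \<in> K0B"
  then obtain a b where X: "X = hp_field (\<lambda>x y. a * x) (\<lambda>x y. a * y + b)" by (auto simp: K0B_eq)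
  have v: "vector_field half_plane X"
    unfolding X by (intro vector_field_hp_field smooth_intros open_half_plane)
  moreover have "kill_coeff C X i j k p = 0" if p: "p \<in> half_plane" for p i j k
  proof -
    have 1: "partial i (\<lambda>q. a * q $ 1) q = (if i = 1 then a else 0)"
      "partial i (\<lambda>q. a * q $ 2 + b) q = (if i = 2 then a else 0)" for i q
      by (simp_all add: partial_simps)
    note k = kill_coeff_hp_field[OF p, where u = "\<lambda>x y. a * x" and v = "\<lambda>x y. a * y + b" and C = C, OF 1]
    show ?thesis
      using exhaust_2[of i] exhaust_2[of j] exhaust_2[of k]
      unfolding X by (elim disjE) (simp_all add: k)
  qed
  ultimately show "X \<in> killing C" by (simp add: killing_iff)
qed

lemma eq_const_mult_x:
  assumes "\<And>q. q \<in> half_plane \<Longrightarrow> f differentiable at q"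
    "\<And>q. q \<in> half_plane \<Longrightarrow> q $ 1 * partial 1 f q = f q" "\<And>q. q \<in> half_plane \<Longrightarrow> partial 2 f q = 0"
  obtains c where "\<And>q. q \<in> half_plane \<Longrightarrow> f q = c * q $ 1"
proof -
  have x: "q $ 1 > 0" if "q \<in> half_plane" for q using half_plane_pos[OF that] .
  have "(\<lambda>q. f q / q $ 1) differentiable at q" "partial i (\<lambda>q. f q / q $ 1) q = 0" if "q \<in> half_plane" for q i
    using assms[OF that] x[OF that] exhaust_2[of i] by (auto simp: partial_simps algebra_simps)
  from constant_on_open[OF open_half_plane connected_half_plane this]
  obtain c where c: "\<And>q. q \<in> half_plane \<Longrightarrow> f q / q $ 1 = c" by blast
  have "f q = c * q $ 1" if "q \<in> half_plane" for q
    using c[OF that] x[OF that] by (simp add: field_simps)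
  then show ?thesis by (rule that)
qed

text \<open>Commuting with the frame makes X_1 / x a constant \<open>a\<close>, and then X_2 - a y a
  constant too.\<close>

lemma kA_zero_imp_K0B:
  assumes X: "vector_field half_plane X" and z: "\<And>p. p \<in> half_plane \<Longrightarrow> kA \<beta> \<gamma> X p = 0" and g: "\<gamma> \<noteq> 0"
  shows "X \<in> K0B"
proof -
  have d: "(\<lambda>q. X q $ i) differentiable at p" if "p \<in> half_plane" for i p
    using smooth_on_differentiable[OF open_half_plane _ that] vector_field_comp_smooth[OF X] by blast
  have e: "partial 1 (\<lambda>q. X q $ 1) p = X p $ 1 / p $ 1" "partial 2 (\<lambda>q. X q $ 1) p = 0"
    "partial 1 (\<lambda>q. X q $ 2) p = 0" "partial 2 (\<lambda>q. X q $ 2) p = X p $ 1 / p $ 1" if "p \<in> half_plane" for p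
    using z[OF that] g by (auto simp: kA_def vec_eq_iff forall_4 algebra_simps)
  obtain a where a: "\<And>q. q \<in> half_plane \<Longrightarrow> X q $ 1 = a * q $ 1"
    by (rule eq_const_mult_x[of "\<lambda>q. X q $ 1"]) (use d e half_plane_pos in force)+
  have "(\<lambda>q. X q $ 2 - a * q $ 2) differentiable at p"
    "partial i (\<lambda>q. X q $ 2 - a * q $ 2) p = 0" if "p \<in> half_plane" for p i
    using d[OF that] e[OF that] a[OF that] half_plane_pos[OF that] exhaust_2[of i]
    by (auto simp: partial_simps)
  from constant_on_open[OF open_half_plane connected_half_plane this]
  obtain b where b: "\<And>q. q \<in> half_plane \<Longrightarrow> X q $ 2 - a * q $ 2 = b" by blast
  have "X = hp_field (\<lambda>x y. a * x) (\<lambda>x y. a * y + b)"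
    by (rule vector_field_eq_hp_field[OF X a]) (use b in force)+
  then show ?thesis by (auto simp: K0B_eq)
qed

text \<open>The push-forward of \<open>X_field c\<close> under (x, y) \<mapsto> (x, \<beta> x + y).
  It is a field in the original coordinates, so that \<open>C\<close> itself need not be replaced by
  its sheared form.\<close>

definition X_shear :: "real \<Rightarrow> real \<Rightarrow> vfield" where
  "X_shear \<beta> c = hp_field (\<lambda>x y. 2 * x * y - 2 * \<beta> * x\<^sup>2) (\<lambda>x y. y\<^sup>2 + (c - \<beta>\<^sup>2) * x\<^sup>2)"

lemma X_field_eq: "X_field \<sigma> = X_shear 0 \<sigma>"
  by (simp add: X_field_def X_shear_def)

lemma framed_nform_values:
  assumes fr: "framed \<beta> 1 C C'" and nf: "nform C' c h1 h2"
  shows "C 2 2 1 = h1" "C 2 2 2 = h2 + \<beta> * h1" "C 1 2 1 = h2 / 2 - \<beta> * h1"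
    "C 1 2 2 = (c * h1 - 1) / 2 - \<beta> * h2 / 2 - \<beta>\<^sup>2 * h1"
    "C 1 1 1 = - 3 / 2 - c * h1 / 2 - \<beta> * h2 + \<beta>\<^sup>2 * h1"
    "C 1 1 2 = - \<beta> / 2 - 3 / 2 * \<beta> * c * h1 - c * h2 / 2 + \<beta>^3 * h1"
    "C 2 1 1 = h2 / 2 - \<beta> * h1" "C 2 1 2 = (c * h1 - 1) / 2 - \<beta> * h2 / 2 - \<beta>\<^sup>2 * h1"
proof -
  have C': "C' 1 1 1 = - 3 / 2 - c * h1 / 2" "C' 1 1 2 = - c * h2 / 2" "C' 1 2 1 = h2 / 2"
    "C' 1 2 2 = (c * h1 - 1) / 2" "C' 2 2 1 = h1" "C' 2 2 2 = h2"
    using nf unfolding nform_def by (metis consts6_simps)+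
  have f: "C' 1 1 1 = C 1 1 1 + 2 * \<beta> * C 1 2 1 + \<beta>\<^sup>2 * C 2 2 1"
     "\<beta> * C' 1 1 1 + 1 * C' 1 1 2 = C 1 1 2 + 2 * \<beta> * C 1 2 2 + \<beta>\<^sup>2 * C 2 2 2"
     "C' 1 2 1 = 1 * (C 1 2 1 + \<beta> * C 2 2 1)"
     "\<beta> * C' 1 2 1 + 1 * C' 1 2 2 = 1 * (C 1 2 2 + \<beta> * C 2 2 2)"
     "C' 2 2 1 = 1\<^sup>2 * C 2 2 1" "\<beta> * C' 2 2 1 + 1 * C' 2 2 2 = 1\<^sup>2 * C 2 2 2"
     "C 2 1 1 = C 1 2 1" "C 2 1 2 = C 1 2 2"
    using fr unfolding framed_def by argo+
  show 1: "C 2 2 1 = h1" using f(5) by (simp add: C')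
  show 2: "C 2 2 2 = h2 + \<beta> * h1" using f(6) by (simp add: C')
  show 3: "C 1 2 1 = h2 / 2 - \<beta> * h1" using f(3) unfolding C' 1 mult_1 by linarith
  show 4: "C 1 2 2 = (c * h1 - 1) / 2 - \<beta> * h2 / 2 - \<beta>\<^sup>2 * h1"
    using f(4) by (simp add: C' 2 field_simps power2_eq_square)
  show 5: "C 1 1 1 = - 3 / 2 - c * h1 / 2 - \<beta> * h2 + \<beta>\<^sup>2 * h1"
    using f(1) by (simp add: C' 1 3 field_simps power2_eq_square)
  show 6: "C 1 1 2 = - \<beta> / 2 - 3 / 2 * \<beta> * c * h1 - c * h2 / 2 + \<beta>^3 * h1"
    using f(2) by (simp add: C' 2 4 field_simps power2_eq_square power3_eq_cube)
  show "C 2 1 1 = h2 / 2 - \<beta> * h1" using 3 f(7) by simp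
  show "C 2 1 2 = (c * h1 - 1) / 2 - \<beta> * h2 / 2 - \<beta>\<^sup>2 * h1" using 4 f(8) by simp
qed

lemma nform_cases:
  assumes "nform C' c h1 h2"
  obtains "c = 0" | "c \<noteq> 0" "h2 = 0" "c * h1 = -1"
proof -
  have "c * h2 = 0" "c * (1 + c * h1) = 0" using assms by (simp_all only: nform_def)
  then show ?thesis using that by (auto simp: add_eq_0_iff)
qed

lemma partial_X_shear:
  "partial i (\<lambda>q. 2 * q $ 1 * q $ 2 - 2 * \<beta> * (q $ 1)\<^sup>2) q =
     (if i = 1 then 2 * q $ 2 - 4 * \<beta> * q $ 1 else 2 * q $ 1)"
  "partial i (\<lambda>q. (q $ 2)\<^sup>2 + (c - \<beta>\<^sup>2) * (q $ 1)\<^sup>2) q =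
     (if i = 1 then 2 * (c - \<beta>\<^sup>2) * q $ 1 else 2 * q $ 2)"
  using exhaust_2[of i] by (auto simp: power2_eq_square partial_simps algebra_simps)

lemma vector_field_X_shear: "vector_field half_plane (X_shear \<beta> c)"
  unfolding X_shear_def by (intro vector_field_hp_field smooth_intros open_half_plane)

lemma X_shear_killing:
  assumes fr: "framed \<beta> 1 C C'" and nf: "nform C' c h1 h2"
  shows "X_shear \<beta> c \<in> killing C"
proof -
  note C = framed_nform_values[OF fr nf]
  have "kill_coeff C (X_shear \<beta> c) i j k p = 0" if p: "p \<in> half_plane" for p i j k
  proof -
    note kk = kill_coeff_hp_field[OF p, where u = "\<lambda>x y. 2 * x * y - 2 * \<beta> * x\<^sup>2"
        and v = "\<lambda>x y. y\<^sup>2 + (c - \<beta>\<^sup>2) * x\<^sup>2" and C = C, OF partial_X_shear, folded X_shear_def]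
    show ?thesis
      using nf
    proof (cases rule: nform_cases)
      case 1
      show ?thesis
        using exhaust_2[of i] exhaust_2[of j] exhaust_2[of k]
        by (elim disjE) (simp_all only: kk, simp_all add: 1 C partial_simps field_simps power2_eq_square power3_eq_cube)
    next
      case 2
      have hc: "h1 * c = -1" "h1 * (c * z) = - z" "c * (h1 * z) = - z" for z
        using 2(3) by (simp_all add: mult.commute) (metis mult.assoc mult_minus1 mult.commute)+
      show ?thesis
        using exhaust_2[of i] exhaust_2[of j] exhaust_2[of k]
        by (elim disjE) (simp_all only: kk, simp_all add: C 2 hc partial_simps field_simps power2_eq_square power3_eq_cube)
    qed
  qed
  then show ?thesis by (simp add: killing_iff vector_field_X_shear)
qed

text \<open>The value is 2 x times the eigenvector (0, 1, c, 0) from which \<open>nform\<close>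
  arose.\<close>

lemma kA_X_shear: "p \<in> half_plane \<Longrightarrow> kA \<beta> 1 (X_shear \<beta> c) p = vector [0, 2 * p $ 1, 2 * c * p $ 1, 0]"
proof -
  assume p: "p \<in> half_plane"
  have e: "partial i (\<lambda>q. X_shear \<beta> c q $ 1) p = partial i (\<lambda>q. 2 * q $ 1 * q $ 2 - 2 * \<beta> * (q $ 1)\<^sup>2) p"
    "partial i (\<lambda>q. X_shear \<beta> c q $ 2) p = partial i (\<lambda>q. (q $ 2)\<^sup>2 + (c - \<beta>\<^sup>2) * (q $ 1)\<^sup>2) p" for i
    by (rule partial_cong[OF open_half_plane p], simp add: X_shear_def hp_field_nth)+
  show ?thesis
    using half_plane_pos[OF p] unfolding kA_def e partial_X_shear unfolding X_shear_def hp_field_nth[OF p]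
    by (simp add: vec_eq_iff forall_4 field_simps power2_eq_square)
qed

text \<open>The commutation relation says that the matrix \<open>A\<close> satisfies \<open>[A, R] = tr A \<cdot> R\<close>, which is
  \<open>\<L>\<^sub>X R = 0\<close> for the curvature \<open>R\<close>.\<close>

lemma A_system_curvature:
  assumes A: "A_system \<beta> \<gamma> C A" and p: "p \<in> half_plane" and g: "\<gamma> \<noteq> 0" and sym: "\<And>k. C 2 1 k = C 1 2 k"
  defines "q \<equiv> A p $ 1" and "t \<equiv> A p $ 2" and "s \<equiv> A p $ 3" and "u \<equiv> A p $ 4"
  shows "t * curv C 1 2 - s * curv C 2 1 = (q + u) * curv C 1 1"
    "q * curv C 2 1 + t * curv C 2 2 - t * curv C 1 1 - u * curv C 2 1 = (q + u) * curv C 2 1"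
    "s * curv C 1 1 + u * curv C 1 2 - q * curv C 1 2 - s * curv C 2 2 = (q + u) * curv C 1 2"
    "s * curv C 2 1 - t * curv C 1 2 = (q + u) * curv C 2 2"
proof -
  have "dA2 C (dA1 C (A p)) $ k - dA1 C (dA2 C (A p)) $ k - dA2 C (A p) $ k = 0" for k
    using A_system_commute[OF A p g] by (metis cancel_comm_monoid_add_class.diff_cancel vector_minus_component)
  note c = this[of 1] this[of 2] this[of 3] this[of 4]
  note c' = c[unfolded dA1_def dA2_def vector_4, folded q_def t_def s_def u_def]
  show "t * curv C 1 2 - s * curv C 2 1 = (q + u) * curv C 1 1"
    using c'(1) unfolding curv_def sym by (simp add: algebra_simps)
  show "q * curv C 2 1 + t * curv C 2 2 - t * curv C 1 1 - u * curv C 2 1 = (q + u) * curv C 2 1"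
    using c'(2) unfolding curv_def sym by (simp add: algebra_simps)
  show "s * curv C 1 1 + u * curv C 1 2 - q * curv C 1 2 - s * curv C 2 2 = (q + u) * curv C 1 2"
    using c'(3) unfolding curv_def sym by (simp add: algebra_simps)
  show "s * curv C 2 1 - t * curv C 1 2 = (q + u) * curv C 2 2"
    using c'(4) unfolding curv_def sym by (simp add: algebra_simps)
qed

text \<open>The curvature relations are linear conditions on \<open>A\<close>, and differentiating a
  condition along the frame yields further ones, until a multiple of (0, 1, c, 0) is left. The
  condition on \<open>h1\<close> and \<open>h2\<close> excludes the flat connection: h1 = h2 = 0
  forces c = 0 and zero curvature.\<close>

lemma nform_A_system:
  assumes nf: "nform C' c h1 h2" and h: "h1 \<noteq> 0 \<or> h2 \<noteq> 0" and A: "A_system \<beta> 1 C' A"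
    and p: "p \<in> half_plane"
  shows "A p $ 1 = 0" "A p $ 3 = c * A p $ 2" "A p $ 4 = 0"
    "p $ 1 * partial 1 (\<lambda>q. A q $ 2) p = A p $ 2" "partial 2 (\<lambda>q. A q $ 2) p = 0"
proof -
  have C': "C' 1 1 1 = - 3 / 2 - c * h1 / 2" "C' 1 1 2 = - c * h2 / 2" "C' 1 2 1 = h2 / 2"
    "C' 1 2 2 = (c * h1 - 1) / 2" "C' 2 2 1 = h1" "C' 2 2 2 = h2"
    using nf unfolding nform_def by (metis consts6_simps)+
  have sym: "C' 2 1 k = C' 1 2 k" for k
    using nf exhaust_2[of k] unfolding nform_def by (metis consts6_simps)
  note R = A_system_curvature[OF A _ one_neq_zero sym]
  have A_system: "q $ 1 * (partial 1 (\<lambda>q. A q $ k) q + \<beta> * partial 2 (\<lambda>q. A q $ k) q) = dA1 C' (A q) $ k"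
    "q $ 1 * partial 2 (\<lambda>q. A q $ k) q = dA2 C' (A q) $ k" if "q \<in> half_plane" for q k
    using A that by (simp_all add: A_system_def)
  have d: "(\<lambda>q. A q $ k) differentiable at q" if "q \<in> half_plane" for q k
    using A that smooth_on_differentiable[OF open_half_plane] by (simp add: A_system_def)
  \<comment> \<open>An entry that vanishes identically has zero derivatives, so its row in both
    right-hand sides vanishes as well.\<close>
  have zero: "dA1 C' (A q) $ k = 0" "dA2 C' (A q) $ k = 0"
    if "\<And>q. q \<in> half_plane \<Longrightarrow> A q $ k = 0" "q \<in> half_plane" for q k
  proof -
    have "partial i (\<lambda>q. A q $ k) q = 0" for i
      using partial_cong[OF open_half_plane that(2), of "\<lambda>q. A q $ k" "\<lambda>q. 0"] that(1) by simp
    then show "dA1 C' (A q) $ k = 0" "dA2 C' (A q) $ k = 0" using A_system[OF that(2), of k] by simp_all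
  qed
  have K: "A q $ 1 = 0 \<and> A q $ 3 = c * A q $ 2 \<and> A q $ 4 = 0" if q: "q \<in> half_plane" for q
    using nf
  proof (cases rule: nform_cases)
    case 2
    have h1: "h1 \<noteq> 0" using 2 by auto
    have C2: "C' 1 1 1 = -1" "C' 1 1 2 = 0" "C' 1 2 1 = 0" "C' 1 2 2 = -1" "C' 2 2 2 = 0"
      using 2 by (simp_all add: C')
    have curv: "curv C' 1 1 = 0" "curv C' 2 1 = - h1" "curv C' 1 2 = 1" "curv C' 2 2 = 0"
      unfolding curv_def sym C2 C'(5) by simp_all
    have "A q $ 2 + h1 * A q $ 3 = 0" "2 * h1 * A q $ 4 = 0" "A q $ 1 = 0"
      using R[OF q] unfolding curv by (simp_all add: algebra_simps)
    moreover from this(1) have "c * A q $ 2 + (c * h1) * A q $ 3 = 0" by algebra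
    ultimately show ?thesis using h1 2(3) by simp
  next
    case 1
    have curv: "curv C' 1 1 = - 3 / 4 * h2" "curv C' 2 1 = h2\<^sup>2 / 4 - 2 * h1" "curv C' 1 2 = 0" "curv C' 2 2 = - 3 / 4 * h2"
      unfolding curv_def sym C' 1 by (simp_all add: field_simps power2_eq_square)
    show ?thesis
    proof (cases "h2 = 0")
      case True
      with h have h1: "h1 \<noteq> 0" by simp
      have s: "A r $ 3 = 0" "A r $ 4 = 0" if "r \<in> half_plane" for r
        using R[OF that] h1 unfolding curv True by (simp_all add: algebra_simps)
      from zero(1)[OF s(2) q] s[OF q] show ?thesis by (simp add: dA1_def C' 1 True)
    next
      case False
      \<comment> \<open>For nonzero \<open>h2\<close> the curvature matrix has nonzero trace, which
        forces the trace of \<open>A\<close> to vanish; differentiating this identity disposes of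
        the remaining entries.\<close>
      have tr: "A r $ 1 + A r $ 4 = 0" if "r \<in> half_plane" for r
      proof -
        have "(A r $ 1 + A r $ 4) * h2 = 0" using R(1,4)[OF that] unfolding curv by (simp add: algebra_simps)
        with False show ?thesis by simp
      qed
      have "partial i (\<lambda>q. A q $ 1 + A q $ 4) q = 0" for i
        using partial_cong[OF open_half_plane q, of "\<lambda>q. A q $ 1 + A q $ 4" "\<lambda>q. 0"] tr by simp
      then have "partial i (\<lambda>q. A q $ 1) q + partial i (\<lambda>q. A q $ 4) q = 0" for i
        by (simp add: partial_simps d[OF q])
      then have "partial i (\<lambda>q. A q $ 4) q = - partial i (\<lambda>q. A q $ 1) q" for i
        by (simp add: eq_neg_iff_add_eq_0 add.commute)
      with A_system[OF q, of 1] A_system[OF q, of 4] have "dA1 C' (A q) $ 1 + dA1 C' (A q) $ 4 = 0" "dA2 C' (A q) $ 1 + dA2 C' (A q) $ 4 = 0"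
        by (simp_all add: algebra_simps)
      moreover have "A q $ 1 = - A q $ 4" using tr[OF q] by simp
      ultimately have "A q $ 4 * h2 = 0" "A q $ 3 * h2 = 0"
        by (simp_all add: dA1_def dA2_def C' 1 field_simps)
      with False tr[OF q] show ?thesis by (simp add: 1)
    qed
  qed
  from K[OF p] show "A p $ 1 = 0" "A p $ 3 = c * A p $ 2" "A p $ 4 = 0" by blast+
  have e: "dA1 C' (A p) $ 2 = A p $ 2" "dA2 C' (A p) $ 2 = 0"
    using K[OF p] by (simp_all add: dA1_def dA2_def C' field_simps)
  then show "partial 2 (\<lambda>q. A q $ 2) p = 0" using A_system(2)[OF p, of 2] half_plane_pos[OF p] by simp
  with e A_system(1)[OF p, of 2] show "p $ 1 * partial 1 (\<lambda>q. A q $ 2) p = A p $ 2" by simp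
qed

lemma killing_vector_field: "X \<in> killing C \<Longrightarrow> vector_field half_plane X"
  by (simp add: killing_iff)

lemma killing_nform:
  assumes fr: "framed \<beta> 1 C C'" and nf: "nform C' c h1 h2" and h: "h1 \<noteq> 0 \<or> h2 \<noteq> 0"
  shows "killing C = {k *\<^sub>R X_shear \<beta> c + Y |k Y. Y \<in> K0B}"
proof (intro subset_antisym subsetI)
  fix X assume X: "X \<in> killing C"
  note s = A_system_kA[OF X fr]
  note n = nform_A_system[OF nf h s]
  have d: "(\<lambda>q. kA \<beta> 1 X q $ 2) differentiable at p" if "p \<in> half_plane" for p
    using s that smooth_on_differentiable[OF open_half_plane] by (simp add: A_system_def)
  from eq_const_mult_x[of "\<lambda>q. kA \<beta> 1 X q $ 2", OF d n(4,5)]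
  obtain k where k: "\<And>q. q \<in> half_plane \<Longrightarrow> kA \<beta> 1 X q $ 2 = k * q $ 1" by blast
  \<comment> \<open>The factor 1/2 compensates for the entry 2 x in
    \<open>kA_X_shear\<close>.\<close>
  let ?Y = "X + (- k / 2) *\<^sub>R X_shear \<beta> c"
  have "?Y \<in> K0B"
  proof (rule kA_zero_imp_K0B[of _ \<beta> 1])
    show "vector_field half_plane ?Y"
      by (intro vector_field_add vector_field_X_shear killing_vector_field[OF X])
    show "kA \<beta> 1 ?Y p = 0" if "p \<in> half_plane" for p
      using n[OF that] k[OF that] kA_X_shear[OF that, of \<beta> c]
        kA_add[OF killing_vector_field[OF X] vector_field_X_shear that, of \<beta> 1 "- k / 2" \<beta> c]
      by (simp add: vec_eq_iff forall_4)
  qed simp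
  moreover have "X = (k / 2) *\<^sub>R X_shear \<beta> c + ?Y" by (simp add: algebra_simps)
  ultimately show "X \<in> {k *\<^sub>R X_shear \<beta> c + Y |k Y. Y \<in> K0B}" by blast
next
  fix X assume "X \<in> {k *\<^sub>R X_shear \<beta> c + Y |k Y. Y \<in> K0B}"
  then obtain k Y where "X = Y + k *\<^sub>R X_shear \<beta> c" "Y \<in> K0B" by (auto simp: add.commute)
  then show "X \<in> killing C"
    using killing_add[OF subsetD[OF K0B_subset_killing] X_shear_killing[OF fr nf]] by simp
qed

text \<open>The basis e1, e2, e3 goes to \<partial>_2, x \<partial>_1 + y \<partial>_2 and the
  negative of \<open>X_shear \<beta> c\<close>. The sign fits [e1, e3] = -2 e2, since
  [\<partial>_2, X] = 2 (x \<partial>_1 + y \<partial>_2) for the sheared field X.\<close>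

definition su11_field :: "real \<Rightarrow> real \<Rightarrow> real^3 \<Rightarrow> vfield" where
  "su11_field \<beta> c v = hp_field (\<lambda>x y. v $ 2 * x - v $ 3 * (2 * x * y - 2 * \<beta> * x\<^sup>2))
     (\<lambda>x y. v $ 1 + v $ 2 * y - v $ 3 * (y\<^sup>2 + (c - \<beta>\<^sup>2) * x\<^sup>2))"

lemma linear_su11_field: "linear (su11_field \<beta> c)"
  by (rule linearI)
    (auto simp: su11_field_def hp_field_plus hp_field_scaleR algebra_simps intro!: hp_field_cong)

lemma inj_su11_field: "inj (su11_field \<beta> c)"
proof -
  have "v = 0" if "su11_field \<beta> c v = 0" for v
  proof -
    have e: "v $ 2 * x - v $ 3 * (2 * x * y - 2 * \<beta> * x\<^sup>2) = 0"
      "v $ 1 + v $ 2 * y - v $ 3 * (y\<^sup>2 + (c - \<beta>\<^sup>2) * x\<^sup>2) = 0" if "x > 0" for x y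
      using \<open>su11_field \<beta> c v = 0\<close> that unfolding su11_field_def hp_field_zero[symmetric] hp_field_eq_iff by auto
    from e(1)[of 1 0] e(1)[of 1 1] have "v $ 3 = 0" by (simp add: algebra_simps)
    moreover from this e(1)[of 1 0] have "v $ 2 = 0" by simp
    ultimately show ?thesis using e(2)[of 1 0] by (simp add: vec_eq_iff forall_3)
  qed
  then show ?thesis by (simp add: linear_injective_0[OF linear_su11_field])
qed

lemma range_su11_field: "range (su11_field \<beta> c) = {k *\<^sub>R X_shear \<beta> c + Y |k Y. Y \<in> K0B}"
proof (intro subset_antisym subsetI)
  fix X assume "X \<in> range (su11_field \<beta> c)"
  then obtain v where "X = su11_field \<beta> c v" by blast
  then have "X = (- v $ 3) *\<^sub>R X_shear \<beta> c + hp_field (\<lambda>x y. v $ 2 * x) (\<lambda>x y. v $ 2 * y + v $ 1)"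
    by (auto simp: su11_field_def X_shear_def hp_field_plus hp_field_scaleR algebra_simps intro!: hp_field_cong)
  then show "X \<in> {k *\<^sub>R X_shear \<beta> c + Y |k Y. Y \<in> K0B}" unfolding K0B_eq by blast
next
  fix X assume "X \<in> {k *\<^sub>R X_shear \<beta> c + Y |k Y. Y \<in> K0B}"
  then obtain k a b where "X = k *\<^sub>R X_shear \<beta> c + hp_field (\<lambda>x y. a * x) (\<lambda>x y. a * y + b)"
    by (auto simp: K0B_eq)
  then have "X = su11_field \<beta> c (vector [b, a, - k])"
    by (auto simp: su11_field_def X_shear_def hp_field_plus hp_field_scaleR algebra_simps intro!: hp_field_cong)
  then show "X \<in> range (su11_field \<beta> c)" by blast
qed

lemma lie_bracket_hp_field:
  assumes
    "\<And>q i. q \<in> half_plane \<Longrightarrow> partial i (\<lambda>q. u (q $ 1) (q $ 2)) q = du i (q $ 1) (q $ 2)"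
    "\<And>q i. q \<in> half_plane \<Longrightarrow> partial i (\<lambda>q. v (q $ 1) (q $ 2)) q = dv i (q $ 1) (q $ 2)"
    "\<And>q i. q \<in> half_plane \<Longrightarrow> partial i (\<lambda>q. u' (q $ 1) (q $ 2)) q = du' i (q $ 1) (q $ 2)"
    "\<And>q i. q \<in> half_plane \<Longrightarrow> partial i (\<lambda>q. v' (q $ 1) (q $ 2)) q = dv' i (q $ 1) (q $ 2)"
  shows "lie_bracket (hp_field u v) (hp_field u' v') = hp_field
    (\<lambda>x y. u x y * du' 1 x y + v x y * du' 2 x y - (u' x y * du 1 x y + v' x y * du 2 x y))
    (\<lambda>x y. u x y * dv' 1 x y + v x y * dv' 2 x y - (u' x y * dv 1 x y + v' x y * dv 2 x y))"
    (is "?L = ?R")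
proof
  fix p
  have 0: "hp_field u v p = 0" if "p \<notin> half_plane" for u v
    using that by (simp add: hp_field_def restrict_vf_def)
  show "?L p = ?R p"
  proof (cases "p \<in> half_plane")
    case True
    have e: "partial i (\<lambda>q. hp_field w w' q $ 1) p = partial i (\<lambda>q. w (q $ 1) (q $ 2)) p"
      "partial i (\<lambda>q. hp_field w w' q $ 2) p = partial i (\<lambda>q. w' (q $ 1) (q $ 2)) p" for i w w'
      by (rule partial_cong[OF open_half_plane True], simp add: hp_field_nth)+
    show ?thesis
      by (simp add: vec_eq_iff forall_2 lie_bracket_def directional_def sum_2 e assms[OF True]
          hp_field_nth[OF True])
  qed (simp add: 0 lie_bracket_def directional_def vec_eq_iff)
qed

lemma su11_field_bracket: "su11_field \<beta> c (su11_bracket v w) = lie_bracket (su11_field \<beta> c v) (su11_field \<beta> c w)"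
proof -
  have 1: "partial i (\<lambda>q. v $ 2 * q $ 1 - v $ 3 * (2 * q $ 1 * q $ 2 - 2 * \<beta> * (q $ 1)\<^sup>2)) q
     = (if i = 1 then v $ 2 - v $ 3 * (2 * q $ 2 - 4 * \<beta> * q $ 1) else - v $ 3 * (2 * q $ 1))"
    and 2: "partial i (\<lambda>q. v $ 1 + v $ 2 * q $ 2 - v $ 3 * ((q $ 2)\<^sup>2 + (c - \<beta>\<^sup>2) * (q $ 1)\<^sup>2)) q
     = (if i = 1 then - v $ 3 * (2 * (c - \<beta>\<^sup>2) * q $ 1) else v $ 2 - v $ 3 * (2 * q $ 2))"
    for i and q :: point and v :: "real^3"
    using exhaust_2[of i] by (auto simp: power2_eq_square partial_simps algebra_simps)
  have "su11_bracket v w $ 1 = v $ 1 * w $ 2 - v $ 2 * w $ 1"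
    "su11_bracket v w $ 2 = - 2 * (v $ 1 * w $ 3 - v $ 3 * w $ 1)"
    "su11_bracket v w $ 3 = v $ 2 * w $ 3 - v $ 3 * w $ 2"
    by (simp_all add: su11_bracket_def axis_def)
  note b = this
  show ?thesis
    unfolding su11_field_def
    by (subst lie_bracket_hp_field[
          where du = "\<lambda>i x y. if i = 1 then v $ 2 - v $ 3 * (2 * y - 4 * \<beta> * x) else - v $ 3 * (2 * x)"
            and dv = "\<lambda>i x y. if i = 1 then - v $ 3 * (2 * (c - \<beta>\<^sup>2) * x) else v $ 2 - v $ 3 * (2 * y)"
            and du' = "\<lambda>i x y. if i = 1 then w $ 2 - w $ 3 * (2 * y - 4 * \<beta> * x) else - w $ 3 * (2 * x)"
            and dv' = "\<lambda>i x y. if i = 1 then - w $ 3 * (2 * (c - \<beta>\<^sup>2) * x) else w $ 2 - w $ 3 * (2 * y)",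
          OF 1 2 1 2])
      (rule hp_field_cong, simp_all add: b algebra_simps power2_eq_square)
qed

lemma iso_su11_nform:
  assumes "framed \<beta> 1 C C'" "nform C' c h1 h2" "h1 \<noteq> 0 \<or> h2 \<noteq> 0"
  shows "iso_su11 (killing C)" "dim (killing C) = 3"
proof -
  have r: "range (su11_field \<beta> c) = killing C" unfolding range_su11_field killing_nform[OF assms] ..
  then show "iso_su11 (killing C)"
    unfolding iso_su11_def using linear_su11_field inj_su11_field su11_field_bracket by blast
  from dim_range_linear[OF linear_su11_field inj_su11_field, of \<beta> c] show "dim (killing C) = 3"
    unfolding r by simp
qed

lemma direct_sum_nform:
  assumes "framed 0 1 C C'" "nform C' c h1 h2" "h1 \<noteq> 0 \<or> h2 \<noteq> 0"
  shows "is_direct_sum (killing C) (span {X_field c}) K0B"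
proof -
  have "k = 0" if "k *\<^sub>R X_shear 0 c \<in> K0B" for k
  proof -
    from that obtain a b where e: "hp_field (\<lambda>x y. k * (2 * x * y)) (\<lambda>x y. k * (y\<^sup>2 + c * x\<^sup>2)) =
        hp_field (\<lambda>x y. a * x) (\<lambda>x y. a * y + b)"
      by (auto simp: K0B_eq X_shear_def hp_field_scaleR)
    from e[unfolded hp_field_eq_iff, rule_format, of 1 0] e[unfolded hp_field_eq_iff, rule_format, of 1 1]
    show ?thesis by simp
  qed
  moreover have "0 \<in> K0B" by (simp add: K0B_def span_zero)
  ultimately have "span {X_field c} \<inter> K0B = {0}"
    by (auto simp: span_singleton X_field_eq intro: exI[of _ 0])
  then show ?thesis
    unfolding is_direct_sum_def killing_nform[OF assms] by (auto simp: span_singleton X_field_eq)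
qed

lemma dim_K0B: "dim K0B = 2"
proof -
  define F where "F v = hp_field (\<lambda>x y. v $ 1 * x) (\<lambda>x y. v $ 1 * y + v $ 2)" for v :: "real^2"
  have lin: "linear F"
    by (rule linearI) (auto simp: F_def hp_field_plus hp_field_scaleR algebra_simps intro!: hp_field_cong)
  have "v = 0" if "F v = 0" for v
  proof -
    have "v $ 1 * x = 0 \<and> v $ 1 * y + v $ 2 = 0" if "x > 0" for x y
      using \<open>F v = 0\<close> that unfolding F_def hp_field_zero[symmetric] hp_field_eq_iff by auto
    from this[of 1 0] show ?thesis by (simp add: vec_eq_iff forall_2)
  qed
  then have inj: "inj F" by (simp add: linear_injective_0[OF lin])
  have "range F = K0B"
  proof (intro subset_antisym subsetI)
    fix X assume "X \<in> K0B"
    then obtain a b where "X = F (vector [a, b])" by (auto simp: K0B_eq F_def)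
    then show "X \<in> range F" by blast
  qed (auto simp: K0B_eq F_def)
  with dim_range_linear[OF lin inj] show ?thesis by simp
qed

subsection \<open>Killing algebras of dimension 4\<close>

text \<open>\<open>profile d \<kappa> \<psi> \<zeta>\<close>: the \<open>y\<close>-independent solutions of the Killing equation when only
  \<open>C\<^sub>1\<^sub>1\<^sup>1, C\<^sub>1\<^sub>1\<^sup>2 = \<kappa>, C\<^sub>1\<^sub>2\<^sup>2\<close> do not vanish; here \<open>d = C\<^sub>1\<^sub>1\<^sup>1 - 2 C\<^sub>1\<^sub>2\<^sup>2\<close>.\<close>

definition profile :: "real \<Rightarrow> real \<Rightarrow> (real \<Rightarrow> real) \<Rightarrow> (real \<Rightarrow> real) \<Rightarrow> bool" where
  "profile d \<kappa> \<psi> \<zeta> \<longleftrightarrow> smooth_on half_plane (\<lambda>p. \<psi> (p $ 1)) \<and> smooth_on half_plane (\<lambda>p. \<zeta> (p $ 1)) \<and>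
     \<psi> 1 \<noteq> \<psi> 2 \<and> (\<exists>\<psi>1 \<psi>2 \<zeta>1 \<zeta>2. \<forall>x>0.
       (\<psi> has_real_derivative \<psi>1 x) (at x) \<and> (\<psi>1 has_real_derivative \<psi>2 x) (at x) \<and>
       (\<zeta> has_real_derivative \<zeta>1 x) (at x) \<and> (\<zeta>1 has_real_derivative \<zeta>2 x) (at x) \<and>
       x * \<psi>2 x = d * \<psi>1 x \<and> \<psi>1 x \<noteq> 0 \<and> x * \<zeta>2 x = d * \<zeta>1 x + \<kappa>)"

text \<open>The entries of \<open>v\<close> are the coefficients of x \<partial>_1 - \<zeta>
  \<partial>_2, \<psi> \<partial>_2, x \<partial>_1 + y \<partial>_2 and \<partial>_2; the last two
  fields span \<open>K0B\<close>.\<close>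

definition rank1_field :: "(real \<Rightarrow> real) \<Rightarrow> (real \<Rightarrow> real) \<Rightarrow> real^4 \<Rightarrow> vfield" where
  "rank1_field \<psi> \<zeta> v = hp_field (\<lambda>x y. (v $ 1 + v $ 3) * x) (\<lambda>x y. - v $ 1 * \<zeta> x + v $ 2 * \<psi> x + v $ 3 * y + v $ 4)"

lemma curv_rank1:
  assumes "\<And>k. C 2 1 k = C 1 2 k" "C 1 2 1 = 0" "C 2 2 1 = 0" "C 2 2 2 = 0"
  shows "curv C 1 1 = 0" "curv C 2 1 = 0" "curv C 2 2 = 0" "curv C 1 2 = - ((1 + C 1 1 1 - C 1 2 2) * C 1 2 2)"
  by (simp_all add: curv_def assms algebra_simps)

text \<open>Only \<open>curv C 1 2\<close> is nonzero, and the curvature relations make the first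
  row of \<open>A\<close> vanish. Then A_4 is a constant P, and A_3 obeys the profile equation with
  inhomogeneity P \<kappa>, where \<kappa> = \<open>C 1 1 2\<close>. Two integrations recover
  \<open>X\<close>.\<close>

lemma killing_rank1:
  assumes sym: "\<And>k. C 2 1 k = C 1 2 k" and C0: "C 1 2 1 = 0" "C 2 2 1 = 0" "C 2 2 2 = 0"
    and r: "(1 + C 1 1 1 - C 1 2 2) * C 1 2 2 \<noteq> 0"
    and pr: "profile (C 1 1 1 - 2 * C 1 2 2) (C 1 1 2) \<psi> \<zeta>"
  shows "killing C = range (rank1_field \<psi> \<zeta>)"
proof (intro subset_antisym subsetI)
  obtain \<psi>1 \<psi>2 \<zeta>1 \<zeta>2 where *: "\<forall>x>0.
       (\<psi> has_real_derivative \<psi>1 x) (at x) \<and> (\<psi>1 has_real_derivative \<psi>2 x) (at x) \<and>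
       (\<zeta> has_real_derivative \<zeta>1 x) (at x) \<and> (\<zeta>1 has_real_derivative \<zeta>2 x) (at x) \<and>
       x * \<psi>2 x = (C 1 1 1 - 2 * C 1 2 2) * \<psi>1 x \<and> \<psi>1 x \<noteq> 0 \<and>
       x * \<zeta>2 x = (C 1 1 1 - 2 * C 1 2 2) * \<zeta>1 x + C 1 1 2"
    using pr unfolding profile_def by (elim conjE exE) (rule that)
  have D: "(\<psi> has_real_derivative \<psi>1 x) (at x)" "(\<psi>1 has_real_derivative \<psi>2 x) (at x)"
    "(\<zeta> has_real_derivative \<zeta>1 x) (at x)" "(\<zeta>1 has_real_derivative \<zeta>2 x) (at x)"
    and O: "x * \<psi>2 x = (C 1 1 1 - 2 * C 1 2 2) * \<psi>1 x" "\<psi>1 x \<noteq> 0"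
    "x * \<zeta>2 x = (C 1 1 1 - 2 * C 1 2 2) * \<zeta>1 x + C 1 1 2" if "x > 0" for x
    using *[rule_format, OF that] by blast+
  have sm: "smooth_on half_plane (\<lambda>p. \<psi> (p $ 1))" "smooth_on half_plane (\<lambda>p. \<zeta> (p $ 1))"
    using pr by (auto simp: profile_def)
  note ch = partial_chain[where f = "\<lambda>q. q $ 1", OF differentiable_coord]
  have DP: "(\<lambda>q. \<psi> (q $ 1)) differentiable at q" "partial i (\<lambda>q. \<psi> (q $ 1)) q = (if i = 1 then \<psi>1 (q $ 1) else 0)"
    "(\<lambda>q. \<psi>1 (q $ 1)) differentiable at q" "partial i (\<lambda>q. \<psi>1 (q $ 1)) q = (if i = 1 then \<psi>2 (q $ 1) else 0)"
    "(\<lambda>q. \<zeta> (q $ 1)) differentiable at q" "partial i (\<lambda>q. \<zeta> (q $ 1)) q = (if i = 1 then \<zeta>1 (q $ 1) else 0)"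
    "(\<lambda>q. \<zeta>1 (q $ 1)) differentiable at q" "partial i (\<lambda>q. \<zeta>1 (q $ 1)) q = (if i = 1 then \<zeta>2 (q $ 1) else 0)"
    if "q \<in> half_plane" for q i
    using ch[OF D(1)] ch[OF D(2)] ch[OF D(3)] ch[OF D(4)] half_plane_pos[OF that] by auto
  {
    fix X assume X: "X \<in> killing C"
    have fr: "framed 0 1 C C" using sym by (simp add: framed_def)
    define A where "A = kA 0 1 X"
    have A: "A_system 0 1 C A" unfolding A_def by (rule A_system_kA[OF X fr])
    note v = killing_vector_field[OF X]
    have d: "(\<lambda>q. A q $ k) differentiable at p" "(\<lambda>q. X q $ j) differentiable at p"
      if "p \<in> half_plane" for p k j
      using A smooth_on_differentiable[OF open_half_plane _ that] vector_field_comp_smooth[OF v]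
      by (auto simp: A_system_def)
    have tq: "A p $ 1 = 0" "A p $ 2 = 0" if "p \<in> half_plane" for p
      using A_system_curvature(1,3)[OF A that _ sym] r
      unfolding curv_rank1(1-3)[OF sym C0] neg_equal_0_iff_equal[symmetric, of "_ * C 1 2 2"] curv_rank1(4)[OF sym C0, symmetric]
      by (auto simp: algebra_simps)
    have E: "p $ 1 * partial 1 (\<lambda>q. A q $ k) p = dA1 C (A p) $ k" "p $ 1 * partial 2 (\<lambda>q. A q $ k) p = dA2 C (A p) $ k"
      if "p \<in> half_plane" for p k
      using A that by (auto simp: A_system_def)
    have p0: "partial i (\<lambda>q. A q $ 4) p = 0" if "p \<in> half_plane" for p i
      using E[OF that, of 4] half_plane_pos[OF that] exhaust_2[of i]
      by (auto simp: dA1_def dA2_def C0 tq[OF that])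
    obtain P where P: "\<And>q. q \<in> half_plane \<Longrightarrow> A q $ 4 = P"
      using constant_on_open[OF open_half_plane connected_half_plane d(1) p0] by blast
    have s1: "p $ 1 * partial 1 (\<lambda>q. A q $ 3) p = (C 1 1 1 - 2 * C 1 2 2) * A p $ 3 + P * C 1 1 2"
      "partial 2 (\<lambda>q. A q $ 3) p = 0" if "p \<in> half_plane" for p
      using E[OF that, of 3] half_plane_pos[OF that]
      by (auto simp: dA1_def dA2_def C0 tq[OF that] P[OF that] algebra_simps)
    \<comment> \<open>Variation of constants: A_3 and P \<zeta>1 solve the same inhomogeneous
      equation, so their difference is a multiple of the homogeneous solution \<psi>1.\<close>
    have m1: "(\<lambda>q. (A q $ 3 - P * \<zeta>1 (q $ 1)) / \<psi>1 (q $ 1)) differentiable at p"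
      "partial i (\<lambda>q. (A q $ 3 - P * \<zeta>1 (q $ 1)) / \<psi>1 (q $ 1)) p = 0" if p: "p \<in> half_plane" for p i
    proof -
      note x = half_plane_pos[OF p]
      show "(\<lambda>q. (A q $ 3 - P * \<zeta>1 (q $ 1)) / \<psi>1 (q $ 1)) differentiable at p"
        using d(1)[OF p] DP[OF p] O(2)[OF x] by (simp add: partial_simps)
      have "p $ 1 * ((partial 1 (\<lambda>q. A q $ 3) p - P * \<zeta>2 (p $ 1)) * \<psi>1 (p $ 1)
          - (A p $ 3 - P * \<zeta>1 (p $ 1)) * \<psi>2 (p $ 1)) =
          (p $ 1 * partial 1 (\<lambda>q. A q $ 3) p - P * (p $ 1 * \<zeta>2 (p $ 1))) * \<psi>1 (p $ 1)
          - (A p $ 3 - P * \<zeta>1 (p $ 1)) * (p $ 1 * \<psi>2 (p $ 1))"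
        by (simp add: algebra_simps)
      also have "\<dots> = 0" unfolding s1(1)[OF p] O(1)[OF x] O(3)[OF x] by (simp add: algebra_simps)
      finally have z: "(partial 1 (\<lambda>q. A q $ 3) p - P * \<zeta>2 (p $ 1)) * \<psi>1 (p $ 1)
          - (A p $ 3 - P * \<zeta>1 (p $ 1)) * \<psi>2 (p $ 1) = 0" using x by simp
      show "partial i (\<lambda>q. (A q $ 3 - P * \<zeta>1 (q $ 1)) / \<psi>1 (q $ 1)) p = 0"
        using d(1)[OF p] DP[OF p] O(2)[OF x] z s1(2)[OF p] exhaust_2[of i] by (auto simp: partial_simps)
    qed
    obtain m where "\<And>q. q \<in> half_plane \<Longrightarrow> (A q $ 3 - P * \<zeta>1 (q $ 1)) / \<psi>1 (q $ 1) = m"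
      using constant_on_open[OF open_half_plane connected_half_plane m1] by blast
    then have s: "A q $ 3 = P * \<zeta>1 (q $ 1) + m * \<psi>1 (q $ 1)" if "q \<in> half_plane" for q
      using that O(2)[OF half_plane_pos[OF that]] by (force simp: field_simps)
    have e: "partial 1 (\<lambda>q. X q $ 1) p = X p $ 1 / p $ 1" "partial 2 (\<lambda>q. X q $ 1) p = 0"
      "partial 1 (\<lambda>q. X q $ 2) p = A p $ 3" "partial 2 (\<lambda>q. X q $ 2) p = P + X p $ 1 / p $ 1" if "p \<in> half_plane" for p
      using tq[OF that] P[OF that] by (auto simp: A_def kA_def algebra_simps)
    obtain k where k: "\<And>q. q \<in> half_plane \<Longrightarrow> X q $ 1 = k * q $ 1"
      by (rule eq_const_mult_x[of "\<lambda>q. X q $ 1"]) (use d e half_plane_pos in force)+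
    have "(\<lambda>q. X q $ 2 - ((P + k) * q $ 2 + P * \<zeta> (q $ 1) + m * \<psi> (q $ 1))) differentiable at p"
      "partial i (\<lambda>q. X q $ 2 - ((P + k) * q $ 2 + P * \<zeta> (q $ 1) + m * \<psi> (q $ 1))) p = 0"
      if "p \<in> half_plane" for p i
      using d(2)[OF that] DP[OF that] e[OF that] k[OF that] s[OF that] half_plane_pos[OF that] exhaust_2[of i]
      by (auto simp: partial_simps)
    from constant_on_open[OF open_half_plane connected_half_plane this]
    obtain c where c: "\<And>q. q \<in> half_plane \<Longrightarrow> X q $ 2 - ((P + k) * q $ 2 + P * \<zeta> (q $ 1) + m * \<psi> (q $ 1)) = c"
      by blast
    \<comment> \<open>P + k is the coefficient of y; as the first component requires v_1 + v_3 = k,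
      the first entry must be - P.\<close>
    have "X = rank1_field \<psi> \<zeta> (vector [- P, m, P + k, c])"
      unfolding rank1_field_def
    proof (rule vector_field_eq_hp_field[OF v])
      fix p assume p: "p \<in> half_plane"
      let ?w = "vector [- P, m, P + k, c] :: real^4"
      show "X p $ 1 = (?w $ 1 + ?w $ 3) * p $ 1"
        unfolding vector_4 using k[OF p] by simp
      show "X p $ 2 = - ?w $ 1 * \<zeta> (p $ 1) + ?w $ 2 * \<psi> (p $ 1) + ?w $ 3 * p $ 2 + ?w $ 4"
        unfolding vector_4 using c[OF p] by simp
    qed
    then show "X \<in> range (rank1_field \<psi> \<zeta>)" by blast
  }
  {
    fix X assume "X \<in> range (rank1_field \<psi> \<zeta>)"
    then obtain w where X: "X = rank1_field \<psi> \<zeta> w" by blast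
    have "vector_field half_plane X"
      unfolding X rank1_field_def by (intro vector_field_hp_field smooth_intros open_half_plane sm)
    moreover have "kill_coeff C X i j k p = 0" if p: "p \<in> half_plane" for p i j k
    proof -
      note x = half_plane_pos[OF p]
      have 1: "partial i (\<lambda>q. (w $ 1 + w $ 3) * q $ 1) q = (if i = 1 then w $ 1 + w $ 3 else 0)"
        "partial i (\<lambda>q. - w $ 1 * \<zeta> (q $ 1) + w $ 2 * \<psi> (q $ 1) + w $ 3 * q $ 2 + w $ 4) q
          = (if i = 1 then - w $ 1 * \<zeta>1 (q $ 1) + w $ 2 * \<psi>1 (q $ 1) else w $ 3)"
        if "q \<in> half_plane" for q i
        using DP[OF that] exhaust_2[of i] by (auto simp: partial_simps)
      note kk = kill_coeff_hp_field[OF p, where u = "\<lambda>x y. (w $ 1 + w $ 3) * x" and C = C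
          and v = "\<lambda>x y. - w $ 1 * \<zeta> x + w $ 2 * \<psi> x + w $ 3 * y + w $ 4", OF 1]
      have s: "C 2 1 1 = 0" "C 2 1 2 = C 1 2 2" by (simp_all add: sym C0)
      have O': "\<psi>2 (p $ 1) = (C 1 1 1 - 2 * C 1 2 2) * \<psi>1 (p $ 1) / p $ 1"
        "\<zeta>2 (p $ 1) = ((C 1 1 1 - 2 * C 1 2 2) * \<zeta>1 (p $ 1) + C 1 1 2) / p $ 1"
        using O(1,3)[OF x] x by (simp_all add: nonzero_eq_divide_eq mult.commute)
      show ?thesis
        using exhaust_2[of i] exhaust_2[of j] exhaust_2[of k] unfolding X rank1_field_def
        by (elim disjE) (simp_all only: kk, simp_all add: C0 s partial_simps DP[OF p] O', use x in \<open>simp_all add: field_simps power2_eq_square\<close>)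
    qed
    ultimately show "X \<in> killing C" by (simp add: killing_iff)
  }
qed

lemma linear_rank1_field: "linear (rank1_field \<psi> \<zeta>)"
  by (rule linearI)
    (auto simp: rank1_field_def hp_field_plus hp_field_scaleR algebra_simps intro!: hp_field_cong)

text \<open>The values of \<psi> at 1 and 2 suffice to keep \<psi> \<partial>_2 apart from
  \<partial>_2.\<close>

lemma rank1_field_eq_0:
  assumes \<psi>: "\<psi> 1 \<noteq> \<psi> 2" and "rank1_field \<psi> \<zeta> v = 0"
  shows "v = 0"
proof -
  have e: "(v $ 1 + v $ 3) * x = 0" "- v $ 1 * \<zeta> x + v $ 2 * \<psi> x + v $ 3 * y + v $ 4 = 0" if "x > 0" for x y
    using assms(2) that unfolding rank1_field_def hp_field_zero[symmetric] hp_field_eq_iff by auto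
  from e(2)[of 1 0] e(2)[of 1 1] have 3: "v $ 3 = 0" by simp
  with e(1)[of 1] have 1: "v $ 1 = 0" by simp
  from e(2)[of 1 0] e(2)[of 2 0] have e2: "v $ 2 * \<psi> 1 = - v $ 4" "v $ 2 * \<psi> 2 = - v $ 4" by (simp_all add: 1 3)
  then have "v $ 2 * (\<psi> 1 - \<psi> 2) = 0" by (simp add: algebra_simps)
  with \<psi> have 2: "v $ 2 = 0" by simp
  with e2 1 3 show ?thesis by (simp add: vec_eq_iff forall_4)
qed

lemma rank1_field_direct_sum:
  assumes \<psi>: "\<psi> 1 \<noteq> \<psi> 2"
  shows "is_direct_sum (range (rank1_field \<psi> \<zeta>)) (span {hp_field (\<lambda>x y. x) (\<lambda>x y. - \<zeta> x), hp_field (\<lambda>x y. 0) (\<lambda>x y. \<psi> x)}) K0B"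
proof -
  have S: "a *\<^sub>R hp_field (\<lambda>x y. x) (\<lambda>x y. - \<zeta> x) + b *\<^sub>R hp_field (\<lambda>x y. 0) (\<lambda>x y. \<psi> x)
     = rank1_field \<psi> \<zeta> (vector [a, b, 0, 0])" for a b
    by (simp add: rank1_field_def hp_field_plus hp_field_scaleR)
  have K: "hp_field (\<lambda>x y. a * x) (\<lambda>x y. a * y + b) = rank1_field \<psi> \<zeta> (vector [0, 0, a, b])" for a b
    by (simp add: rank1_field_def)
  note add = linear_add[OF linear_rank1_field, symmetric]
  let ?S = "{rank1_field \<psi> \<zeta> (vector [a, b, 0, 0]) |a b. True}"
  let ?T = "{rank1_field \<psi> \<zeta> (vector [0, 0, a, b]) |a b. True}"
  have "z = 0" if z: "z = rank1_field \<psi> \<zeta> (vector [a, b, 0, 0])" "z = rank1_field \<psi> \<zeta> (vector [0, 0, a', b'])" for z a b a' b'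
  proof -
    have "rank1_field \<psi> \<zeta> (vector [a, b, 0, 0] - vector [0, 0, a', b']) = 0"
      using z by (simp add: linear_diff[OF linear_rank1_field])
    from rank1_field_eq_0[OF \<psi> this] have "a = 0" "b = 0" by (simp_all add: vec_eq_iff forall_4)
    with z(1) show ?thesis by (simp add: rank1_field_def hp_field_zero)
  qed
  moreover have "rank1_field \<psi> \<zeta> (vector [0, 0, 0, 0]) = 0" by (simp add: rank1_field_def hp_field_zero)
  then have "0 \<in> ?S \<inter> ?T" by (auto intro!: exI[of _ 0])
  ultimately have 1: "?S \<inter> ?T = {0}" by blast
  have "rank1_field \<psi> \<zeta> v = rank1_field \<psi> \<zeta> (vector [v $ 1, v $ 2, 0, 0]) + rank1_field \<psi> \<zeta> (vector [0, 0, v $ 3, v $ 4])" for v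
  proof -
    have "vector [v $ 1, v $ 2, 0, 0] + vector [0, 0, v $ 3, v $ 4] = v" by (simp add: vec_eq_iff forall_4)
    then show ?thesis by (simp only: add)
  qed
  then have "range (rank1_field \<psi> \<zeta>) \<subseteq> {a + b |a b. a \<in> ?S \<and> b \<in> ?T}" by blast
  moreover have "{a + b |a b. a \<in> ?S \<and> b \<in> ?T} \<subseteq> range (rank1_field \<psi> \<zeta>)" by (auto simp: add)
  ultimately show ?thesis
    unfolding is_direct_sum_def span_pair S K0B_eq K using 1 by blast
qed

section \<open>Explicit profiles\<close>

lemma profileI:
  assumes "smooth_on half_plane (\<lambda>p. \<psi> (p $ 1))" "smooth_on half_plane (\<lambda>p. \<zeta> (p $ 1))" "\<psi> 1 \<noteq> \<psi> 2"
    and "\<And>x. x > 0 \<Longrightarrow> (\<psi> has_real_derivative \<psi>' x) (at x)"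
    "\<And>x. x > 0 \<Longrightarrow> (\<psi>' has_real_derivative \<psi>'' x) (at x)"
    "\<And>x. x > 0 \<Longrightarrow> (\<zeta> has_real_derivative \<zeta>' x) (at x)"
    "\<And>x. x > 0 \<Longrightarrow> (\<zeta>' has_real_derivative \<zeta>'' x) (at x)"
    "\<And>x. x > 0 \<Longrightarrow> x * \<psi>'' x = d * \<psi>' x" "\<And>x. x > 0 \<Longrightarrow> \<psi>' x \<noteq> 0"
    "\<And>x. x > 0 \<Longrightarrow> x * \<zeta>'' x = d * \<zeta>' x + \<kappa>"
  shows "profile d \<kappa> \<psi> \<zeta>"
  unfolding profile_def
  by (intro conjI exI[of _ \<psi>'] exI[of _ \<psi>''] exI[of _ \<zeta>'] exI[of _ \<zeta>''] allI impI assms)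

text \<open>\<psi>' is a multiple of x^d, which integrates to a power except for d = -1, where
  \<open>ln\<close> appears. A linear \<zeta> exists unless d = 0 and \<kappa> \<noteq> 0, the
  resonant case that leads to x ln x.\<close>

lemma profile_powr:
  assumes "d \<noteq> -1" "\<kappa> = - d * e"
  shows "profile d \<kappa> (\<lambda>x. x powr (d + 1)) (\<lambda>x. e * x)"
proof (rule profileI[where \<psi>' = "\<lambda>x. (d + 1) * x powr d" and \<psi>'' = "\<lambda>x. (d + 1) * (d * x powr (d - 1))"
      and \<zeta>' = "\<lambda>x. e" and \<zeta>'' = "\<lambda>x. 0"])
  show "1 powr (d + 1) \<noteq> (2::real) powr (d + 1)"
    using assms(1) powr_eq_one_iff_gen[of "2::real" "d + 1"] by auto
  show "smooth_on half_plane (\<lambda>p. p $ 1 powr (d + 1))" "smooth_on half_plane (\<lambda>p. e * p $ 1)"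
    by (intro smooth_intros open_half_plane half_plane_pos, assumption?)+
next
  fix x :: real assume x: "0 < x"
  show "x * ((d + 1) * (d * x powr (d - 1))) = d * ((d + 1) * x powr d)"
    using x by (simp add: powr_diff field_simps)
  show "((\<lambda>x. x powr (d + 1)) has_real_derivative (d + 1) * x powr d) (at x)"
    using x by (auto intro!: derivative_eq_intros)
  show "((\<lambda>x. (d + 1) * x powr d) has_real_derivative (d + 1) * (d * x powr (d - 1))) (at x)"
    using x by (auto intro!: derivative_eq_intros)
  show "(d + 1) * x powr d \<noteq> 0" using x assms(1) by (simp add: add_eq_0_iff2)
  show "((\<lambda>x. e * x) has_real_derivative e) (at x)" by (auto intro!: derivative_eq_intros)
qed (use assms in auto)

lemma profile_ln: "profile (-1) \<kappa> ln (\<lambda>x. \<kappa> * x)"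
proof (rule profileI[where \<psi>' = "\<lambda>x. 1 / x" and \<psi>'' = "\<lambda>x. - 1 / x\<^sup>2"
      and \<zeta>' = "\<lambda>x. \<kappa>" and \<zeta>'' = "\<lambda>x. 0"])
  show "smooth_on half_plane (\<lambda>p. ln (p $ 1))" "smooth_on half_plane (\<lambda>p. \<kappa> * p $ 1)"
    by (intro smooth_intros open_half_plane half_plane_pos, assumption?)+
qed (auto intro!: derivative_eq_intros simp: power2_eq_square)

lemma profile_x: "profile 0 \<kappa> (\<lambda>x. x) (\<lambda>x. \<kappa> * (x * ln x))"
proof (rule profileI[where \<psi>' = "\<lambda>x. 1" and \<psi>'' = "\<lambda>x. 0"
      and \<zeta>' = "\<lambda>x. \<kappa> * (ln x + 1)" and \<zeta>'' = "\<lambda>x. \<kappa> * (1 / x)"])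
  show "smooth_on half_plane (\<lambda>p. p $ 1)" "smooth_on half_plane (\<lambda>p. \<kappa> * (p $ 1 * ln (p $ 1)))"
    by (intro smooth_intros open_half_plane half_plane_pos, assumption?)+
qed (auto intro!: derivative_eq_intros simp: field_simps)

lemma dim_killing_rank1:
  assumes sym: "\<And>k. C 2 1 k = C 1 2 k" and C0: "C 1 2 1 = 0" "C 2 2 1 = 0" "C 2 2 2 = 0"
    and r: "(1 + C 1 1 1 - C 1 2 2) * C 1 2 2 \<noteq> 0"
  shows "dim (killing C) = 4"
proof -
  have "\<exists>\<psi> \<zeta>. profile d \<kappa> \<psi> \<zeta>" for d \<kappa>
  proof (cases "d = 0")
    case True then show ?thesis using profile_x by blast
  next
    case False
    then show ?thesis
      using profile_ln[of \<kappa>] profile_powr[of d \<kappa> "- \<kappa> / d"] by (cases "d = -1") auto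
  qed
  then obtain \<psi> \<zeta> where pr: "profile (C 1 1 1 - 2 * C 1 2 2) (C 1 1 2) \<psi> \<zeta>" by blast
  then have "\<psi> 1 \<noteq> \<psi> 2" by (simp add: profile_def)
  then have "inj (rank1_field \<psi> \<zeta>)"
    using rank1_field_eq_0 by (auto simp: linear_injective_0[OF linear_rank1_field])
  from dim_range_linear[OF linear_rank1_field this] show ?thesis
    by (simp add: killing_rank1[OF sym C0 r pr])
qed

section \<open>Ricci tensor, linear equivalence and normal forms in dimension 4\<close>

lemma ricci_11_iff:
  "ricci_11 C r \<longleftrightarrow> curv C 1 1 = 0 \<and> curv C 2 1 = 0 \<and> curv C 2 2 = 0 \<and> r = - curv C 1 2"
proof
  assume R: "ricci_11 C r"
  let ?p = "vector [1, 0] :: point"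
  let ?V = "\<lambda>v. restrict_vf half_plane (\<lambda>_. v)"
  note v = vector_field_restrict_const[OF open_half_plane]
  have "r / (?p $ 1)\<^sup>2 * ?V y ?p $ 1 * ?V z ?p $ 1 = (?V y ?p $ 2 * (?V z ?p $ 1 * curv C 1 1 + ?V z ?p $ 2 * curv C 2 1)
      - ?V y ?p $ 1 * (?V z ?p $ 1 * curv C 1 2 + ?V z ?p $ 2 * curv C 2 2)) / (?p $ 1)\<^sup>2" for y z
    using R v point_in_half_plane
      ricci_conn[OF open_half_plane order_refl point_in_half_plane vector_field_smooth[OF v]
        vector_field_smooth[OF v], of C y z]
    unfolding ricci_11_def by metis
  then have e: "r * y $ 1 * z $ 1 = y $ 2 * (z $ 1 * curv C 1 1 + z $ 2 * curv C 2 1)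
      - y $ 1 * (z $ 1 * curv C 1 2 + z $ 2 * curv C 2 2)" for y z :: "real^2"
    by (simp add: restrict_vf_def point_in_half_plane)
  from e[of "axis 1 1" "axis 1 1"] e[of "axis 1 1" "axis 2 1"] e[of "axis 2 1" "axis 1 1"] e[of "axis 2 1" "axis 2 1"]
  show "curv C 1 1 = 0 \<and> curv C 2 1 = 0 \<and> curv C 2 2 = 0 \<and> r = - curv C 1 2" by simp
next
  assume "curv C 1 1 = 0 \<and> curv C 2 1 = 0 \<and> curv C 2 2 = 0 \<and> r = - curv C 1 2"
  then show "ricci_11 C r"
    unfolding ricci_11_def
    using ricci_conn[OF open_half_plane order_refl _ vector_field_smooth vector_field_smooth] by simp
qed

lemma ricci_rank_one_form_iff:
  assumes "\<And>k. C 2 1 k = C 1 2 k"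
  shows "ricci_rank_one_form C r \<longleftrightarrow>
    C 1 2 1 = 0 \<and> C 2 2 1 = 0 \<and> C 2 2 2 = 0 \<and> r = (1 + C 1 1 1 - C 1 2 2) * C 1 2 2"
  unfolding ricci_rank_one_form_def ricci_11_iff using curv_rank1[where C = C, OF assms] by auto

lemma struct_dim:
  assumes "\<And>k. D 2 1 k = D 1 2 k" "struct_1a D \<or> struct_1b D \<or> struct_1c D"
  shows "dim (killing D) = 4"
  using assms(2) unfolding struct_1a_def struct_1b_def struct_1c_def ricci_rank_one_form_iff[OF assms(1)]
  by (auto intro!: dim_killing_rank1[OF assms(1)])

text \<open>The map is linear, so the Hessian term vanishes and the constants transform like a
  tensor; it keeps x, so the common factor 1 / x cancels.\<close>

lemma lin_equivI:
  assumes fr: "framed b c C C'" and C: "\<And>i j k. C i j k = C j i k" "\<And>i j k. C' i j k = C' j i k"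
    and nf: "\<not> flat half_plane (conn C)" "\<exists>l k. curv C' l k \<noteq> 0"
  shows "lin_equiv C' C"
proof -
  have "is_pullback half_plane (\<lambda>p. vector [p $ 1, b * p $ 1 + c * p $ 2]) (conn C) (conn C')"
    unfolding is_pullback_def
  proof (intro ballI allI)
    fix p :: point and i j l :: 2 assume p: "p \<in> half_plane"
    have d: "partial i (\<lambda>q. b * q $ 1 + c * q $ 2) = (\<lambda>q. if i = 1 then b else c)"
      "partial i (\<lambda>q. q $ 1) = (\<lambda>q. if i = 1 then 1 else 0)" for i
      using exhaust_2[of i] by (auto simp: partial_simps fun_eq_iff)
    have f: "C' 1 1 1 = C 1 1 1 + 2 * b * C 1 2 1 + b\<^sup>2 * C 2 2 1"
     "b * C' 1 1 1 + c * C' 1 1 2 = C 1 1 2 + 2 * b * C 1 2 2 + b\<^sup>2 * C 2 2 2"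
     "C' 1 2 1 = c * (C 1 2 1 + b * C 2 2 1)"
     "b * C' 1 2 1 + c * C' 1 2 2 = c * (C 1 2 2 + b * C 2 2 2)"
     "C' 2 2 1 = c\<^sup>2 * C 2 2 1" "b * C' 2 2 1 + c * C' 2 2 2 = c\<^sup>2 * C 2 2 2"
      "C 2 1 k = C 1 2 k" "C' 2 1 k = C' 1 2 k" for k
      using fr C unfolding framed_def by blast+
    let ?T = "\<lambda>q::point. vector [q $ 1, b * q $ 1 + c * q $ 2] :: point"
    have "(\<Sum>k\<in>UNIV. C' i j k * partial k (\<lambda>q. ?T q $ l) p) =
        (\<Sum>a\<in>UNIV. \<Sum>e\<in>UNIV. C a e l * partial i (\<lambda>q. ?T q $ a) p * partial j (\<lambda>q. ?T q $ e) p)"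
      using exhaust_2[of i] exhaust_2[of j] exhaust_2[of l]
      by (elim disjE) (simp_all add: sum_2 d f(7,8), (insert f(1-6), simp add: algebra_simps power2_eq_square)+)
    moreover have "partial i (partial j (\<lambda>q. ?T q $ l)) p = 0"
      using exhaust_2[of i] exhaust_2[of j] exhaust_2[of l] by (elim disjE) (simp_all add: d)
    ultimately show "(\<Sum>k\<in>UNIV. conn C' p i j k * partial k (\<lambda>q. ?T q $ l) p) =
       partial i (partial j (\<lambda>q. ?T q $ l)) p + (\<Sum>a\<in>UNIV. \<Sum>e\<in>UNIV. conn C (?T p) a e l *
        partial i (\<lambda>q. ?T q $ a) p * partial j (\<lambda>q. ?T q $ e) p)"
      by (simp add: conn_def sum_2 add_divide_distrib[symmetric])
  qed
  moreover have "c \<noteq> 0" using fr by (simp add: framed_def)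
  ultimately show ?thesis
    using C nf unfolding lin_equiv_def structure_B_def flat_conn_iff by blast
qed

lemma consts6_sym: "consts6 a b c d e f i j k = consts6 a b c d e f j i k"
  by (auto simp: consts6_def)

text \<open>Shear and rescaling affect only \<open>C 1 1 2\<close>, which becomes (\<kappa> - b
  (\<alpha> - 2 \<mu>)) / c. It can be made 0 unless \<alpha> = 2 \<mu> and \<kappa> \<noteq> 0; in
  that case it can be made 1.\<close>

lemma rank1_normal_form:
  assumes C: "\<And>i j k. C i j k = C j i k" and C0: "C 1 2 1 = 0" "C 2 2 1 = 0" "C 2 2 2 = 0"
    and nf: "\<not> flat half_plane (conn C)"
  shows "\<exists>C'. lin_equiv C' C \<and>
        (struct_1a C' \<and>
           is_direct_sum (killing C')
             (span {hp_field (\<lambda>x y. x) (\<lambda>x y. - x * ln x), hp_field (\<lambda>x y. 0) (\<lambda>x y. x)}) K0B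
         \<or> struct_1b C' \<and>
           (\<exists>a. a \<noteq> 0 \<and> is_direct_sum (killing C')
             (span {hp_field (\<lambda>x y. x) (\<lambda>x y. 0), hp_field (\<lambda>x y. 0) (\<lambda>x y. x powr a)}) K0B)
         \<or> struct_1c C' \<and>
           is_direct_sum (killing C')
             (span {hp_field (\<lambda>x y. x) (\<lambda>x y. 0), hp_field (\<lambda>x y. 0) (\<lambda>x y. ln x)}) K0B)"
proof -
  define \<alpha> \<mu> \<kappa> where "\<alpha> = C 1 1 1" and "\<mu> = C 1 2 2" and "\<kappa> = C 1 1 2"
  note defs = \<alpha>_def[symmetric] \<mu>_def[symmetric] \<kappa>_def[symmetric]
  define N where "N k = consts6 \<alpha> k 0 \<mu> 0 0" for k
  have sym: "C 2 1 k = C 1 2 k" for k by (rule C)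
  have r: "(1 + \<alpha> - \<mu>) * \<mu> \<noteq> 0"
    using nf curv_rank1[OF sym C0] unfolding flat_conn_iff forall_2 defs by auto
  have symN: "N k 2 1 i = N k 1 2 i" for k i unfolding N_def by (rule consts6_sym)
  have N0: "N k 1 2 1 = 0" "N k 2 2 1 = 0" "N k 2 2 2 = 0" "N k 1 1 1 = \<alpha>" "N k 1 1 2 = k" "N k 1 2 2 = \<mu>" for k
    by (simp_all add: N_def)
  have RN: "\<exists>l i. curv (N k) l i \<noteq> 0" for k
    using curv_rank1(4)[of "N k", OF symN N0(1-3)] r by (metis N0(4,6) neg_equal_0_iff_equal)
  have fr: "framed b c C (N k)" if "c \<noteq> 0" "c * k = \<kappa> - b * (\<alpha> - 2 * \<mu>)" for b c k
    using that unfolding framed_def N0 symN sym C0 defs by (simp add: algebra_simps)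
  have le: "lin_equiv (N k) C" if "c \<noteq> 0" "c * k = \<kappa> - b * (\<alpha> - 2 * \<mu>)" for b c k
    by (rule lin_equivI[OF fr[OF that] C _ nf RN]) (simp add: N_def consts6_sym)
  have ds: "is_direct_sum (killing (N k))
      (span {hp_field (\<lambda>x y. x) (\<lambda>x y. - \<zeta> x), hp_field (\<lambda>x y. 0) (\<lambda>x y. \<psi> x)}) K0B"
    if "profile (\<alpha> - 2 * \<mu>) k \<psi> \<zeta>" for k \<psi> \<zeta>
    using killing_rank1[of "N k", OF symN N0(1-3), unfolded N0, OF r that] rank1_field_direct_sum that
    by (simp add: profile_def)
  show ?thesis
  proof (cases "\<alpha> - 2 * \<mu> = 0 \<and> \<kappa> \<noteq> 0")
    case True
    then have "lin_equiv (N 1) C" by (intro le[of \<kappa> 1 0]) auto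
    moreover have "struct_1a (N 1)"
      unfolding struct_1a_def ricci_rank_one_form_iff[OF symN] N0 using True r by auto
    moreover have "is_direct_sum (killing (N 1))
             (span {hp_field (\<lambda>x y. x) (\<lambda>x y. - x * ln x), hp_field (\<lambda>x y. 0) (\<lambda>x y. x)}) K0B"
      using ds[of 1 "\<lambda>x. x" "\<lambda>x. 1 * (x * ln x)"] profile_x[of 1] True by simp
    ultimately show ?thesis by blast
  next
    case False
    \<comment> \<open>If \<alpha> = 2 \<mu>, then \<kappa> = 0 here, and the quotient by zero gives
      the shear 0, which is the right one.\<close>
    then have le0: "lin_equiv (N 0) C" by (intro le[of 1 0 "\<kappa> / (\<alpha> - 2 * \<mu>)"]) auto
    show ?thesis
    proof (cases "\<alpha> - 2 * \<mu> = -1")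
      case True
      \<comment> \<open>With this value the Ricci constant (1 + \<alpha> - \<mu>) \<mu> becomes
        \<mu>^2.\<close>
      have "\<alpha> = 2 * \<mu> - 1" using True by simp
      then have "struct_1c (N 0)"
        unfolding struct_1c_def ricci_rank_one_form_iff[OF symN] N0 using r by (auto simp: power2_eq_square)
      moreover have "is_direct_sum (killing (N 0))
             (span {hp_field (\<lambda>x y. x) (\<lambda>x y. 0), hp_field (\<lambda>x y. 0) (\<lambda>x y. ln x)}) K0B"
        using ds[of 0 ln "\<lambda>x. 0 * x"] profile_ln[of 0] True by simp
      ultimately show ?thesis using le0 by blast
    next
      case False
      have "struct_1b (N 0)"
        unfolding struct_1b_def ricci_rank_one_form_iff[OF symN] N0 using r by auto
      moreover have "is_direct_sum (killing (N 0))
             (span {hp_field (\<lambda>x y. x) (\<lambda>x y. 0), hp_field (\<lambda>x y. 0) (\<lambda>x y. x powr (\<alpha> - 2 * \<mu> + 1))}) K0B"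
        using ds[of 0 "\<lambda>x. x powr (\<alpha> - 2 * \<mu> + 1)" "\<lambda>x. 0 * x"] profile_powr[OF False, of 0 0] by simp
      moreover have "\<alpha> - 2 * \<mu> + 1 \<noteq> 0" using False by (simp add: add_eq_0_iff2)
      ultimately show ?thesis using le0 by blast
    qed
  qed
qed

subsection \<open>Connections of Type A\<close>

lemma diffeoI:
  assumes "open V" "open W" "\<And>q. q \<in> V \<Longrightarrow> f q \<in> W \<and> g (f q) = q" "\<And>q. q \<in> W \<Longrightarrow> g q \<in> V \<and> f (g q) = q"
    "\<And>k. smooth_on V (\<lambda>q. f q $ k)" "\<And>k. smooth_on W (\<lambda>q. g q $ k)"
  shows "diffeo V f W"
proof -
  have b: "bij_betw f V W" by (rule bij_betw_byWitness[of _ g]) (use assms(3,4) in auto)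
  have "inv_into V f q = g q" if "q \<in> W" for q
    using inv_into_f_eq[of f V "g q" q] b assms(4)[OF that] by (simp add: bij_betw_def)
  then have "smooth_on W (\<lambda>q. inv_into V f q $ k)" for k
    using smooth_on_cong[OF assms(2), of "\<lambda>q. inv_into V f q $ k" "\<lambda>q. g q $ k"] assms(6) by simp
  with assms b show ?thesis by (simp add: diffeo_def smooth_map_on_def)
qed

text \<open>The maps (x, y) \<mapsto> (l x, l y + m) with l > 0 act transitively and preserve C /
  x.\<close>

lemma locally_homogeneous_conn: "locally_homogeneous half_plane (conn C)"
  unfolding locally_homogeneous_def
proof (intro ballI)
  fix p q :: point assume pq: "p \<in> half_plane" "q \<in> half_plane"
  define l m where "l = q $ 1 / p $ 1" and "m = q $ 2 - l * p $ 2"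
  have l: "l > 0" using pq by (simp add: l_def half_plane_def)
  define \<phi> :: "point \<Rightarrow> point" where "\<phi> r = vector [l * r $ 1, l * r $ 2 + m]" for r
  have "diffeo half_plane \<phi> half_plane"
  proof (rule diffeoI[of _ _ _ "\<lambda>r. vector [(1 / l) * r $ 1, (1 / l) * (r $ 2 - m)]"])
    show "smooth_on half_plane (\<lambda>r. \<phi> r $ k)" for k
      using exhaust_2[of k] unfolding \<phi>_def
      by (elim disjE; simp) (intro smooth_intros open_half_plane)+
    show "smooth_on half_plane (\<lambda>r. vector [(1 / l) * r $ 1, (1 / l) * (r $ 2 - m)] $ k)" for k :: 2
      using exhaust_2[of k]
      by (elim disjE; simp only: vector_2) (intro smooth_intros open_half_plane)+
  qed (use l in \<open>auto simp: open_half_plane[unfolded half_plane_def] half_plane_def \<phi>_def vec_eq_iff forall_2\<close>)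
  moreover have "is_pullback half_plane \<phi> (conn C) (conn C)"
    unfolding is_pullback_def
  proof (intro ballI allI)
    fix r :: point and i j k :: 2 assume "r \<in> half_plane"
    then have r: "r $ 1 > 0" by (rule half_plane_pos)
    have d: "partial i (\<lambda>r. \<phi> r $ k) = (\<lambda>r. if i = k then l else 0)" for i k
      using exhaust_2[of i] exhaust_2[of k] by (auto simp: \<phi>_def partial_simps fun_eq_iff)
    show "(\<Sum>n\<in>UNIV. conn C r i j n * partial n (\<lambda>r. \<phi> r $ k) r) =
       partial i (partial j (\<lambda>r. \<phi> r $ k)) r + (\<Sum>a\<in>UNIV. \<Sum>b\<in>UNIV. conn C (\<phi> r) a b k *
        partial i (\<lambda>r. \<phi> r $ a) r * partial j (\<lambda>r. \<phi> r $ b) r)"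
      using l r exhaust_2[of i] exhaust_2[of j] exhaust_2[of k] unfolding d
      by (elim disjE) (simp_all add: sum_2 conn_def \<phi>_def)
  qed
  moreover have "\<phi> p = q"
    using pq by (simp add: \<phi>_def m_def l_def vec_eq_iff forall_2 half_plane_def)
  ultimately show "\<exists>V W \<phi>. p \<in> V \<and> V \<subseteq> half_plane \<and> W \<subseteq> half_plane \<and> diffeo V \<phi> W \<and> \<phi> p = q \<and>
      is_pullback V \<phi> (conn C) (conn C)"
    using pq by blast
qed

lemma type_A_chart:
  assumes "\<not> flat half_plane (conn C)" "diffeo half_plane \<phi> W" "is_pullback half_plane \<phi> (\<lambda>_. G) (conn C)"
  shows "type_A half_plane (conn C)"
  using assms locally_homogeneous_conn unfolding type_A_def by blast

text \<open>The charts straighten two commuting, independent Killing fields, along which the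
  Christoffel symbols must be constant: x \<partial>_1 + b x \<partial>_2 and \<partial>_2 if
  \<open>C 1 1 1 - 2 * C 1 2 2\<close> is nonzero, and x \<partial>_1 + y \<partial>_2 and x
  \<partial>_2 if it is zero.\<close>

lemma type_A_rank1:
  assumes C: "\<And>i j k. C i j k = C j i k" and C0: "C 1 2 1 = 0" "C 2 2 1 = 0" "C 2 2 2 = 0"
    and nf: "\<not> flat half_plane (conn C)"
  shows "type_A half_plane (conn C)"
proof (cases "C 1 1 1 - 2 * C 1 2 2 = 0")
  case d: False
  define b where "b = C 1 1 2 / (C 1 1 1 - 2 * C 1 2 2)"
  have b: "C 1 1 2 = b * (C 1 1 1 - 2 * C 1 2 2)" using d by (simp add: b_def)
  define \<phi> :: "point \<Rightarrow> point" where "\<phi> r = vector [ln (r $ 1), r $ 2 - b * r $ 1]" for r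
  define G where "G = consts6 (1 + C 1 1 1) 0 0 (C 1 2 2) 0 0"
  show ?thesis
  proof (rule type_A_chart[OF nf])
    show "diffeo half_plane \<phi> UNIV"
    proof (rule diffeoI[of _ _ _ "\<lambda>r. vector [exp (r $ 1), r $ 2 + b * exp (r $ 1)]"])
      show "smooth_on half_plane (\<lambda>r. \<phi> r $ k)" for k
        using exhaust_2[of k] unfolding \<phi>_def
        by (elim disjE; simp) (intro smooth_intros open_half_plane half_plane_pos, assumption?)+
      show "smooth_on UNIV (\<lambda>r. vector [exp (r $ 1), r $ 2 + b * exp (r $ 1)] $ k)" for k :: 2
        using exhaust_2[of k]
        by (elim disjE; simp only: vector_2) (intro smooth_intros open_UNIV)+
    qed (auto simp: open_half_plane[unfolded half_plane_def] half_plane_def \<phi>_def vec_eq_iff forall_2)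
    show "is_pullback half_plane \<phi> (\<lambda>_. G) (conn C)"
      unfolding is_pullback_def
    proof (intro ballI allI)
      fix r :: point and i j k :: 2 assume r: "r \<in> half_plane"
      then have x: "r $ 1 > 0" by (rule half_plane_pos)
      have d1: "partial i (\<lambda>r. \<phi> r $ 1) r = (if i = 1 then 1 / r $ 1 else 0)"
        "partial i (\<lambda>r. \<phi> r $ 2) r = (if i = 1 then - b else 1)" if "r \<in> half_plane" for i r
        using partial_chain(2)[where f = "\<lambda>r. r $ 1" and h = ln, OF differentiable_coord DERIV_ln_divide]
          half_plane_pos[OF that] exhaust_2[of i] by (auto simp: \<phi>_def partial_simps)
      have d2: "partial i (partial j (\<lambda>r. \<phi> r $ 1)) r = (if i = 1 \<and> j = 1 then - 1 / (r $ 1)\<^sup>2 else 0)"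
        "partial i (partial j (\<lambda>r. \<phi> r $ 2)) r = 0" for i j
        using partial_cong[OF open_half_plane r d1(1)] partial_cong[OF open_half_plane r d1(2)]
          x exhaust_2[of i] exhaust_2[of j] by (auto simp: partial_simps)
      show "(\<Sum>n\<in>UNIV. conn C r i j n * partial n (\<lambda>r. \<phi> r $ k) r) =
         partial i (partial j (\<lambda>r. \<phi> r $ k)) r + (\<Sum>a\<in>UNIV. \<Sum>b\<in>UNIV. G a b k *
          partial i (\<lambda>r. \<phi> r $ a) r * partial j (\<lambda>r. \<phi> r $ b) r)"
        using x exhaust_2[of i] exhaust_2[of j] exhaust_2[of k] C[of 2 1] C0 b
        by (elim disjE) (simp_all add: sum_2 conn_def d1[OF r] d2 G_def, simp_all add: field_simps power2_eq_square)
    qed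
  qed
next
  case d: True
  define \<phi> :: "point \<Rightarrow> point" where "\<phi> r = vector [ln (r $ 1), r $ 2 / r $ 1]" for r
  define G where "G = consts6 (1 + C 1 1 1) (C 1 1 2) 0 (1 + C 1 2 2) 0 0"
  show ?thesis
  proof (rule type_A_chart[OF nf])
    show "diffeo half_plane \<phi> UNIV"
    proof (rule diffeoI[of _ _ _ "\<lambda>r. vector [exp (r $ 1), r $ 2 * exp (r $ 1)]"])
      show "smooth_on half_plane (\<lambda>r. \<phi> r $ k)" for k
        using exhaust_2[of k] unfolding \<phi>_def
        by (elim disjE; simp) (intro smooth_intros open_half_plane half_plane_pos, assumption?)+
      show "smooth_on UNIV (\<lambda>r. vector [exp (r $ 1), r $ 2 * exp (r $ 1)] $ k)" for k :: 2
        using exhaust_2[of k]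
        by (elim disjE; simp only: vector_2) (intro smooth_intros open_UNIV)+
    qed (auto simp: open_half_plane[unfolded half_plane_def] half_plane_def \<phi>_def vec_eq_iff forall_2)
    show "is_pullback half_plane \<phi> (\<lambda>_. G) (conn C)"
      unfolding is_pullback_def
    proof (intro ballI allI)
      fix r :: point and i j k :: 2 assume r: "r \<in> half_plane"
      then have x: "r $ 1 > 0" by (rule half_plane_pos)
      have d1: "partial i (\<lambda>r. \<phi> r $ 1) r = (if i = 1 then 1 / r $ 1 else 0)"
        "partial i (\<lambda>r. \<phi> r $ 2) r = (if i = 1 then - r $ 2 / (r $ 1)\<^sup>2 else 1 / r $ 1)" if "r \<in> half_plane" for i r
        using partial_chain(2)[where f = "\<lambda>r. r $ 1" and h = ln, OF differentiable_coord DERIV_ln_divide]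
          half_plane_pos[OF that] exhaust_2[of i]
        by (auto simp: \<phi>_def partial_simps power2_eq_square)
      have d2: "partial i (partial j (\<lambda>r. \<phi> r $ 1)) r = (if i = 1 \<and> j = 1 then - 1 / (r $ 1)\<^sup>2 else 0)"
        "partial i (partial j (\<lambda>r. \<phi> r $ 2)) r =
          (if i = 1 \<and> j = 1 then 2 * r $ 2 / (r $ 1)^3 else if i = 2 \<and> j = 2 then 0 else - 1 / (r $ 1)\<^sup>2)" for i j
        using partial_cong[OF open_half_plane r d1(1)] partial_cong[OF open_half_plane r d1(2)]
          x exhaust_2[of i] exhaust_2[of j]
        by (auto simp: partial_simps power2_eq_square power3_eq_cube field_simps)
      show "(\<Sum>n\<in>UNIV. conn C r i j n * partial n (\<lambda>r. \<phi> r $ k) r) =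
         partial i (partial j (\<lambda>r. \<phi> r $ k)) r + (\<Sum>a\<in>UNIV. \<Sum>b\<in>UNIV. G a b k *
          partial i (\<lambda>r. \<phi> r $ a) r * partial j (\<lambda>r. \<phi> r $ b) r)"
        using x exhaust_2[of i] exhaust_2[of j] exhaust_2[of k] C[of 2 1] C0 d
        by (elim disjE) (simp_all add: sum_2 conn_def d1[OF r] d2 G_def,
            simp_all add: field_simps power2_eq_square power3_eq_cube)
    qed
  qed
qed

section \<open>Derivatives along the frame x (\<partial>_1 + \<beta> \<partial>_2), x
  \<partial>_2\<close>

definition fderiv :: "real \<Rightarrow> 2 \<Rightarrow> (point \<Rightarrow> real) \<Rightarrow> point \<Rightarrow> real" where
  "fderiv \<beta> k f q = q $ 1 * (if k = 1 then partial 1 f q + \<beta> * partial 2 f q else partial 2 f q)"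

context
  fixes V :: "point set"
  assumes V: "open V"
begin

lemma fderiv_add:
  assumes "smooth_on V f" "smooth_on V g" "q \<in> V"
  shows "fderiv \<beta> k (\<lambda>q. f q + g q) q = fderiv \<beta> k f q + fderiv \<beta> k g q"
  using smooth_on_differentiable[OF V assms(1,3)] smooth_on_differentiable[OF V assms(2,3)]
  by (simp add: fderiv_def partial_simps algebra_simps)

lemma fderiv_diff:
  assumes "smooth_on V f" "smooth_on V g" "q \<in> V"
  shows "fderiv \<beta> k (\<lambda>q. f q - g q) q = fderiv \<beta> k f q - fderiv \<beta> k g q"
  using smooth_on_differentiable[OF V assms(1,3)] smooth_on_differentiable[OF V assms(2,3)]
  by (simp add: fderiv_def partial_simps algebra_simps)

lemma fderiv_mult:
  assumes "smooth_on V f" "smooth_on V g" "q \<in> V"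
  shows "fderiv \<beta> k (\<lambda>q. f q * g q) q = f q * fderiv \<beta> k g q + fderiv \<beta> k f q * g q"
  using smooth_on_differentiable[OF V assms(1,3)] smooth_on_differentiable[OF V assms(2,3)]
  by (simp add: fderiv_def partial_simps algebra_simps)

lemma fderiv_const: "fderiv \<beta> k (\<lambda>q. c) q = 0"
  by (simp add: fderiv_def)

lemma fderiv_cong:
  assumes "q \<in> V" "\<And>q. q \<in> V \<Longrightarrow> f q = g q"
  shows "fderiv \<beta> k f q = fderiv \<beta> k g q"
  using partial_cong[OF V assms] by (simp add: fderiv_def)

lemma smooth_fderiv:
  assumes "smooth_on V f"
  shows "smooth_on V (fderiv \<beta> k f)"
proof -
  have "smooth_on V (\<lambda>q. q $ 1 * (partial 1 f q + \<beta> * partial 2 f q))" "smooth_on V (\<lambda>q. q $ 1 * partial 2 f q)"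
    by (intro smooth_intros V smooth_on_partial assms)+
  moreover have "fderiv \<beta> k f = (if k = 1 then (\<lambda>q. q $ 1 * (partial 1 f q + \<beta> * partial 2 f q)) else (\<lambda>q. q $ 1 * partial 2 f q))"
    by (auto simp: fderiv_def fun_eq_iff)
  ultimately show ?thesis by simp
qed

lemma fderiv_fderiv:
  assumes f: "smooth_on V f" and q: "q \<in> V"
  shows "fderiv \<beta> 1 (fderiv \<beta> 1 f) q = fderiv \<beta> 1 f q + (q $ 1)\<^sup>2 * (partial 1 (partial 1 f) q
      + 2 * \<beta> * partial 1 (partial 2 f) q + \<beta>\<^sup>2 * partial 2 (partial 2 f) q)"
    "fderiv \<beta> 1 (fderiv \<beta> 2 f) q = fderiv \<beta> 2 f q + (q $ 1)\<^sup>2 * (partial 1 (partial 2 f) q + \<beta> * partial 2 (partial 2 f) q)"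
    "fderiv \<beta> 2 (fderiv \<beta> 1 f) q = (q $ 1)\<^sup>2 * (partial 1 (partial 2 f) q + \<beta> * partial 2 (partial 2 f) q)"
    "fderiv \<beta> 2 (fderiv \<beta> 2 f) q = (q $ 1)\<^sup>2 * partial 2 (partial 2 f) q"
proof -
  have d: "partial i f differentiable at q" for i
    by (rule smooth_on_differentiable[OF V smooth_on_partial[OF f] q])
  have c: "partial 2 (partial 1 f) q = partial 1 (partial 2 f) q"
    by (rule partial_commute[OF V f q])
  have e: "fderiv \<beta> 1 f = (\<lambda>q. q $ 1 * (partial 1 f q + \<beta> * partial 2 f q))" "fderiv \<beta> 2 f = (\<lambda>q. q $ 1 * partial 2 f q)"
    by (simp_all add: fderiv_def fun_eq_iff)
  show "fderiv \<beta> 1 (fderiv \<beta> 1 f) q = fderiv \<beta> 1 f q + (q $ 1)\<^sup>2 * (partial 1 (partial 1 f) q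
      + 2 * \<beta> * partial 1 (partial 2 f) q + \<beta>\<^sup>2 * partial 2 (partial 2 f) q)"
    "fderiv \<beta> 1 (fderiv \<beta> 2 f) q = fderiv \<beta> 2 f q + (q $ 1)\<^sup>2 * (partial 1 (partial 2 f) q + \<beta> * partial 2 (partial 2 f) q)"
    "fderiv \<beta> 2 (fderiv \<beta> 1 f) q = (q $ 1)\<^sup>2 * (partial 1 (partial 2 f) q + \<beta> * partial 2 (partial 2 f) q)"
    "fderiv \<beta> 2 (fderiv \<beta> 2 f) q = (q $ 1)\<^sup>2 * partial 2 (partial 2 f) q"
    unfolding e unfolding fderiv_def
    by (simp_all add: d partial_simps c) (simp_all add: algebra_simps power2_eq_square)
qed

lemma fderiv_commute:
  assumes f: "smooth_on V f" and q: "q \<in> V"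
  shows "fderiv \<beta> 1 (fderiv \<beta> 2 f) q - fderiv \<beta> 2 (fderiv \<beta> 1 f) q = fderiv \<beta> 2 f q"
  by (simp add: fderiv_fderiv[OF assms])

lemmas fderiv_rules = fderiv_add fderiv_diff fderiv_mult fderiv_const

end

lemma partial_chain2:
  fixes \<phi> :: "point \<Rightarrow> point"
  assumes f: "f differentiable at (\<phi> p)" and \<phi>: "\<And>l. (\<lambda>q. \<phi> q $ l) differentiable at p"
  shows "partial k (\<lambda>q. f (\<phi> q)) p =
    partial 1 f (\<phi> p) * partial k (\<lambda>q. \<phi> q $ 1) p + partial 2 f (\<phi> p) * partial k (\<lambda>q. \<phi> q $ 2) p"
proof -
  let ?D = "\<lambda>v. \<chi> l. partial 1 (\<lambda>q. \<phi> q $ l) p * v $ 1 + partial 2 (\<lambda>q. \<phi> q $ l) p * v $ 2"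
  have "(\<phi> has_derivative ?D) (at p)"
    using has_derivative_partial[OF \<phi>]
    by (subst has_derivative_componentwise_within) (auto simp: Basis_vec_def inner_axis)
  from has_derivative_compose[OF this has_derivative_partial[OF f]]
  have "((\<lambda>q. f (\<phi> q)) has_derivative (\<lambda>v. partial 1 f (\<phi> p) * ?D v $ 1 + partial 2 f (\<phi> p) * ?D v $ 2)) (at p)" .
  from partial_eqI[OF this, of k] show ?thesis using exhaust_2[of k] by auto
qed

text \<open>The chain rule for the inverse map provides a left inverse of the Jacobian
  matrix.\<close>

lemma diffeo_jacobian:
  assumes "diffeo V \<phi> W" "p \<in> V"
  shows "partial 1 (\<lambda>q. \<phi> q $ 1) p * partial 2 (\<lambda>q. \<phi> q $ 2) p
    - partial 2 (\<lambda>q. \<phi> q $ 1) p * partial 1 (\<lambda>q. \<phi> q $ 2) p \<noteq> 0"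
proof -
  let ?g = "inv_into V \<phi>"
  have o: "open V" "open W" and b: "bij_betw \<phi> V W" and s: "\<And>k. smooth_on V (\<lambda>q. \<phi> q $ k)" "\<And>k. smooth_on W (\<lambda>q. ?g q $ k)"
    using assms(1) by (auto simp: diffeo_def smooth_map_on_def)
  have W: "\<phi> p \<in> W" using b assms(2) by (auto simp: bij_betw_def)
  have inv: "?g (\<phi> q) = q" if "q \<in> V" for q
    using that b by (simp add: bij_betw_def)
  have "partial 1 (\<lambda>q. ?g q $ j) (\<phi> p) * partial k (\<lambda>q. \<phi> q $ 1) p
      + partial 2 (\<lambda>q. ?g q $ j) (\<phi> p) * partial k (\<lambda>q. \<phi> q $ 2) p = (if k = j then 1 else 0)" for k j
    using partial_chain2[OF smooth_on_differentiable[OF o(2) s(2) W] smooth_on_differentiable[OF o(1) s(1) assms(2)], of k j]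
      partial_cong[OF o(1) assms(2), of "\<lambda>q. ?g (\<phi> q) $ j" "\<lambda>q. q $ j" k] inv by simp
  note e = this[of 1 1] this[of 1 2] this[of 2 1] this[of 2 2]
  show ?thesis
  proof
    assume "partial 1 (\<lambda>q. \<phi> q $ 1) p * partial 2 (\<lambda>q. \<phi> q $ 2) p
      - partial 2 (\<lambda>q. \<phi> q $ 1) p * partial 1 (\<lambda>q. \<phi> q $ 2) p = 0"
    with e have "(1::real) = 0" by simp algebra
    then show False by simp
  qed
qed

definition quad :: "(2 \<Rightarrow> 2 \<Rightarrow> 2 \<Rightarrow> real) \<Rightarrow> (2 \<Rightarrow> 2 \<Rightarrow> point \<Rightarrow> real) \<Rightarrow> 2 \<Rightarrow> 2 \<Rightarrow> 2 \<Rightarrow> point \<Rightarrow> real" where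
  "quad G m i j l q = G 1 1 l * m i 1 q * m j 1 q + G 1 2 l * m i 1 q * m j 2 q
     + G 2 1 l * m i 2 q * m j 1 q + G 2 2 l * m i 2 q * m j 2 q"

text \<open>In a chart \<open>\<phi>\<close> with constant Christoffel symbols \<open>G\<close>, let \<open>m i l = e\<^sub>i \<phi>\<^sup>l\<close>, where \<open>e\<^sub>i\<close> is the frame of
  \<^const>\<open>framed\<close>. The pull-back condition becomes \<open>e\<^sub>i m\<^sub>j = \<omega>\<^sub>i\<^sub>j\<^sup>k m\<^sub>k - G(m\<^sub>i, m\<^sub>j)\<close> with constants
  \<open>\<omega>\<^sub>i\<^sub>j\<^sup>k = \<delta>\<^sub>i\<^sub>1 \<delta>\<^sub>j\<^sup>k + C'\<^sub>i\<^sub>j\<^sup>k\<close>, and \<open>[e1, e2] = e2\<close> then transports the curvature.\<close>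

lemma chart_frame:
  assumes V: "open V" "V \<subseteq> half_plane" and s: "\<And>l. smooth_on V (\<lambda>q. \<phi> q $ l)"
    and pb: "is_pullback V \<phi> (\<lambda>_. G) (conn C)" and fr: "framed \<beta> 1 C C'"
    and sym: "\<And>k. C 2 1 k = C 1 2 k" and q: "q \<in> V"
  defines "m \<equiv> \<lambda>i l. fderiv \<beta> i (\<lambda>q. \<phi> q $ l)"
  shows "fderiv \<beta> 1 (m 1 l) q = (1 + C' 1 1 1) * m 1 l q + C' 1 1 2 * m 2 l q - quad G m 1 1 l q"
    "fderiv \<beta> 1 (m 2 l) q = C' 1 2 1 * m 1 l q + (1 + C' 1 2 2) * m 2 l q - quad G m 1 2 l q"
    "fderiv \<beta> 2 (m 1 l) q = C' 1 2 1 * m 1 l q + C' 1 2 2 * m 2 l q - quad G m 2 1 l q"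
    "fderiv \<beta> 2 (m 2 l) q = C' 2 2 1 * m 1 l q + C' 2 2 2 * m 2 l q - quad G m 2 2 l q"
proof -
  have x: "q $ 1 > 0" using q V half_plane_pos by blast
  have f: "C' 1 1 1 = C 1 1 1 + 2 * \<beta> * C 1 2 1 + \<beta>\<^sup>2 * C 2 2 1"
    "\<beta> * C' 1 1 1 + C' 1 1 2 = C 1 1 2 + 2 * \<beta> * C 1 2 2 + \<beta>\<^sup>2 * C 2 2 2"
    "C' 1 2 1 = C 1 2 1 + \<beta> * C 2 2 1" "\<beta> * C' 1 2 1 + C' 1 2 2 = C 1 2 2 + \<beta> * C 2 2 2"
    "C' 2 2 1 = C 2 2 1" "\<beta> * C' 2 2 1 + C' 2 2 2 = C 2 2 2"
    using fr unfolding framed_def by auto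
  define J where "J i l = partial i (\<lambda>q. \<phi> q $ l) q" for i l
  define H where "H i j l = partial i (partial j (\<lambda>q. \<phi> q $ l)) q" for i j l
  define B where "B i j l = G 1 1 l * J i 1 * J j 1 + G 1 2 l * J i 1 * J j 2
    + G 2 1 l * J i 2 * J j 1 + G 2 2 l * J i 2 * J j 2" for i j l
  have H0: "q $ 1 * H i j l = C i j 1 * J 1 l + C i j 2 * J 2 l - q $ 1 * B i j l" for i j l
  proof -
    have "(C i j 1 * J 1 l + C i j 2 * J 2 l) / q $ 1 = H i j l + B i j l"
      using pb q unfolding is_pullback_def H_def J_def B_def
      by (auto simp: sum_2 conn_def add_divide_distrib algebra_simps)
    then show ?thesis using x by (simp add: field_simps)
  qed
  have Hs: "H 2 1 l = H 1 2 l" for l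
    unfolding H_def by (rule partial_commute[OF V(1) s q])
  \<comment> \<open>A chart of Type A may a priori have constants \<open>G\<close> with torsion; the
    symmetry of \<open>B\<close> follows from that of the Hessian and of \<open>C\<close>.\<close>
  then have Bs: "B 2 1 l = B 1 2 l" for l
    using H0[of 2 1 l] H0[of 1 2 l] x sym by simp
  have m: "m 1 l q = q $ 1 * (J 1 l + \<beta> * J 2 l)" "m 2 l q = q $ 1 * J 2 l" for l
    by (simp_all add: m_def fderiv_def J_def)
  have g1: "quad G m 1 2 l q = (q $ 1)\<^sup>2 * (B 1 2 l + \<beta> * B 2 2 l)" "quad G m 2 2 l q = (q $ 1)\<^sup>2 * B 2 2 l"
    "quad G m 2 1 l q = (q $ 1)\<^sup>2 * (B 2 1 l + \<beta> * B 2 2 l)"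
    "quad G m 1 1 l q = (q $ 1)\<^sup>2 * (B 1 1 l + \<beta> * B 1 2 l + \<beta> * B 2 1 l + \<beta>\<^sup>2 * B 2 2 l)" for l
    unfolding quad_def m B_def by (simp_all add: algebra_simps power2_eq_square)
  have g: "quad G m 1 1 l q = (q $ 1)\<^sup>2 * (B 1 1 l + 2 * \<beta> * B 1 2 l + \<beta>\<^sup>2 * B 2 2 l)"
    "quad G m 1 2 l q = (q $ 1)\<^sup>2 * (B 1 2 l + \<beta> * B 2 2 l)" "quad G m 2 1 l q = (q $ 1)\<^sup>2 * (B 1 2 l + \<beta> * B 2 2 l)"
    "quad G m 2 2 l q = (q $ 1)\<^sup>2 * B 2 2 l" for l
    by (simp_all add: g1 Bs)
  have k: "(q $ 1)\<^sup>2 * H i j l = q $ 1 * (C i j 1 * J 1 l + C i j 2 * J 2 l) - (q $ 1)\<^sup>2 * B i j l" for i j l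
  proof -
    have "(q $ 1)\<^sup>2 * H i j l = q $ 1 * (q $ 1 * H i j l)" by (simp add: power2_eq_square)
    then show ?thesis unfolding H0 by (simp add: algebra_simps power2_eq_square)
  qed
  have e: "fderiv \<beta> 1 (m 1 l) q = m 1 l q + (q $ 1)\<^sup>2 * (H 1 1 l + 2 * \<beta> * H 1 2 l + \<beta>\<^sup>2 * H 2 2 l)"
    "fderiv \<beta> 1 (m 2 l) q = m 2 l q + (q $ 1)\<^sup>2 * (H 1 2 l + \<beta> * H 2 2 l)"
    "fderiv \<beta> 2 (m 1 l) q = (q $ 1)\<^sup>2 * (H 1 2 l + \<beta> * H 2 2 l)"
    "fderiv \<beta> 2 (m 2 l) q = (q $ 1)\<^sup>2 * H 2 2 l"
    unfolding m_def H_def by (rule fderiv_fderiv[OF V(1) s q])+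
  note k4 = k[of 1 1 l] k[of 1 2 l] k[of 2 2 l]
  have c: "a * m 1 l q + b * m 2 l q = q $ 1 * (a * J 1 l + (\<beta> * a + b) * J 2 l)" for a b
    by (simp add: m algebra_simps)
  have "(q $ 1)\<^sup>2 * (H 1 1 l + 2 * \<beta> * H 1 2 l + \<beta>\<^sup>2 * H 2 2 l) =
      q $ 1 * (C' 1 1 1 * J 1 l + (\<beta> * C' 1 1 1 + C' 1 1 2) * J 2 l) - quad G m 1 1 l q"
    unfolding f(2) g unfolding f(1) using k4 by algebra
  then show "fderiv \<beta> 1 (m 1 l) q = (1 + C' 1 1 1) * m 1 l q + C' 1 1 2 * m 2 l q - quad G m 1 1 l q"
    unfolding e(1) c[symmetric] by (simp add: algebra_simps)
  have 2: "(q $ 1)\<^sup>2 * (H 1 2 l + \<beta> * H 2 2 l) =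
      q $ 1 * (C' 1 2 1 * J 1 l + (\<beta> * C' 1 2 1 + C' 1 2 2) * J 2 l) - quad G m 1 2 l q"
    unfolding f(4) g unfolding f(3) using k4 by algebra
  then show "fderiv \<beta> 1 (m 2 l) q = C' 1 2 1 * m 1 l q + (1 + C' 1 2 2) * m 2 l q - quad G m 1 2 l q"
    unfolding e(2) c[symmetric] by (simp add: algebra_simps)
  from 2 show "fderiv \<beta> 2 (m 1 l) q = C' 1 2 1 * m 1 l q + C' 1 2 2 * m 2 l q - quad G m 2 1 l q"
    unfolding e(3) c[symmetric] g(2,3) by (simp add: algebra_simps)
  have "(q $ 1)\<^sup>2 * H 2 2 l = q $ 1 * (C' 2 2 1 * J 1 l + (\<beta> * C' 2 2 1 + C' 2 2 2) * J 2 l) - quad G m 2 2 l q"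
    unfolding f(6) g unfolding f(5) by (rule k)
  then show "fderiv \<beta> 2 (m 2 l) q = C' 2 2 1 * m 1 l q + C' 2 2 2 * m 2 l q - quad G m 2 2 l q"
    unfolding e(4) c[symmetric] by (simp add: algebra_simps)
qed

text \<open>The integrability condition for [e1, e2] = e2. \<open>K\<close> is the curvature of the
  constants \<open>G\<close>, and the determinant of \<open>m\<close> appears because R(m_1, m_2) is
  that multiple of R(\<partial>_1, \<partial>_2).\<close>

lemma frame_integrability:
  fixes m :: "2 \<Rightarrow> 2 \<Rightarrow> point \<Rightarrow> real" and G C :: "2 \<Rightarrow> 2 \<Rightarrow> 2 \<Rightarrow> real"
  assumes V: "open V" and sm: "\<And>i l. smooth_on V (m i l)" and sym: "\<And>k. C 2 1 k = C 1 2 k"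
    and e: "\<And>q l. q \<in> V \<Longrightarrow> fderiv \<beta> 1 (m 1 l) q = (1 + C 1 1 1) * m 1 l q + C 1 1 2 * m 2 l q -
      quad G m 1 1 l q"
    "\<And>q l. q \<in> V \<Longrightarrow> fderiv \<beta> 1 (m 2 l) q = C 1 2 1 * m 1 l q + (1 + C 1 2 2) * m 2 l q -
      quad G m 1 2 l q"
    "\<And>q l. q \<in> V \<Longrightarrow> fderiv \<beta> 2 (m 1 l) q = C 1 2 1 * m 1 l q + C 1 2 2 * m 2 l q -
      quad G m 2 1 l q"
    "\<And>q l. q \<in> V \<Longrightarrow> fderiv \<beta> 2 (m 2 l) q = C 2 2 1 * m 1 l q + C 2 2 2 * m 2 l q -
      quad G m 2 2 l q"
    and Gs: "\<And>l. G 2 1 l = G 1 2 l"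
    and q: "q \<in> V"
  defines "K \<equiv> \<lambda>l b. G 1 1 l * G 2 b 1 + G 1 2 l * G 2 b 2 - G 2 1 l * G 1 b 1 - G 2 2 l * G 1 b 2"
  shows "curv C j 1 * m 1 l q + curv C j 2 * m 2 l q =
    (m 1 1 q * m 2 2 q - m 1 2 q * m 2 1 q) * (K l 1 * m j 1 q + K l 2 * m j 2 q)"
proof -
  note r = fderiv_rules[OF V] smooth_on_const[OF V] smooth_on_add[OF V] smooth_on_diff[OF V] smooth_on_mult[OF V] sm q
  have c1: "fderiv \<beta> 1 (fderiv \<beta> 2 (m 1 l)) q - fderiv \<beta> 2 (fderiv \<beta> 1 (m 1 l)) q = fderiv \<beta> 2 (m 1 l) q"
    and c2: "fderiv \<beta> 1 (fderiv \<beta> 2 (m 2 l)) q - fderiv \<beta> 2 (fderiv \<beta> 1 (m 2 l)) q = fderiv \<beta> 2 (m 2 l) q"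
    by (rule fderiv_commute[OF V sm q])+
  have E: "fderiv \<beta> k (fderiv \<beta> 1 (m 1 l)) q = fderiv \<beta> k (\<lambda>q. (1 + C 1 1 1) * m 1 l q + C 1 1 2 * m 2 l q - quad G m 1 1 l q) q"
    "fderiv \<beta> k (fderiv \<beta> 1 (m 2 l)) q = fderiv \<beta> k (\<lambda>q. C 1 2 1 * m 1 l q + (1 + C 1 2 2) * m 2 l q - quad G m 1 2 l q) q"
    "fderiv \<beta> k (fderiv \<beta> 2 (m 1 l)) q = fderiv \<beta> k (\<lambda>q. C 1 2 1 * m 1 l q + C 1 2 2 * m 2 l q - quad G m 2 1 l q) q"
    "fderiv \<beta> k (fderiv \<beta> 2 (m 2 l)) q = fderiv \<beta> k (\<lambda>q. C 2 2 1 * m 1 l q + C 2 2 2 * m 2 l q - quad G m 2 2 l q) q"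
    for k
    by (rule fderiv_cong[OF V q], rule e, assumption)+
  have 1: "curv C 1 1 * m 1 l q + curv C 1 2 * m 2 l q =
    (m 1 1 q * m 2 2 q - m 1 2 q * m 2 1 q) * (K l 1 * m 1 1 q + K l 2 * m 1 2 q)"
  proof -
    note c = c1[unfolded E, unfolded quad_def, simplified r, unfolded e[OF q] quad_def]
    show ?thesis using c unfolding K_def curv_def sym Gs by (simp add: algebra_simps)
  qed
  have 2: "curv C 2 1 * m 1 l q + curv C 2 2 * m 2 l q =
    (m 1 1 q * m 2 2 q - m 1 2 q * m 2 1 q) * (K l 1 * m 2 1 q + K l 2 * m 2 2 q)"
  proof -
    note c = c2[unfolded E, unfolded quad_def, simplified r, unfolded e[OF q] quad_def]
    show ?thesis using c unfolding K_def curv_def sym Gs by (simp add: algebra_simps)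
  qed
  from 1 2 show ?thesis using exhaust_2[of j] by auto
qed

lemma cramer2:
  fixes a1 a2 b1 b2 v1 v2 :: real
  assumes "a1 * b2 - a2 * b1 \<noteq> 0"
  obtains x y where "v1 = x * a1 + y * b1" "v2 = x * a2 + y * b2"
proof
  let ?D = "a1 * b2 - a2 * b1"
  show "v1 = (v1 * b2 - v2 * b1) / ?D * a1 + (a1 * v2 - a2 * v1) / ?D * b1"
    "v2 = (v1 * b2 - v2 * b1) / ?D * a2 + (a1 * v2 - a2 * v1) / ?D * b2"
    using assms by (simp_all add: divide_simps) (simp_all add: algebra_simps)
qed

lemma indep2:
  fixes a1 a2 b1 b2 x y :: real
  assumes "a1 * b2 - a2 * b1 \<noteq> 0" "x * a1 + y * b1 = 0" "x * a2 + y * b2 = 0"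
  shows "x = 0" "y = 0"
proof -
  have "x * (a1 * b2 - a2 * b1) = 0" "y * (a1 * b2 - a2 * b1) = 0" using assms(2,3) by algebra+
  with assms(1) show "x = 0" "y = 0" by simp_all
qed

lemma nform_curv:
  assumes nf: "nform C c h1 h2"
  shows "c \<noteq> 0 \<Longrightarrow> curv C 1 1 = 0 \<and> curv C 2 1 = - h1 \<and> curv C 1 2 = 1 \<and> curv C 2 2 = 0 \<and> h1 \<noteq> 0"
    "c = 0 \<Longrightarrow> curv C 1 1 = - 3 / 4 * h2 \<and> curv C 2 1 = h2\<^sup>2 / 4 - 2 * h1 \<and> curv C 1 2 = 0 \<and> curv C 2 2 = - 3 / 4 * h2"
proof -
  have C: "C = consts6 (-3/2 - c * h1 / 2) (- c * h2 / 2) (h2 / 2) ((c * h1 - 1) / 2) h1 h2"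
    using nf unfolding nform_def by blast
  show "curv C 1 1 = 0 \<and> curv C 2 1 = - h1 \<and> curv C 1 2 = 1 \<and> curv C 2 2 = 0 \<and> h1 \<noteq> 0" if "c \<noteq> 0"
    using nf
  proof (cases rule: nform_cases)
    case 2
    have "h1 \<noteq> 0" using 2(3) by auto
    then show ?thesis unfolding C curv_def consts6_simps 2 by simp
  qed (use that in simp)
  show "curv C 1 1 = - 3 / 4 * h2 \<and> curv C 2 1 = h2\<^sup>2 / 4 - 2 * h1 \<and> curv C 1 2 = 0 \<and> curv C 2 2 = - 3 / 4 * h2" if "c = 0"
    unfolding C curv_def consts6_simps that by (simp add: field_simps power2_eq_square)
qed

text \<open>In the application \<open>K\<close> is a commutator of constant matrices, hence of trace
  zero. As \<open>K\<close> does not vary, differentiating \<open>F\<close> restricts the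
  derivatives of \<open>m\<close>; the three shapes of the curvature matrix need different
  contradictions.\<close>

lemma nform_no_constant_frame:
  fixes m :: "2 \<Rightarrow> 2 \<Rightarrow> point \<Rightarrow> real" and K :: "2 \<Rightarrow> 2 \<Rightarrow> real"
  assumes V: "open V" and p: "p \<in> V" and sm: "\<And>i l. smooth_on V (m i l)"
    and D: "\<And>q. q \<in> V \<Longrightarrow> m 1 1 q * m 2 2 q - m 1 2 q * m 2 1 q \<noteq> 0"
    and t: "\<And>q l. q \<in> V \<Longrightarrow> fderiv \<beta> 1 (m 2 l) q - fderiv \<beta> 2 (m 1 l) q = m 2 l q"
    and F: "\<And>q j l. q \<in> V \<Longrightarrow> curv C j 1 * m 1 l q + curv C j 2 * m 2 l q =
      (m 1 1 q * m 2 2 q - m 1 2 q * m 2 1 q) * (K l 1 * m j 1 q + K l 2 * m j 2 q)"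
    and K: "K 1 1 + K 2 2 = 0" and nf: "nform C c h1 h2" and h: "h1 \<noteq> 0 \<or> h2 \<noteq> 0"
  shows False
proof -
  note r = fderiv_rules[OF V] smooth_on_const[OF V] smooth_on_add[OF V] smooth_on_diff[OF V] smooth_on_mult[OF V] sm
  define d where "d q = m 1 1 q * m 2 2 q - m 1 2 q * m 2 1 q" for q
  have dd: "fderiv \<beta> i d q = m 1 1 q * fderiv \<beta> i (m 2 2) q + fderiv \<beta> i (m 1 1) q * m 2 2 q
      - (m 1 2 q * fderiv \<beta> i (m 2 1) q + fderiv \<beta> i (m 1 2) q * m 2 1 q)" if "q \<in> V" for i q
    unfolding d_def[abs_def] using that by (simp add: r)
  have smd: "smooth_on V d" unfolding d_def[abs_def] by (simp add: r)
  note F' = F[folded d_def] and D' = D[folded d_def]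
  have dF: "curv C j 1 * fderiv \<beta> i (m 1 l) q + curv C j 2 * fderiv \<beta> i (m 2 l) q =
      d q * (K l 1 * fderiv \<beta> i (m j 1) q + K l 2 * fderiv \<beta> i (m j 2) q)
      + fderiv \<beta> i d q * (K l 1 * m j 1 q + K l 2 * m j 2 q)" if q: "q \<in> V" for i j l q
  proof -
    have "fderiv \<beta> i (\<lambda>q. curv C j 1 * m 1 l q + curv C j 2 * m 2 l q) q =
        fderiv \<beta> i (\<lambda>q. d q * (K l 1 * m j 1 q + K l 2 * m j 2 q)) q"
      by (rule fderiv_cong[OF V q F'])
    then show ?thesis using q by (simp add: r smd)
  qed
  have decomp: "\<exists>x y. \<forall>l. f l = x * m 1 l q + y * m 2 l q" if "q \<in> V" for q and f :: "2 \<Rightarrow> real"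
    using cramer2[OF D[OF that], of "f 1" "f 2"] unfolding forall_2 by metis
  have ind: "x = 0 \<and> y = 0" if "q \<in> V" "\<And>l. x * m 1 l q + y * m 2 l q = 0" for q x y
    using indep2[OF D[OF that(1)] that(2) that(2)] by blast
  show False
  proof (cases "c = 0")
    case True
    note R = nform_curv(2)[OF nf True]
    show False
    proof (cases "h2 = 0")
      case False
      \<comment> \<open>R is conjugate to d times \<open>K\<close>, so its trace 2 *
        \<open>curv C 1 1\<close> would have to vanish.\<close>
      have "curv C 1 1 * m 1 l p = d p * (K l 1 * m 1 1 p + K l 2 * m 1 2 p)"
        "curv C 2 1 * m 1 l p + curv C 1 1 * m 2 l p = d p * (K l 1 * m 2 1 p + K l 2 * m 2 2 p)" for l
        using F'[OF p, of 1 l] F'[OF p, of 2 l] R by simp_all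
      note e = this[of 1] this[of 2]
      have "2 * curv C 1 1 * d p = d p * ((K 1 1 + K 2 2) * d p)"
        using e unfolding d_def by algebra
      with K D'[OF p] have "curv C 1 1 = 0" by simp
      with R False show False by simp
    next
      case h2: True
      with h have n: "curv C 2 1 \<noteq> 0" using R by simp
      have F1: "K l 1 * m 1 1 q + K l 2 * m 1 2 q = 0" if "q \<in> V" for l q
        using F'[OF that, of 1 l] R h2 D'[OF that] by simp
      have F2: "curv C 2 1 * m 1 l q = d q * (K l 1 * m 2 1 q + K l 2 * m 2 2 q)" if "q \<in> V" for l q
        using F'[OF that, of 2 l] R h2 by simp
      have F1d: "K l 1 * fderiv \<beta> i (m 1 1) p + K l 2 * fderiv \<beta> i (m 1 2) p = 0" for l i
        using dF[OF p, of 1 i l] R h2 D'[OF p] F1[OF p] by simp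
      have F2d: "curv C 2 1 * fderiv \<beta> 1 (m 1 l) p = d p * (K l 1 * fderiv \<beta> 1 (m 2 1) p + K l 2 * fderiv \<beta> 1 (m 2 2) p)
          + fderiv \<beta> 1 d p * (K l 1 * m 2 1 p + K l 2 * m 2 2 p)" for l
        using dF[OF p, of 2 1 l] R h2 by simp
      \<comment> \<open>\<open>m 1\<close> spans the kernel of the constant nonzero matrix
        \<open>K\<close>, so its derivatives stay in that line.\<close>
      have par: "\<exists>x. \<forall>l. fderiv \<beta> i (m 1 l) p = x * m 1 l p" for i
      proof -
        obtain x y where xy: "\<And>l. fderiv \<beta> i (m 1 l) p = x * m 1 l p + y * m 2 l p"
          using decomp[OF p, of "\<lambda>l. fderiv \<beta> i (m 1 l) p"] by blast
        have "(y * curv C 2 1) * m 1 l p + 0 * m 2 l p = 0" for l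
          using F1d[of l i] F1[OF p, of l] F2[OF p, of l] unfolding xy by algebra
        from ind[OF p this] n have "y = 0" by simp
        with xy show ?thesis by auto
      qed
      obtain x1 x2 where x: "\<And>l. fderiv \<beta> 1 (m 1 l) p = x1 * m 1 l p" "\<And>l. fderiv \<beta> 2 (m 1 l) p = x2 * m 1 l p"
        using par[of 1] par[of 2] by blast
      obtain y z where yz: "\<And>l. fderiv \<beta> 1 (m 2 l) p = y * m 1 l p + z * m 2 l p"
        using decomp[OF p, of "\<lambda>l. fderiv \<beta> 1 (m 2 l) p"] by blast
      have d1: "fderiv \<beta> 1 d p = (x1 + z) * d p"
        unfolding dd[OF p] x yz d_def by (simp add: algebra_simps)
      have "(2 * z * curv C 2 1) * m 1 l p + 0 * m 2 l p = 0" for l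
        using F2d[of l] F1[OF p, of l] F2[OF p, of l] unfolding x yz d1 by algebra
      from ind[OF p this] n have "z = 0" by simp
      \<comment> \<open>e1 m_2 and e2 m_1 are now both multiples of m_1, so their difference cannot
        be m_2.\<close>
      then have "(y - x2) * m 1 l p + (-1) * m 2 l p = 0" for l
        using t[OF p, of l] unfolding x yz by (simp add: algebra_simps)
      from ind[OF p this] show False by simp
    qed
  next
    case False
    note R = nform_curv(1)[OF nf False]
    have F1: "m 2 l q = d q * (K l 1 * m 1 1 q + K l 2 * m 1 2 q)"
      and F2: "- h1 * m 1 l q = d q * (K l 1 * m 2 1 q + K l 2 * m 2 2 q)" if "q \<in> V" for l q
      using F'[OF that, of 1 l] F'[OF that, of 2 l] R by simp_all
    \<comment> \<open>The matrix of each derivative commutes with R up to its trace. As R is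
      invertible, this trace is zero; what commutes with R and has trace zero is a multiple of
      R.\<close>
    have rot: "\<exists>s. \<forall>l. fderiv \<beta> i (m 1 l) q = s * m 2 l q \<and> fderiv \<beta> i (m 2 l) q = - s * h1 * m 1 l q"
      if q: "q \<in> V" for i q
    proof -
      obtain x s where xs: "\<And>l. fderiv \<beta> i (m 1 l) q = x * m 1 l q + s * m 2 l q"
        using decomp[OF q, of "\<lambda>l. fderiv \<beta> i (m 1 l) q"] by blast
      obtain y z where yz: "\<And>l. fderiv \<beta> i (m 2 l) q = y * m 1 l q + z * m 2 l q"
        using decomp[OF q, of "\<lambda>l. fderiv \<beta> i (m 2 l) q"] by blast
      have d1: "fderiv \<beta> i d q = (x + z) * d q"
        unfolding dd[OF q] xs yz d_def by (simp add: algebra_simps)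
      have e1: "fderiv \<beta> i (m 2 l) q = d q * (K l 1 * fderiv \<beta> i (m 1 1) q + K l 2 * fderiv \<beta> i (m 1 2) q)
          + fderiv \<beta> i d q * (K l 1 * m 1 1 q + K l 2 * m 1 2 q)"
        "- h1 * fderiv \<beta> i (m 1 l) q = d q * (K l 1 * fderiv \<beta> i (m 2 1) q + K l 2 * fderiv \<beta> i (m 2 2) q)
          + fderiv \<beta> i d q * (K l 1 * m 2 1 q + K l 2 * m 2 2 q)" for l
        using dF[OF q, of 1 i l] dF[OF q, of 2 i l] R by simp_all
      have "(y + s * h1) * m 1 l q + (- 2 * x) * m 2 l q = 0" for l
        using e1(1)[of l] F1[OF q, of l] F2[OF q, of l] unfolding xs yz d1 by algebra
      from ind[OF q this] have x: "x = 0" and y: "y = - s * h1" by (auto simp: eq_neg_iff_add_eq_0)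
      have "(2 * z * h1) * m 1 l q + (- s * h1 - y) * m 2 l q = 0" for l
        using e1(2)[of l] F1[OF q, of l] F2[OF q, of l] unfolding xs yz d1 by algebra
      from ind[OF q this] R have "z = 0" by simp
      with x y xs yz show ?thesis by auto
    qed
    have e: "fderiv \<beta> 1 (m 1 l) q = 0" "fderiv \<beta> 1 (m 2 l) q = 0" "fderiv \<beta> 2 (m 1 l) q = - m 2 l q" if q: "q \<in> V" for l q
    proof -
      obtain s1 s2 where s: "\<And>l. fderiv \<beta> 1 (m 1 l) q = s1 * m 2 l q" "\<And>l. fderiv \<beta> 1 (m 2 l) q = - s1 * h1 * m 1 l q"
        "\<And>l. fderiv \<beta> 2 (m 1 l) q = s2 * m 2 l q"
        using rot[OF q, of 1] rot[OF q, of 2] by blast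
      have "(- s1 * h1) * m 1 l q + (- s2 - 1) * m 2 l q = 0" for l
        using t[OF q, of l] unfolding s by (simp add: algebra_simps)
      from ind[OF q this] R have "s1 = 0" "s2 = -1" by auto
      with s show "fderiv \<beta> 1 (m 1 l) q = 0" "fderiv \<beta> 1 (m 2 l) q = 0" "fderiv \<beta> 2 (m 1 l) q = - m 2 l q" by auto
    qed
    \<comment> \<open>Since e1 m = 0 and e2 m_1 = - m_2, the commutation rule for m_1 reads 0 = -
      m_2.\<close>
    have "m 2 l p = 0" for l
    proof -
      have "fderiv \<beta> 1 (fderiv \<beta> 2 (m 1 l)) p = fderiv \<beta> 1 (\<lambda>q. 0 - m 2 l q) p"
        by (rule fderiv_cong[OF V p]) (simp add: e)
      moreover have "fderiv \<beta> 2 (fderiv \<beta> 1 (m 1 l)) p = fderiv \<beta> 2 (\<lambda>q. 0) p"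
        by (rule fderiv_cong[OF V p]) (simp add: e)
      moreover have "fderiv \<beta> 1 (\<lambda>q. 0 - m 2 l q) p = 0"
        by (simp only: fderiv_diff[OF V smooth_on_const[OF V] sm p] fderiv_const[OF V] e[OF p])
      ultimately show ?thesis
        using fderiv_commute[OF V sm p, of \<beta> 1 l] e(3)[OF p] by (simp add: fderiv_const[OF V])
    qed
    with D[OF p] show False by simp
  qed
qed

lemma not_type_A_nform:
  assumes fr: "framed \<beta> 1 C C'" and nf: "nform C' c h1 h2" and h: "h1 \<noteq> 0 \<or> h2 \<noteq> 0"
    and sym: "\<And>k. C 2 1 k = C 1 2 k"
  shows "\<not> type_A half_plane (conn C)"
proof
  assume "type_A half_plane (conn C)"
  then obtain V W \<phi> G where V: "vector [1, 0] \<in> V" "V \<subseteq> half_plane" "diffeo V \<phi> W"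
    "is_pullback V \<phi> (\<lambda>_. G) (conn C)"
    unfolding type_A_def using point_in_half_plane by blast
  have o: "open V" and s: "\<And>l. smooth_on V (\<lambda>q. \<phi> q $ l)"
    using V(3) by (auto simp: diffeo_def smooth_map_on_def)
  define m where "m i l = fderiv \<beta> i (\<lambda>q. \<phi> q $ l)" for i l
  have sm: "smooth_on V (m i l)" for i l unfolding m_def by (rule smooth_fderiv[OF o s])
  have D: "m 1 1 q * m 2 2 q - m 1 2 q * m 2 1 q \<noteq> 0" if "q \<in> V" for q
  proof -
    have "m 1 1 q * m 2 2 q - m 1 2 q * m 2 1 q = (q $ 1)\<^sup>2 *
      (partial 1 (\<lambda>q. \<phi> q $ 1) q * partial 2 (\<lambda>q. \<phi> q $ 2) q - partial 2 (\<lambda>q. \<phi> q $ 1) q * partial 1 (\<lambda>q. \<phi> q $ 2) q)"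
      by (simp add: m_def fderiv_def algebra_simps power2_eq_square)
    then show ?thesis using diffeo_jacobian[OF V(3) that] half_plane_pos[of q] V(2) that by auto
  qed
  have t: "fderiv \<beta> 1 (m 2 l) q - fderiv \<beta> 2 (m 1 l) q = m 2 l q" if "q \<in> V" for q l
    unfolding m_def by (rule fderiv_commute[OF o s that])
  note e = chart_frame[OF o V(2) s V(4) fr sym, folded m_def]
  \<comment> \<open>\<open>t\<close> says that the torsion of \<open>G\<close> vanishes on the
    frame; the nonzero determinant transfers this to the coordinates.\<close>
  have Gs: "G 2 1 l = G 1 2 l" for l
  proof -
    have "(G 2 1 l - G 1 2 l) * (m 1 1 (vector [1, 0]) * m 2 2 (vector [1, 0]) - m 1 2 (vector [1, 0]) * m 2 1 (vector [1, 0])) = 0"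
      using t[OF V(1), of l] unfolding e(2,3)[OF V(1)] quad_def by (simp add: algebra_simps)
    with D[OF V(1)] show ?thesis by simp
  qed
  have sym': "C' 2 1 k = C' 1 2 k" for k
    using nf exhaust_2[of k] unfolding nform_def by (metis consts6_simps)
  note F = frame_integrability[of V m C' \<beta> G, OF o sm sym' e Gs]
  show False
    by (rule nform_no_constant_frame[of V "vector [1, 0]" m \<beta> C'
          "\<lambda>l b. G 1 1 l * G 2 b 1 + G 1 2 l * G 2 b 2 - G 2 1 l * G 1 b 1 - G 2 2 l * G 1 b 2",
          OF o V(1) sm D t F _ nf h]) (simp_all add: algebra_simps)
qed

subsection \<open>Connections of Type C\<close>

definition hmetric :: "real \<Rightarrow> point \<Rightarrow> real^2^2" where
  "hmetric \<epsilon> p = (\<chi> i j. if i = j then (if i = 1 then 1 else \<epsilon>) / (p $ 1)\<^sup>2 else 0)"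

lemma ginner_hmetric: "ginner (hmetric \<epsilon>) p v w = (v $ 1 * w $ 1 + \<epsilon> * v $ 2 * w $ 2) / (p $ 1)\<^sup>2"
  by (simp add: ginner_def hmetric_def matrix_vector_mult_def inner_vec_def sum_2 add_divide_distrib algebra_simps)

text \<open>The hyperbolic plane for \<epsilon> = 1 and its Lorentzian counterpart for \<epsilon> =
  -1. One metric on the whole half plane serves at every point, with sectional curvature -1 in both
  cases.\<close>

lemma type_C_hmetric:
  assumes e: "\<epsilon>\<^sup>2 = 1"
  shows "type_C half_plane (conn (consts6 (-1) 0 0 (-1) \<epsilon> 0))"
proof -
  define N where "N = consts6 (-1) 0 0 (-1) \<epsilon> 0"
  have N: "N 1 1 1 = -1" "N 1 1 2 = 0" "N 1 2 1 = 0" "N 1 2 2 = -1" "N 2 1 1 = 0" "N 2 1 2 = -1" "N 2 2 1 = \<epsilon>" "N 2 2 2 = 0"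
    by (simp_all add: N_def)
  have curv: "curv N 1 1 = 0" "curv N 2 1 = - \<epsilon>" "curv N 1 2 = 1" "curv N 2 2 = 0"
    by (simp_all add: curv_def N)
  have nf: "\<not> flat half_plane (conn N)"
    unfolding flat_conn_iff using curv(3) by force
  have "metric_on half_plane (hmetric \<epsilon>)"
    unfolding metric_on_def
  proof (intro conjI allI ballI)
    fix i j :: 2
    have "smooth_on half_plane (\<lambda>p. (if i = 1 then 1 else \<epsilon>) / (p $ 1)\<^sup>2)"
      by (intro smooth_intros open_half_plane) (simp add: half_plane_def)
    moreover have "smooth_on half_plane (\<lambda>p. 0)" by (intro smooth_intros open_half_plane)
    ultimately show "smooth_on half_plane (\<lambda>p. hmetric \<epsilon> p $ i $ j)"
      by (cases "i = j") (simp_all add: hmetric_def)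
  next
    fix p :: point assume "p \<in> half_plane"
    then show "transpose (hmetric \<epsilon> p) = hmetric \<epsilon> p" "det (hmetric \<epsilon> p) \<noteq> 0"
      using e by (auto simp: half_plane_def hmetric_def transpose_def vec_eq_iff det_2)
  qed
  moreover have "levi_civita half_plane (hmetric \<epsilon>) (conn N)"
    unfolding levi_civita_def
  proof (intro conjI allI impI ballI)
    fix X Y :: vfield and p :: point
    assume XY: "vector_field half_plane X \<and> vector_field half_plane Y" and p: "p \<in> half_plane"
    show "cov_deriv (conn N) X Y p - cov_deriv (conn N) Y X p = lie_bracket X Y p"
      by (simp add: vec_eq_iff forall_2 cov_deriv_def lie_bracket_def sum_2 conn_def N algebra_simps)
  next
    fix X Y Z :: vfield and p :: point
    assume XYZ: "vector_field half_plane X \<and> vector_field half_plane Y \<and> vector_field half_plane Z"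
      and p: "p \<in> half_plane"
    have d: "(\<lambda>q. Y q $ i) differentiable at p" "(\<lambda>q. Z q $ i) differentiable at p" for i
      using XYZ smooth_on_differentiable[OF open_half_plane vector_field_comp_smooth p] by auto
    show "directional X (\<lambda>q. ginner (hmetric \<epsilon>) q (Y q) (Z q)) p =
           ginner (hmetric \<epsilon>) p (cov_deriv (conn N) X Y p) (Z p) + ginner (hmetric \<epsilon>) p (Y p) (cov_deriv (conn N) X Z p)"
      using half_plane_pos[OF p] unfolding ginner_hmetric directional_def sum_2
      by (simp add: power2_eq_square partial_simps d cov_deriv_def directional_def sum_2 conn_def N)
        (simp add: field_simps)
  qed
  moreover have "const_sectional half_plane (hmetric \<epsilon>) (conn N)"
    unfolding const_sectional_def
  proof (intro exI[of _ "-1"] ballI allI impI)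
    fix p :: point and v w :: "real^2"
    assume p: "p \<in> half_plane"
      and nz: "ginner (hmetric \<epsilon>) p v v * ginner (hmetric \<epsilon>) p w w - (ginner (hmetric \<epsilon>) p v w)\<^sup>2 \<noteq> 0"
    note x = half_plane_pos[OF p]
    have c: "curvature (conn N) (\<lambda>_. v) (\<lambda>_. w) (\<lambda>_. w) p $ k =
        (v $ 1 * w $ 2 - v $ 2 * w $ 1) * (w $ 1 * curv N 1 k + w $ 2 * curv N 2 k) / (p $ 1)\<^sup>2" for k
      by (rule curvature_conn[OF open_half_plane order_refl p]) (intro smooth_map_on_const open_half_plane)+
    have "ginner (hmetric \<epsilon>) p (curvature (conn N) (\<lambda>_. v) (\<lambda>_. w) (\<lambda>_. w) p) v =
      - \<epsilon> * (v $ 1 * w $ 2 - v $ 2 * w $ 1)\<^sup>2 / (p $ 1)^4"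
      unfolding ginner_hmetric c curv using x by (simp add: field_simps power2_eq_square power4_eq_xxxx)
    moreover have "ginner (hmetric \<epsilon>) p v v * ginner (hmetric \<epsilon>) p w w - (ginner (hmetric \<epsilon>) p v w)\<^sup>2 =
      \<epsilon> * (v $ 1 * w $ 2 - v $ 2 * w $ 1)\<^sup>2 / (p $ 1)^4"
    proof -
      have "(v $ 1 * v $ 1 + \<epsilon> * v $ 2 * v $ 2) * (w $ 1 * w $ 1 + \<epsilon> * w $ 2 * w $ 2)
          - (v $ 1 * w $ 1 + \<epsilon> * v $ 2 * w $ 2)\<^sup>2 = \<epsilon> * (v $ 1 * w $ 2 - v $ 2 * w $ 1)\<^sup>2"
        by (simp add: algebra_simps power2_eq_square)
      then show ?thesis
        unfolding ginner_hmetric power_divide times_divide_times_eq by (simp add: diff_divide_distrib[symmetric])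
    qed
    ultimately show "sectional (hmetric \<epsilon>) (conn N) p v w = -1"
      unfolding sectional_def using nz by simp
  qed
  ultimately show ?thesis
    using nf locally_homogeneous_conn open_half_plane unfolding type_C_def N_def[symmetric] by blast
qed

text \<open>A parallel metric makes the curvature skew-adjoint, which the curvature matrix of an \<open>nform\<close> with
  \<open>c = 0\<close> is not for any nondegenerate metric.\<close>

lemma not_type_C_nform:
  assumes nf: "nform C 0 h1 h2" and h: "h1 \<noteq> 0 \<or> h2 \<noteq> 0"
  shows "\<not> type_C half_plane (conn C)"
proof
  assume "type_C half_plane (conn C)"
  then obtain V g where V: "open V" "vector [1, 0] \<in> V" "V \<subseteq> half_plane" and m: "metric_on V g"
    and lc: "levi_civita V g (conn C)"
    unfolding type_C_def using point_in_half_plane by blast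
  define p where "p = (vector [1, 0] :: point)"
  have p: "p \<in> V" using V by (simp add: p_def)
  define f where "f i j q = g q $ i $ j" for i j q
  have sm: "smooth_on V (f i j)" for i j
    using m unfolding metric_on_def f_def by blast
  have fs: "f 2 1 q = f 1 2 q" if "q \<in> V" for q
  proof -
    have "transpose (g q) $ 1 $ 2 = g q $ 1 $ 2" using m that by (simp add: metric_on_def)
    then show ?thesis by (simp add: transpose_def f_def)
  qed
  have det: "f 1 1 p * f 2 2 p - f 1 2 p * f 2 1 p \<noteq> 0"
    using m p by (simp add: metric_on_def det_2 f_def)
  have sym: "C 2 1 k = C 1 2 k" for k
    using nf exhaust_2[of k] unfolding nform_def by (metis consts6_simps)
  \<comment> \<open>The parallel metric tested on coordinate fields, cut off because vector fields
    on \<open>V\<close> are normalised to 0 outside.\<close>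
  have e: "fderiv 0 k (f i j) q = C k i 1 * f 1 j q + C k i 2 * f 2 j q + C k j 1 * f i 1 q + C k j 2 * f i 2 q"
    if q: "q \<in> V" for i j k q
  proof -
    let ?R = "\<lambda>i. restrict_vf V (\<lambda>_. axis i 1)"
    have x: "q $ 1 > 0" using half_plane_pos q V by blast
    have R: "?R i r $ l = axis i 1 $ l" if "r \<in> V" for i l r using that by (simp add: restrict_vf_def)
    have f0: "ginner g r (?R i r) v = (\<Sum>l\<in>UNIV. f i l r * v $ l)" "ginner g r v (?R j r) = (\<Sum>l\<in>UNIV. f l j r * v $ l)"
      if "r \<in> V" for i j r v
      using that exhaust_2[of i] exhaust_2[of j]
      by (auto simp: ginner_def inner_vec_def matrix_vector_mult_def sum_2 restrict_vf_def f_def algebra_simps)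
    have dc: "partial l (\<lambda>r. ?R i r $ n) q = 0" for l i n
      using partial_cong[OF V(1) q, of "\<lambda>r. ?R i r $ n" "\<lambda>r. axis i 1 $ n" l] R by simp
    have cd: "cov_deriv (conn C) (?R k) (?R i) q $ l = C k i l / q $ 1" for i l
      using exhaust_2[of k] exhaust_2[of i]
      by (auto simp: cov_deriv_def directional_def dc sum_2 R[OF q] conn_def)
    have fij: "partial l (\<lambda>r. ginner g r (?R i r) (?R j r)) q = partial l (f i j) q" for l
      by (rule partial_cong[OF V(1) q]) (use exhaust_2[of j] in \<open>auto simp: f0(1) sum_2 R\<close>)
    have "directional (?R k) (\<lambda>r. ginner g r (?R i r) (?R j r)) q =
        ginner g q (cov_deriv (conn C) (?R k) (?R i) q) (?R j q) + ginner g q (?R i q) (cov_deriv (conn C) (?R k) (?R j) q)"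
      using lc q vector_field_restrict_const[OF V(1)] unfolding levi_civita_def by blast
    then have "partial k (f i j) q = (C k i 1 * f 1 j q + C k i 2 * f 2 j q + C k j 1 * f i 1 q + C k j 2 * f i 2 q) / q $ 1"
      using exhaust_2[of k] unfolding f0[OF q] cd directional_def fij sum_2 R[OF q]
      by (auto simp: add_divide_distrib algebra_simps)
    then show ?thesis using x exhaust_2[of k] by (auto simp: fderiv_def)
  qed
  note r = fderiv_rules[OF V(1)] smooth_on_const[OF V(1)] smooth_on_add[OF V(1)] smooth_on_mult[OF V(1)] sm p
  have E: "fderiv 0 n (fderiv 0 k (f i j)) p = C k i 1 * fderiv 0 n (f 1 j) p + C k i 2 * fderiv 0 n (f 2 j) p
      + C k j 1 * fderiv 0 n (f i 1) p + C k j 2 * fderiv 0 n (f i 2) p" for n k i j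
    using fderiv_cong[OF V(1) p, of "fderiv 0 k (f i j)"
        "\<lambda>q. C k i 1 * f 1 j q + C k i 2 * f 2 j q + C k j 1 * f i 1 q + C k j 2 * f i 2 q" 0 n] e by (simp add: r)
  \<comment> \<open>The bracket [e1, e2] = e2 applied to the entries of the metric.\<close>
  have skew: "curv C i 1 * f 1 j p + curv C i 2 * f 2 j p + curv C j 1 * f i 1 p + curv C j 2 * f i 2 p = 0" for i j
    using fderiv_commute[OF V(1) sm p, of 0 i j] exhaust_2[of i] exhaust_2[of j]
    unfolding E e[OF p] by (elim disjE) (simp_all add: curv_def sym fs[OF p] algebra_simps)
  note R = nform_curv(2)[OF nf refl]
  have R': "curv C 1 2 = 0" "curv C 2 2 = curv C 1 1" using R by simp_all
  have 1: "curv C 1 1 * f 1 1 p = 0" "2 * curv C 1 1 * f 1 2 p + curv C 2 1 * f 1 1 p = 0"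
    "curv C 1 1 * f 2 2 p + curv C 2 1 * f 1 2 p = 0"
    using skew[of 1 1] skew[of 1 2] skew[of 2 2] R' fs[OF p] by (simp_all add: algebra_simps)
  \<comment> \<open>In both cases the entries 11 and 12 of the metric vanish at \<open>p\<close>, so
    it degenerates there.\<close>
  show False
  proof (cases "h2 = 0")
    case True
    then have "curv C 1 1 = 0" "curv C 2 1 \<noteq> 0" using R h by auto
    with 1 det fs[OF p] show False by simp
  next
    case False
    then have "curv C 1 1 \<noteq> 0" using R by simp
    with 1 det fs[OF p] show False by simp
  qed
qed

subsection \<open>The classification\<close>

text \<open>Rescaling y multiplies each constant by a power of \<gamma>, whose exponent is the
  number of lower indices 2 minus the number of upper ones.\<close>

lemma framed_rescale:
  assumes fr: "framed \<beta> 1 C C1" and nf: "nform C1 c h1 h2" and g: "\<gamma> \<noteq> 0"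
  shows "framed \<beta> \<gamma> C (consts6 (-3/2 - c * h1 / 2) (- c * h2 / 2 / \<gamma>) (\<gamma> * (h2 / 2)) ((c * h1 - 1) / 2)
    (\<gamma>\<^sup>2 * h1) (\<gamma> * h2))"
proof -
  have C1: "C1 1 1 1 = -3/2 - c * h1 / 2" "C1 1 1 2 = - c * h2 / 2" "C1 1 2 1 = h2 / 2"
    "C1 1 2 2 = (c * h1 - 1) / 2" "C1 2 2 1 = h1" "C1 2 2 2 = h2"
    using nf unfolding nform_def by (metis consts6_simps)+
  have f: "C 1 2 1 = C 2 1 1" "C 1 2 2 = C 2 1 2"
    "-3/2 - c * h1 / 2 = C 1 1 1 + 2 * \<beta> * C 1 2 1 + \<beta>\<^sup>2 * C 2 2 1"
    "\<beta> * (-3/2 - c * h1 / 2) + - c * h2 / 2 = C 1 1 2 + 2 * \<beta> * C 1 2 2 + \<beta>\<^sup>2 * C 2 2 2"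
    "h2 / 2 = C 1 2 1 + \<beta> * C 2 2 1"
    "\<beta> * (h2 / 2) + (c * h1 - 1) / 2 = C 1 2 2 + \<beta> * C 2 2 2"
    "h1 = C 2 2 1" "\<beta> * h1 + h2 = C 2 2 2"
    using fr unfolding framed_def C1 power_one mult_1 by blast+
  show ?thesis
    unfolding framed_def consts6_simps
  proof (intro conjI refl g f(1,2))
    show "-3/2 - c * h1 / 2 = C 1 1 1 + 2 * \<beta> * C 1 2 1 + \<beta>\<^sup>2 * C 2 2 1" by (rule f)
    show "\<beta> * (-3/2 - c * h1 / 2) + \<gamma> * (- c * h2 / 2 / \<gamma>) = C 1 1 2 + 2 * \<beta> * C 1 2 2 + \<beta>\<^sup>2 * C 2 2 2"
      using g f(4) by simp
    show "\<gamma> * (h2 / 2) = \<gamma> * (C 1 2 1 + \<beta> * C 2 2 1)" unfolding f(5)[symmetric] ..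
    show "\<beta> * (\<gamma> * (h2 / 2)) + \<gamma> * ((c * h1 - 1) / 2) = \<gamma> * (C 1 2 2 + \<beta> * C 2 2 2)"
      unfolding f(6)[symmetric] by (simp add: algebra_simps)
    show "\<gamma>\<^sup>2 * h1 = \<gamma>\<^sup>2 * C 2 2 1" unfolding f(7) ..
    show "\<beta> * (\<gamma>\<^sup>2 * h1) + \<gamma> * (\<gamma> * h2) = \<gamma>\<^sup>2 * C 2 2 2"
      unfolding f(8)[symmetric] by (simp add: algebra_simps power2_eq_square)
  qed
qed

lemma nform_N:
  "nform N1_plus 0 (-1/2) 0" "nform N1_minus 0 (1/2) 0" "nform (N2 c) 0 c 2" "nform N3 1 (-1) 0" "nform N4 (-1) 1 0"
  by (simp_all add: nform_def N1_plus_def N1_minus_def N2_def N3_def N4_def)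

lemma framed_nform_refl: "nform C c h1 h2 \<Longrightarrow> framed 0 1 C C"
  by (simp add: nform_def framed_def)

lemma nform_normalize:
  assumes fr: "framed \<beta> 1 C C1" and nf: "nform C1 c h1 h2" and h: "h1 \<noteq> 0 \<or> h2 \<noteq> 0"
  obtains \<gamma> N where "framed \<beta> \<gamma> C N" "N = N1_plus \<or> N = N1_minus \<or> (\<exists>c. N = N2 c) \<or> N = N3 \<or> N = N4"
  using nf
proof (cases rule: nform_cases)
  case 2
  \<comment> \<open>Since c h1 = -1, this \<gamma> turns the constant 22/1 into - sgn c:
    \<open>N3\<close> for positive c and \<open>N4\<close> for negative c.\<close>
  define \<gamma> where "\<gamma> = sqrt \<bar>c\<bar>"
  have g: "\<gamma> \<noteq> 0" "\<gamma>\<^sup>2 = \<bar>c\<bar>" using 2 by (simp_all add: \<gamma>_def)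
  have "\<gamma>\<^sup>2 * h1 = - sgn c" using 2(3) g by (auto simp: abs_if sgn_if)
  with framed_rescale[OF fr nf g(1)] 2 have "framed \<beta> \<gamma> C (consts6 (-1) 0 0 (-1) (- sgn c) 0)" by simp
  moreover have "consts6 (-1) 0 0 (-1) (- sgn c) 0 = N3 \<or> consts6 (-1) 0 0 (-1) (- sgn c) 0 = N4"
    using 2 by (simp add: sgn_if N3_def N4_def)
  ultimately show ?thesis using that by blast
next
  case c: 1
  show ?thesis
  proof (cases "h2 = 0")
    case True
    \<comment> \<open>Brings \<gamma>^2 h1 to 1/2 in absolute value; its sign, which no rescaling
      changes, selects the model.\<close>
    define \<gamma> where "\<gamma> = 1 / sqrt (2 * \<bar>h1\<bar>)"
    have h1: "h1 \<noteq> 0" using True h by simp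
    then have g: "\<gamma> \<noteq> 0" by (simp add: \<gamma>_def)
    have "\<gamma>\<^sup>2 = 1 / (2 * \<bar>h1\<bar>)" by (simp add: \<gamma>_def power_divide)
    then have "\<gamma>\<^sup>2 * h1 = sgn h1 / 2" using h1 by (simp add: sgn_if)
    with framed_rescale[OF fr nf g] c True have "framed \<beta> \<gamma> C (consts6 (-3/2) 0 0 (-1/2) (sgn h1 / 2) 0)" by simp
    moreover have "consts6 (-3/2) 0 0 (-1/2) (sgn h1 / 2) 0 = N1_plus \<or> consts6 (-3/2) 0 0 (-1/2) (sgn h1 / 2) 0 = N1_minus"
      using h1 by (simp add: sgn_if N1_plus_def N1_minus_def)
    ultimately show ?thesis using that by blast
  next
    case False
    \<comment> \<open>\<gamma> may be negative, so \<gamma> h2 = 2 can be reached for either sign of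
      h2; what becomes of h1 is the parameter of \<open>N2\<close>.\<close>
    define \<gamma> where "\<gamma> = 2 / h2"
    have g: "\<gamma> \<noteq> 0" "\<gamma> * h2 = 2" "\<gamma> * (h2 / 2) = 1" using False by (simp_all add: \<gamma>_def)
    from framed_rescale[OF fr nf g(1)] c have "framed \<beta> \<gamma> C (N2 (\<gamma>\<^sup>2 * h1))"
      unfolding g N2_def by simp
    then show ?thesis using that by blast
  qed
qed

text \<open>A Killing field outside \<open>K0B\<close> has a nonzero matrix A at some point, and the
  values of solutions at that point feed the algebraic alternatives.\<close>

lemma killing_cases:
  assumes C: "\<And>i j k. C i j k = C j i k" and nf: "\<not> flat half_plane (conn C)"
  shows "C 1 2 1 = 0 \<and> C 2 2 1 = 0 \<and> C 2 2 2 = 0 \<or> killing C = K0B \<or>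
    (\<exists>\<beta> c h1 h2 C'. framed \<beta> 1 C C' \<and> nform C' c h1 h2 \<and> (h1 \<noteq> 0 \<or> h2 \<noteq> 0))"
proof (cases "killing C = K0B")
  case False
  then obtain X where X: "X \<in> killing C" "X \<notin> K0B" using K0B_subset_killing by blast
  have sym: "C 2 1 k = C 1 2 k" for k by (rule C)
  have "framed 0 1 C C" using sym by (simp add: framed_def)
  note s = A_system_kA[OF X(1) this]
  obtain p where "p \<in> half_plane" "kA 0 1 X p \<noteq> 0"
    using kA_zero_imp_K0B[OF killing_vector_field[OF X(1)], of 0 1] X(2) by auto
  from A_system_cases[where C = C, OF sym s this] nf
  consider "C 1 2 1 = 0 \<and> C 2 2 1 = 0 \<and> C 2 2 2 = 0" | v where "v $ 2 = 1" "dA2 C v = 0" "dA1 C v = v"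
    unfolding flat_conn_iff by blast
  then show ?thesis
  proof cases
    case 2
    obtain \<beta> c h1 h2 C' where f: "framed \<beta> 1 C C'" and n: "nform C' c h1 h2"
      by (rule nform_exists[where C = C, OF sym 2])
    show ?thesis
    proof (cases "h1 \<noteq> 0 \<or> h2 \<noteq> 0")
      case True
      with f n show ?thesis by blast
    next
      \<comment> \<open>Vanishing h1 and h2 lead back to the first alternative.\<close>
      case False
      then have "C 2 2 1 = 0" "C 2 2 2 = 0" "C 1 2 1 = 0"
        using framed_nform_values(1-3)[OF f n] by simp_all
      then show ?thesis by simp
    qed
  qed simp
qed simp

lemma N_properties:
  assumes "N = N1_plus \<or> N = N1_minus \<or> (\<exists>c. N = N2 c) \<or> N = N3 \<or> N = N4"
  shows "dim (killing N) = 3" "N i j k = N j i k" "\<exists>l k. curv N l k \<noteq> 0"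
    "\<exists>\<sigma>. \<sigma> \<in> {-1, 0, 1} \<and> is_direct_sum (killing N) (span {X_field \<sigma>}) K0B \<and>
        (\<sigma> = 0 \<and> (N = N1_plus \<or> N = N1_minus) \<and> \<not> type_C half_plane (conn N)
         \<or> \<sigma> = 0 \<and> (\<exists>c. N = N2 c) \<and> \<not> type_C half_plane (conn N)
         \<or> \<sigma> = 1 \<and> N = N3 \<and> type_C half_plane (conn N)
         \<or> \<sigma> = -1 \<and> N = N4 \<and> type_C half_plane (conn N))"
proof -
  obtain c h1 h2 where n: "nform N c h1 h2" and h: "h1 \<noteq> 0 \<or> h2 \<noteq> 0"
    and c: "c = 0 \<and> (N = N1_plus \<or> N = N1_minus \<or> (\<exists>c. N = N2 c)) \<or> c = 1 \<and> N = N3 \<or> c = -1 \<and> N = N4"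
    using assms
  proof (elim disjE exE)
    fix e assume "N = N2 e" then show thesis using that[of 0 e 2] nform_N(3)[of e] by auto
  qed (use that[of 0 "-1/2" 0] that[of 0 "1/2" 0] that[of 1 "-1" 0] that[of "-1" 1 0] nform_N in auto)
  note f = framed_nform_refl[OF n]
  show "dim (killing N) = 3" by (rule iso_su11_nform(2)[OF f n h])
  show "N i j k = N j i k"
    using n unfolding nform_def by (metis consts6_sym)
  show "\<exists>l k. curv N l k \<noteq> 0"
  proof (cases "c = 0")
    case True
    have "curv N 1 1 \<noteq> 0 \<or> curv N 2 1 \<noteq> 0" using nform_curv(2)[OF n True] h by (cases "h2 = 0") auto
    then show ?thesis by blast
  next
    case False
    from nform_curv(1)[OF n False] have "curv N 1 2 \<noteq> 0" by simp
    then show ?thesis by blast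
  qed
  note d = direct_sum_nform[OF f n h]
  have nC: "\<not> type_C half_plane (conn N)" if "c = 0"
    using not_type_C_nform[OF _ h] n unfolding that by blast
  have tC: "type_C half_plane (conn N3)" "type_C half_plane (conn N4)"
    using type_C_hmetric[of "-1"] type_C_hmetric[of 1] by (simp_all add: N3_def N4_def)
  consider "c = 0" "N = N1_plus \<or> N = N1_minus" | "c = 0" "\<exists>c. N = N2 c" | "c = 1" "N = N3" | "c = -1" "N = N4"
    using c by blast
  then show "\<exists>\<sigma>. \<sigma> \<in> {-1, 0, 1} \<and> is_direct_sum (killing N) (span {X_field \<sigma>}) K0B \<and>
        (\<sigma> = 0 \<and> (N = N1_plus \<or> N = N1_minus) \<and> \<not> type_C half_plane (conn N)
         \<or> \<sigma> = 0 \<and> (\<exists>c. N = N2 c) \<and> \<not> type_C half_plane (conn N)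
         \<or> \<sigma> = 1 \<and> N = N3 \<and> type_C half_plane (conn N)
         \<or> \<sigma> = -1 \<and> N = N4 \<and> type_C half_plane (conn N))"
    by cases (rule exI[of _ c], use d nC tC in simp)+
qed

theorem theorem3p11:
  fixes C :: "2 \<Rightarrow> 2 \<Rightarrow> 2 \<Rightarrow> real"
  assumes "\<And>i j k. C i j k = C j i k"
    and "\<not> flat half_plane (conn C)"
  shows
    "(2 \<le> dim (killing C) \<and> dim (killing C) \<le> 4) \<and>
     (dim (killing C) = 4 \<longrightarrow>
      (\<exists>r. ricci_11 C r) \<and> C 1 2 1 = 0 \<and> C 2 2 1 = 0 \<and> C 2 2 2 = 0 \<and>
      type_A half_plane (conn C) \<and>
      (\<exists>C'. lin_equiv C' C \<and>
        (struct_1a C' \<and>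
           is_direct_sum (killing C')
             (span {hp_field (\<lambda>x y. x) (\<lambda>x y. - x * ln x), hp_field (\<lambda>x y. 0) (\<lambda>x y. x)}) K0B
         \<or> struct_1b C' \<and>
           (\<exists>a. a \<noteq> 0 \<and> is_direct_sum (killing C')
             (span {hp_field (\<lambda>x y. x) (\<lambda>x y. 0), hp_field (\<lambda>x y. 0) (\<lambda>x y. x powr a)}) K0B)
         \<or> struct_1c C' \<and>
           is_direct_sum (killing C')
             (span {hp_field (\<lambda>x y. x) (\<lambda>x y. 0), hp_field (\<lambda>x y. 0) (\<lambda>x y. ln x)}) K0B))) \<and>
     (dim (killing C) = 3 \<longrightarrow>
      iso_su11 (killing C) \<and> \<not> type_A half_plane (conn C) \<and>
      (\<exists>C' \<sigma>. lin_equiv C' C \<and> \<sigma> \<in> {-1, 0, 1} \<and>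
        is_direct_sum (killing C') (span {X_field \<sigma>}) K0B \<and>
        (\<sigma> = 0 \<and> (C' = N1_plus \<or> C' = N1_minus) \<and> \<not> type_C half_plane (conn C')
         \<or> \<sigma> = 0 \<and> (\<exists>c. C' = N2 c) \<and> \<not> type_C half_plane (conn C')
         \<or> \<sigma> = 1 \<and> C' = N3 \<and> type_C half_plane (conn C')
         \<or> \<sigma> = -1 \<and> C' = N4 \<and> type_C half_plane (conn C')))) \<and>
     (\<forall>D. (\<forall>i j k. D i j k = D j i k) \<and> (struct_1a D \<or> struct_1b D \<or> struct_1c D) \<longrightarrow>
      dim (killing D) = 4) \<and>
     (\<forall>D. D = N1_plus \<or> D = N1_minus \<or> (\<exists>c. D = N2 c) \<or> D = N3 \<or> D = N4 \<longrightarrow>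
      dim (killing D) = 3)"
proof -
  note C = assms(1) and nf = assms(2)
  have sym: "C 2 1 k = C 1 2 k" for k by (rule C)
  let ?R = "C 1 2 1 = 0 \<and> C 2 2 1 = 0 \<and> C 2 2 2 = 0"
  have rank1: "dim (killing C) = 4" if ?R
  proof (rule dim_killing_rank1[OF sym])
    show "(1 + C 1 1 1 - C 1 2 2) * C 1 2 2 \<noteq> 0"
      using nf curv_rank1[where C = C, OF sym] that unfolding flat_conn_iff forall_2 by auto
  qed (use that in auto)
  define P where "P \<longleftrightarrow> (\<exists>\<beta> c h1 h2 C'. framed \<beta> 1 C C' \<and> nform C' c h1 h2 \<and> (h1 \<noteq> 0 \<or> h2 \<noteq> 0))"
  have su: "dim (killing C) = 3" if P using that iso_su11_nform(2) unfolding P_def by blast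
  \<comment> \<open>The three alternatives have the dimensions 4, 2 and 3, so that the dimension in
    turn identifies the alternative.\<close>
  have cases: "?R \<and> dim (killing C) = 4 \<or> dim (killing C) = 2 \<or> P \<and> dim (killing C) = 3"
  proof -
    consider ?R | "killing C = K0B" | P using killing_cases[OF C nf, folded P_def] by blast
    then show ?thesis
    proof cases
      case 1
      with rank1[OF 1] show ?thesis by simp
    next
      case 2
      with dim_K0B show ?thesis by simp
    next
      case 3
      with su[OF 3] show ?thesis by simp
    qed
  qed
  then have dims: "2 \<le> dim (killing C) \<and> dim (killing C) \<le> 4" by (elim disjE) simp_all
  have R: "C 1 2 1 = 0" "C 2 2 1 = 0" "C 2 2 2 = 0" if "dim (killing C) = 4"
    using cases that by (elim disjE; simp)+
  have three: "iso_su11 (killing C) \<and> \<not> type_A half_plane (conn C) \<and>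
      (\<exists>C' \<sigma>. lin_equiv C' C \<and> \<sigma> \<in> {-1, 0, 1} \<and>
        is_direct_sum (killing C') (span {X_field \<sigma>}) K0B \<and>
        (\<sigma> = 0 \<and> (C' = N1_plus \<or> C' = N1_minus) \<and> \<not> type_C half_plane (conn C')
         \<or> \<sigma> = 0 \<and> (\<exists>c. C' = N2 c) \<and> \<not> type_C half_plane (conn C')
         \<or> \<sigma> = 1 \<and> C' = N3 \<and> type_C half_plane (conn C')
         \<or> \<sigma> = -1 \<and> C' = N4 \<and> type_C half_plane (conn C')))" if "dim (killing C) = 3"
  proof -
    have P using cases that by (elim disjE) simp_all
    then obtain \<beta> c h1 h2 C1 where f: "framed \<beta> 1 C C1" and n: "nform C1 c h1 h2" and h: "h1 \<noteq> 0 \<or> h2 \<noteq> 0"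
      unfolding P_def by blast
    obtain \<gamma> N where fN: "framed \<beta> \<gamma> C N" and N: "N = N1_plus \<or> N = N1_minus \<or> (\<exists>c. N = N2 c) \<or> N = N3 \<or> N = N4"
      by (rule nform_normalize[OF f n h])
    have "lin_equiv N C" by (rule lin_equivI[OF fN C N_properties(2)[OF N] nf N_properties(3)[OF N]])
    \<comment> \<open>The exclusion of Type A and the isomorphism with su(1,1) are obtained for
      \<open>C\<close> itself, in its sheared frame; the direct sum and Type C concern the model
      \<open>N\<close>.\<close>
    then show ?thesis
      using N_properties(4)[OF N] iso_su11_nform(1)[OF f n h] not_type_A_nform[OF f n h sym]
      by (elim exE) (intro conjI exI[of _ N] exI, assumption+; elim conjE; assumption)
  qed
  show ?thesis
  proof (intro conjI impI allI)
    show "2 \<le> dim (killing C)" "dim (killing C) \<le> 4" using dims by auto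
  next
    assume 4: "dim (killing C) = 4"
    note R = R[OF 4]
    show "C 1 2 1 = 0" "C 2 2 1 = 0" "C 2 2 2 = 0" by (fact R)+
    show "\<exists>r. ricci_11 C r"
      unfolding ricci_11_iff using curv_rank1(1-3)[where C = C, OF sym R] by simp
    show "type_A half_plane (conn C)" by (rule type_A_rank1[OF C R nf])
  next
    fix D :: "2 \<Rightarrow> 2 \<Rightarrow> 2 \<Rightarrow> real"
    assume "(\<forall>i j k. D i j k = D j i k) \<and> (struct_1a D \<or> struct_1b D \<or> struct_1c D)"
    then have "\<And>k. D 2 1 k = D 1 2 k" and "struct_1a D \<or> struct_1b D \<or> struct_1c D" by simp_all
    then show "dim (killing D) = 4" by (rule struct_dim)
  next
    fix D :: "2 \<Rightarrow> 2 \<Rightarrow> 2 \<Rightarrow> real"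
    assume "D = N1_plus \<or> D = N1_minus \<or> (\<exists>c. D = N2 c) \<or> D = N3 \<or> D = N4"
    then show "dim (killing D) = 3" by (rule N_properties(1))
  qed (rule rank1_normal_form[OF C R nf], assumption+,
      rule three[THEN conjunct1], assumption, rule three[THEN conjunct2, THEN conjunct1], assumption,
      rule three[THEN conjunct2, THEN conjunct2], assumption)
qed

end
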